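(* Let $\mathbb A$ be a structure in a finite signature $L$, and let $\mathbb B=\langle B;L\rangle$ be a definable substructure of $\mathbb A$ such that $\mathbb A$ is finitely generated over $\mathbb B$, i.e. there are $x_1,\ldots,x_k\in\mathbb A$ such that every element of $\mathbb A$ equals $\tau(x_1,\ldots,x_k,\bar b)$ for some $L$-term $\tau$ and some tuple $\bar b$ of elements of $B$. Suppose $\mathbb A$ is regularly interpreted in the list superstructure $\mathbb S(\mathbb B,\mathbb N)$ in two ways, $\mathbb A\cong\Gamma_1(\mathbb S(\mathbb B,\mathbb N),\phi_1)$ and $\mathbb A\cong\Gamma_2(\mathbb S(\mathbb B,\mathbb N),\phi_2)$. Suppose there is an isomorphism between $\Gamma_1(\mathbb S(\mathbb B,\mathbb N),\phi_1)$ and $\Gamma_2(\mathbb S(\mathbb B,\mathbb N),\phi_2)$ whose restriction to the interpretation of $\mathbb B$ (i.e. to the image of $B$ inside $\Gamma_1(\mathbb S(\mathbb B,\mathbb N),\phi_1)$) is definable in $\mathbb S(\mathbb B,\mathbb N)$. Then for every structure $\mathcal M\equiv\mathbb S(\mathbb B,\mathbb N)$ we have $\Gamma_1(\mathcal M,\phi_1)\cong\Gamma_2(\mathcal M,\phi_2)$.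
   Context: For a structure $\mathbb A=\langle A;L\rangle$, the list superstructure $\mathbb S(\mathbb A,\mathbb N)=\langle \mathbb A,\mathrm{List}(A),\mathbb N; t(s,a,i),\ell(s)\rangle$ is the three-sorted structure whose sorts are $\mathbb A$, the set $\mathrm{List}(A)$ of all finite tuples of elements of $A$, and the standard arithmetic $\mathbb N=\langle\mathbb N;+,\cdot,0,1\rangle$; $\ell(s)$ is the length of the tuple $s$, and $t(s,a,i)$ holds iff $1\le i\le\ell(s)$ and the $i$-th component of $s$ is $a$. An interpretation of a structure $\mathbb A$ in $\mathbb B$ with parameters $\bar p$ is given by a code $\Gamma$: formulas $U_\Gamma(\bar x,\bar y)$, $E_\Gamma(\bar x,\bar x',\bar y)$ and, for each symbol $Q$ of $L(\mathbb A)$, formulas $Q_\Gamma(\bar x_1,\ldots,\bar x_t,\bar y)$ of $L(\mathbb B)$ such that $U_\Gamma(\mathbb B,\bar p)\subseteq B^n$, $E_\Gamma$ defines an equivalence relation on it, the $Q_\Gamma$ define (preimages of) the constants, operations and relations on the quotient set, and the resulting structure $\Gamma(\mathbb B,\bar p)$ is isomorphic to $\mathbb A$. The interpretation is regular, written $\mathbb A\cong\Gamma(\mathbb B,\phi)$, if there is an $L(\mathbb B)$-formula $\phi(\bar y)$ with $\phi(\mathbb B)\neq\emptyset$ such that $\Gamma(\mathbb B,\bar p)\cong\mathbb A$ for every $\bar p\in\phi(\mathbb B)$. For a structure $\mathcal M$ in the language of $\mathbb B$, $\Gamma(\mathcal M,\phi)$ denotes the structure $\Gamma(\mathcal M,\bar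 p)$ for $\bar p\in\phi(\mathcal M)$ (it is well-defined when these are $L(\mathbb A)$-structures all isomorphic to each other). *)

theory Defs
  imports Main
begin

section \<open>Many-sorted first-order logic with equality\<close>

text \<open>
  Symbols are taken from explicit sets, so that a signature may have no function symbols or no
  relation symbols at all; constants are function symbols with empty domain.  Ordinary one-sorted
  signatures are those whose sort type is \<^typ>\<open>unit\<close>.
\<close>

record ('s, 'f, 'r) sig =
  funs :: "'f set"
  rels :: "'r set"
  fdom :: "'f \<Rightarrow> 's list"
  fcod :: "'f \<Rightarrow> 's"
  rdom :: "'r \<Rightarrow> 's list"

definition finite_sig :: "('s, 'f, 'r) sig \<Rightarrow> bool" where
  "finite_sig L \<longleftrightarrow> finite (funs L) \<and> finite (rels L)"

record ('u, 's, 'f, 'r) struc =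
  carr :: "'s \<Rightarrow> 'u set"
  fn :: "'f \<Rightarrow> 'u list \<Rightarrow> 'u"
  rl :: "'r \<Rightarrow> 'u list \<Rightarrow> bool"

definition tuples :: "('u, 's, 'f, 'r) struc \<Rightarrow> 's list \<Rightarrow> 'u list set" where
  "tuples M ss = {as. list_all2 (\<lambda>a s. a \<in> carr M s) as ss}"

text \<open>The values of \<^const>\<open>fn\<close> and \<^const>\<open>rl\<close> off the tuples of the right sorts are irrelevant.\<close>

definition is_struc :: "('s, 'f, 'r) sig \<Rightarrow> ('u, 's, 'f, 'r) struc \<Rightarrow> bool" where
  "is_struc L M \<longleftrightarrow>
     (\<forall>s. carr M s \<noteq> {}) \<and>
     (\<forall>f \<in> funs L. \<forall>as \<in> tuples M (fdom L f). fn M f as \<in> carr M (fcod L f))"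

definition substruc ::
  "('s, 'f, 'r) sig \<Rightarrow> ('u, 's, 'f, 'r) struc \<Rightarrow> ('u, 's, 'f, 'r) struc \<Rightarrow> bool" where
  "substruc L B A \<longleftrightarrow>
     is_struc L B \<and> is_struc L A \<and>
     (\<forall>s. carr B s \<subseteq> carr A s) \<and>
     (\<forall>f \<in> funs L. \<forall>as \<in> tuples B (fdom L f). fn B f as = fn A f as) \<and>
     (\<forall>r \<in> rels L. \<forall>as \<in> tuples B (rdom L r). rl B r as = rl A r as)"

definition is_iso ::
  "('s, 'f, 'r) sig \<Rightarrow> ('s \<Rightarrow> 'u \<Rightarrow> 'v) \<Rightarrow>
     ('u, 's, 'f, 'r) struc \<Rightarrow> ('v, 's, 'f, 'r) struc \<Rightarrow> bool" where
  "is_iso L h M N \<longleftrightarrow>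
     (\<forall>s. bij_betw (h s) (carr M s) (carr N s)) \<and>
     (\<forall>f \<in> funs L. \<forall>as \<in> tuples M (fdom L f).
        h (fcod L f) (fn M f as) = fn N f (map2 h (fdom L f) as)) \<and>
     (\<forall>r \<in> rels L. \<forall>as \<in> tuples M (rdom L r).
        rl M r as \<longleftrightarrow> rl N r (map2 h (rdom L r) as))"

definition isomorphic ::
  "('s, 'f, 'r) sig \<Rightarrow> ('u, 's, 'f, 'r) struc \<Rightarrow> ('v, 's, 'f, 'r) struc \<Rightarrow> bool" where
  "isomorphic L M N \<longleftrightarrow> (\<exists>h. is_iso L h M N)"

text \<open>A variable is a pair of a sort and an index.\<close>

datatype ('s, 'f) tm = Var 's nat | App 'f "('s, 'f) tm list"

fun tm_sort :: "('s, 'f, 'r) sig \<Rightarrow> ('s, 'f) tm \<Rightarrow> 's" where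
  "tm_sort L (Var s i) = s"
| "tm_sort L (App f ts) = fcod L f"

fun wf_tm :: "('s, 'f, 'r) sig \<Rightarrow> ('s, 'f) tm \<Rightarrow> bool" where
  "wf_tm L (Var s i) = True"
| "wf_tm L (App f ts) =
     (f \<in> funs L \<and> map (tm_sort L) ts = fdom L f \<and> (\<forall>t \<in> set ts. wf_tm L t))"

fun tm_vars :: "('s, 'f) tm \<Rightarrow> ('s \<times> nat) set" where
  "tm_vars (Var s i) = {(s, i)}"
| "tm_vars (App f ts) = (\<Union>t \<in> set ts. tm_vars t)"

fun tm_val :: "('u, 's, 'f, 'r) struc \<Rightarrow> ('s \<times> nat \<Rightarrow> 'u) \<Rightarrow> ('s, 'f) tm \<Rightarrow> 'u" where
  "tm_val M e (Var s i) = e (s, i)"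
| "tm_val M e (App f ts) = fn M f (map (tm_val M e) ts)"

datatype ('s, 'f, 'r) fm =
    Eq "('s, 'f) tm" "('s, 'f) tm"
  | Rel 'r "('s, 'f) tm list"
  | Neg "('s, 'f, 'r) fm"
  | Conj "('s, 'f, 'r) fm" "('s, 'f, 'r) fm"
  | Exi 's nat "('s, 'f, 'r) fm"

fun wf_fm :: "('s, 'f, 'r) sig \<Rightarrow> ('s, 'f, 'r) fm \<Rightarrow> bool" where
  "wf_fm L (Eq t u) = (wf_tm L t \<and> wf_tm L u \<and> tm_sort L t = tm_sort L u)"
| "wf_fm L (Rel r ts) =
     (r \<in> rels L \<and> map (tm_sort L) ts = rdom L r \<and> (\<forall>t \<in> set ts. wf_tm L t))"
| "wf_fm L (Neg p) = wf_fm L p"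
| "wf_fm L (Conj p q) = (wf_fm L p \<and> wf_fm L q)"
| "wf_fm L (Exi s i p) = wf_fm L p"

fun fm_vars :: "('s, 'f, 'r) fm \<Rightarrow> ('s \<times> nat) set" where
  "fm_vars (Eq t u) = tm_vars t \<union> tm_vars u"
| "fm_vars (Rel r ts) = (\<Union>t \<in> set ts. tm_vars t)"
| "fm_vars (Neg p) = fm_vars p"
| "fm_vars (Conj p q) = fm_vars p \<union> fm_vars q"
| "fm_vars (Exi s i p) = fm_vars p - {(s, i)}"

fun sat :: "('u, 's, 'f, 'r) struc \<Rightarrow> ('s \<times> nat \<Rightarrow> 'u) \<Rightarrow> ('s, 'f, 'r) fm \<Rightarrow> bool" where
  "sat M e (Eq t u) = (tm_val M e t = tm_val M e u)"
| "sat M e (Rel r ts) = rl M r (map (tm_val M e) ts)"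
| "sat M e (Neg p) = (\<not> sat M e p)"
| "sat M e (Conj p q) = (sat M e p \<and> sat M e q)"
| "sat M e (Exi s i p) = (\<exists>a \<in> carr M s. sat M (e((s, i) := a)) p)"

text \<open>
  A formula (or term) in context \<open>[s\<^sub>0, \<dots>, s\<^sub>k\<^sub>-\<^sub>1]\<close> has its free variables among
  \<open>(s\<^sub>0, 0), \<dots>, (s\<^sub>k\<^sub>-\<^sub>1, k - 1)\<close>; a tuple \<open>as\<close> of these sorts is substituted by sending the
  variable with index \<open>j\<close> to \<open>as ! j\<close>.
\<close>

definition ctx_vars :: "'s list \<Rightarrow> ('s \<times> nat) set" where
  "ctx_vars ss = {(ss ! j, j) | j. j < length ss}"

definition env :: "'u list \<Rightarrow> 's \<times> nat \<Rightarrow> 'u" where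
  "env as = (\<lambda>(s, j). as ! j)"

definition fm_in :: "('s, 'f, 'r) sig \<Rightarrow> 's list \<Rightarrow> ('s, 'f, 'r) fm \<Rightarrow> bool" where
  "fm_in L ss p \<longleftrightarrow> wf_fm L p \<and> fm_vars p \<subseteq> ctx_vars ss"

definition tm_in :: "('s, 'f, 'r) sig \<Rightarrow> 's list \<Rightarrow> ('s, 'f) tm \<Rightarrow> bool" where
  "tm_in L ss t \<longleftrightarrow> wf_tm L t \<and> tm_vars t \<subseteq> ctx_vars ss"

definition holds :: "('u, 's, 'f, 'r) struc \<Rightarrow> ('s, 'f, 'r) fm \<Rightarrow> 'u list \<Rightarrow> bool" where
  "holds M p as \<longleftrightarrow> sat M (env as) p"

definition solutions ::
  "('u, 's, 'f, 'r) struc \<Rightarrow> 's list \<Rightarrow> ('s, 'f, 'r) fm \<Rightarrow> 'u list set" where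
  "solutions M ss p = {as \<in> tuples M ss. holds M p as}"

text \<open>Definability is with parameters.\<close>

definition definable ::
  "('s, 'f, 'r) sig \<Rightarrow> ('u, 's, 'f, 'r) struc \<Rightarrow> 's list \<Rightarrow> 'u list set \<Rightarrow> bool" where
  "definable L M ss R \<longleftrightarrow>
     (\<exists>p qs cs. fm_in L (ss @ qs) p \<and> cs \<in> tuples M qs \<and>
        R = {as \<in> tuples M ss. holds M p (as @ cs)})"

definition elem_equiv ::
  "('s, 'f, 'r) sig \<Rightarrow> ('u, 's, 'f, 'r) struc \<Rightarrow> ('v, 's, 'f, 'r) struc \<Rightarrow> bool" where
  "elem_equiv L M N \<longleftrightarrow> (\<forall>p. fm_in L [] p \<longrightarrow> (holds M p [] \<longleftrightarrow> holds N p []))"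

section \<open>One-sorted structures\<close>

definition definable_substruc ::
  "(unit, 'f, 'r) sig \<Rightarrow> ('a, unit, 'f, 'r) struc \<Rightarrow> ('a, unit, 'f, 'r) struc \<Rightarrow> bool" where
  "definable_substruc L B A \<longleftrightarrow>
     substruc L B A \<and> definable L A [()] {[b] | b. b \<in> carr B ()}"

definition fin_generated_over ::
  "(unit, 'f, 'r) sig \<Rightarrow> ('a, unit, 'f, 'r) struc \<Rightarrow> ('a, unit, 'f, 'r) struc \<Rightarrow> bool" where
  "fin_generated_over L A B \<longleftrightarrow>
     (\<exists>xs \<in> lists (carr A ()). \<forall>a \<in> carr A (). \<exists>t. \<exists>bs \<in> lists (carr B ()).
        tm_in L (replicate (length xs + length bs) ()) t \<and> a = tm_val A (env (xs @ bs)) t)"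

section \<open>List superstructures\<close>

datatype lsort = BaseS | ListS | NatS

datatype 'f lfun = BaseF 'f | LenF | PlusF | TimesF | ZeroF | OneF

datatype 'r lrel = BaseR 'r | CompR

datatype 'a lval = Elem (un_Elem: 'a) | Tup (un_Tup: "'a list") | Num (un_Num: nat)

fun lfdom :: "(unit, 'f, 'r) sig \<Rightarrow> 'f lfun \<Rightarrow> lsort list" where
  "lfdom L (BaseF f) = map (\<lambda>_. BaseS) (fdom L f)"
| "lfdom L LenF = [ListS]"
| "lfdom L PlusF = [NatS, NatS]"
| "lfdom L TimesF = [NatS, NatS]"
| "lfdom L ZeroF = []"
| "lfdom L OneF = []"

fun lfcod :: "'f lfun \<Rightarrow> lsort" where
  "lfcod (BaseF f) = BaseS"
| "lfcod LenF = NatS"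
| "lfcod PlusF = NatS"
| "lfcod TimesF = NatS"
| "lfcod ZeroF = NatS"
| "lfcod OneF = NatS"

fun lrdom :: "(unit, 'f, 'r) sig \<Rightarrow> 'r lrel \<Rightarrow> lsort list" where
  "lrdom L (BaseR r) = map (\<lambda>_. BaseS) (rdom L r)"
| "lrdom L CompR = [ListS, BaseS, NatS]"

definition list_sig :: "(unit, 'f, 'r) sig \<Rightarrow> (lsort, 'f lfun, 'r lrel) sig" where
  "list_sig L =
     \<lparr>funs = BaseF ` funs L \<union> {LenF, PlusF, TimesF, ZeroF, OneF},
      rels = BaseR ` rels L \<union> {CompR},
      fdom = lfdom L, fcod = lfcod, rdom = lrdom L\<rparr>"

fun luniv :: "'a set \<Rightarrow> lsort \<Rightarrow> 'a lval set" where
  "luniv B BaseS = Elem ` B"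
| "luniv B ListS = Tup ` lists B"
| "luniv B NatS = range Num"

fun lfn :: "('a, unit, 'f, 'r) struc \<Rightarrow> 'f lfun \<Rightarrow> 'a lval list \<Rightarrow> 'a lval" where
  "lfn B (BaseF f) as = Elem (fn B f (map un_Elem as))"
| "lfn B LenF as = Num (length (un_Tup (as ! 0)))"
| "lfn B PlusF as = Num (un_Num (as ! 0) + un_Num (as ! 1))"
| "lfn B TimesF as = Num (un_Num (as ! 0) * un_Num (as ! 1))"
| "lfn B ZeroF as = Num 0"
| "lfn B OneF as = Num 1"

text \<open>Components of a tuple are numbered from \<open>1\<close>.\<close>

fun lrl :: "('a, unit, 'f, 'r) struc \<Rightarrow> 'r lrel \<Rightarrow> 'a lval list \<Rightarrow> bool" where
  "lrl B (BaseR r) as \<longleftrightarrow> rl B r (map un_Elem as)"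
| "lrl B CompR as \<longleftrightarrow>
     (let s = un_Tup (as ! 0); a = un_Elem (as ! 1); i = un_Num (as ! 2)
      in 1 \<le> i \<and> i \<le> length s \<and> s ! (i - 1) = a)"

definition list_super ::
  "('a, unit, 'f, 'r) struc \<Rightarrow> ('a lval, lsort, 'f lfun, 'r lrel) struc" where
  "list_super B = \<lparr>carr = luniv (carr B ()), fn = lfn B, rl = lrl B\<rparr>"

section \<open>Interpretations\<close>

text \<open>
  A code for interpreting one-sorted structures with symbols \<open>'f, 'r\<close> in many-sorted structures
  with symbols \<open>'g, 'q\<close>.  Elements are represented by tuples of sorts \<open>xsorts\<close>, the parameter
  tuple has sorts \<open>psorts\<close>.  The arguments of each formula are concatenated, parameters last; a
  function symbol is interpreted through its graph, the value coming after the arguments.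
\<close>

record ('s, 'f, 'r, 'g, 'q) icode =
  xsorts :: "'s list"
  psorts :: "'s list"
  dom_fm :: "('s, 'g, 'q) fm"
  eq_fm :: "('s, 'g, 'q) fm"
  fun_fm :: "'f \<Rightarrow> ('s, 'g, 'q) fm"
  rel_fm :: "'r \<Rightarrow> ('s, 'g, 'q) fm"

definition wf_code ::
  "(unit, 'f, 'r) sig \<Rightarrow> ('s, 'g, 'q) sig \<Rightarrow> ('s, 'f, 'r, 'g, 'q) icode \<Rightarrow> bool" where
  "wf_code L K \<Gamma> \<longleftrightarrow>
     fm_in K (xsorts \<Gamma> @ psorts \<Gamma>) (dom_fm \<Gamma>) \<and>
     fm_in K (xsorts \<Gamma> @ xsorts \<Gamma> @ psorts \<Gamma>) (eq_fm \<Gamma>) \<and>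
     (\<forall>f \<in> funs L.
        fm_in K (concat (replicate (Suc (length (fdom L f))) (xsorts \<Gamma>)) @ psorts \<Gamma>) (fun_fm \<Gamma> f)) \<and>
     (\<forall>r \<in> rels L.
        fm_in K (concat (replicate (length (rdom L r)) (xsorts \<Gamma>)) @ psorts \<Gamma>) (rel_fm \<Gamma> r))"

definition dom_set ::
  "('s, 'f, 'r, 'g, 'q) icode \<Rightarrow> ('u, 's, 'g, 'q) struc \<Rightarrow> 'u list \<Rightarrow> 'u list set" where
  "dom_set \<Gamma> M p = {x \<in> tuples M (xsorts \<Gamma>). holds M (dom_fm \<Gamma>) (x @ p)}"

definition eq_rel ::
  "('s, 'f, 'r, 'g, 'q) icode \<Rightarrow> ('u, 's, 'g, 'q) struc \<Rightarrow> 'u list \<Rightarrow> ('u list \<times> 'u list) set" where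
  "eq_rel \<Gamma> M p =
     {(x, x'). x \<in> dom_set \<Gamma> M p \<and> x' \<in> dom_set \<Gamma> M p \<and> holds M (eq_fm \<Gamma>) (x @ x' @ p)}"

definition fun_graph ::
  "('s, 'f, 'r, 'g, 'q) icode \<Rightarrow> ('u, 's, 'g, 'q) struc \<Rightarrow> 'u list \<Rightarrow>
     'f \<Rightarrow> 'u list list \<Rightarrow> 'u list \<Rightarrow> bool" where
  "fun_graph \<Gamma> M p f xs y \<longleftrightarrow> holds M (fun_fm \<Gamma> f) (concat xs @ y @ p)"

definition rel_holds ::
  "('s, 'f, 'r, 'g, 'q) icode \<Rightarrow> ('u, 's, 'g, 'q) struc \<Rightarrow> 'u list \<Rightarrow>
     'r \<Rightarrow> 'u list list \<Rightarrow> bool" where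
  "rel_holds \<Gamma> M p r xs \<longleftrightarrow> holds M (rel_fm \<Gamma> r) (concat xs @ p)"

text \<open>
  The formulas of the code, with parameters \<open>p\<close>, do define an \<open>L\<close>-structure: an equivalence
  relation on a nonempty set together with preimages of operations and relations on the quotient.
\<close>

definition code_ok ::
  "(unit, 'f, 'r) sig \<Rightarrow> ('s, 'f, 'r, 'g, 'q) icode \<Rightarrow> ('u, 's, 'g, 'q) struc \<Rightarrow> 'u list \<Rightarrow> bool" where
  "code_ok L \<Gamma> M p \<longleftrightarrow>
     dom_set \<Gamma> M p \<noteq> {} \<and>
     equiv (dom_set \<Gamma> M p) (eq_rel \<Gamma> M p) \<and>
     (\<forall>f \<in> funs L.
        (\<forall>xs \<in> lists (dom_set \<Gamma> M p). length xs = length (fdom L f) \<longrightarrow>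
           (\<exists>y \<in> dom_set \<Gamma> M p. fun_graph \<Gamma> M p f xs y \<and>
              (\<forall>y' \<in> dom_set \<Gamma> M p. fun_graph \<Gamma> M p f xs y' \<longrightarrow> (y, y') \<in> eq_rel \<Gamma> M p))) \<and>
        (\<forall>xs xs' y y'. length xs = length (fdom L f) \<and>
           list_all2 (\<lambda>x x'. (x, x') \<in> eq_rel \<Gamma> M p) xs xs' \<and> (y, y') \<in> eq_rel \<Gamma> M p \<longrightarrow>
           (fun_graph \<Gamma> M p f xs y \<longleftrightarrow> fun_graph \<Gamma> M p f xs' y'))) \<and>
     (\<forall>r \<in> rels L. \<forall>xs xs'. length xs = length (rdom L r) \<and>
        list_all2 (\<lambda>x x'. (x, x') \<in> eq_rel \<Gamma> M p) xs xs' \<longrightarrow>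
        (rel_holds \<Gamma> M p r xs \<longleftrightarrow> rel_holds \<Gamma> M p r xs'))"

text \<open>The structure \<open>\<Gamma>(M, p)\<close>, meaningful if \<^const>\<open>code_ok\<close>.\<close>

definition interp ::
  "('s, 'f, 'r, 'g, 'q) icode \<Rightarrow> ('u, 's, 'g, 'q) struc \<Rightarrow> 'u list \<Rightarrow>
     ('u list set, unit, 'f, 'r) struc" where
  "interp \<Gamma> M p =
     \<lparr>carr = (\<lambda>_. dom_set \<Gamma> M p // eq_rel \<Gamma> M p),
      fn = (\<lambda>f Cs. THE C. C \<in> dom_set \<Gamma> M p // eq_rel \<Gamma> M p \<and>
              (\<exists>xs y. list_all2 (\<in>) xs Cs \<and> y \<in> C \<and> fun_graph \<Gamma> M p f xs y)),
      rl = (\<lambda>r Cs. \<exists>xs. list_all2 (\<in>) xs Cs \<and> rel_holds \<Gamma> M p r xs)\<rparr>"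

text \<open>For every \<open>p \<in> \<phi>(M)\<close> the code defines an \<open>L\<close>-structure \<open>\<Gamma>(M, p)\<close>, and there is such a \<open>p\<close>.\<close>

definition codes_strucs ::
  "(unit, 'f, 'r) sig \<Rightarrow> ('s, 'f, 'r, 'g, 'q) icode \<Rightarrow> ('s, 'g, 'q) fm \<Rightarrow>
     ('u, 's, 'g, 'q) struc \<Rightarrow> bool" where
  "codes_strucs L \<Gamma> \<phi> M \<longleftrightarrow>
     solutions M (psorts \<Gamma>) \<phi> \<noteq> {} \<and> (\<forall>p \<in> solutions M (psorts \<Gamma>) \<phi>. code_ok L \<Gamma> M p)"

text \<open>\<open>\<Gamma>(M, \<phi>)\<close> is well-defined up to isomorphism.\<close>

definition well_defined ::
  "(unit, 'f, 'r) sig \<Rightarrow> ('s, 'f, 'r, 'g, 'q) icode \<Rightarrow> ('s, 'g, 'q) fm \<Rightarrow>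
     ('u, 's, 'g, 'q) struc \<Rightarrow> bool" where
  "well_defined L \<Gamma> \<phi> M \<longleftrightarrow>
     codes_strucs L \<Gamma> \<phi> M \<and>
     (\<forall>p \<in> solutions M (psorts \<Gamma>) \<phi>. \<forall>q \<in> solutions M (psorts \<Gamma>) \<phi>.
        isomorphic L (interp \<Gamma> M p) (interp \<Gamma> M q))"

text \<open>The regular interpretation \<open>A \<cong> \<Gamma>(M, \<phi>)\<close>.\<close>

definition regularly_interpreted ::
  "(unit, 'f, 'r) sig \<Rightarrow> ('s, 'g, 'q) sig \<Rightarrow> ('a, unit, 'f, 'r) struc \<Rightarrow>
     ('s, 'f, 'r, 'g, 'q) icode \<Rightarrow> ('s, 'g, 'q) fm \<Rightarrow> ('u, 's, 'g, 'q) struc \<Rightarrow> bool" where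
  "regularly_interpreted L K A \<Gamma> \<phi> M \<longleftrightarrow>
     wf_code L K \<Gamma> \<and> fm_in K (psorts \<Gamma>) \<phi> \<and> codes_strucs L \<Gamma> \<phi> M \<and>
     (\<forall>p \<in> solutions M (psorts \<Gamma>) \<phi>. isomorphic L (interp \<Gamma> M p) A)"

text \<open>
  The graph of a map between (a set \<open>X\<close> of elements of) two interpreted structures, pulled back to
  representing tuples.  Elements of an interpreted structure are classes of tuples, so \<open>x \<in> C\<close>
  says that \<open>x\<close> represents \<open>C\<close>.
\<close>

definition rep_graph :: "('u list set \<Rightarrow> 'u list set) \<Rightarrow> 'u list set set \<Rightarrow> 'u list set" where
  "rep_graph h X = {x @ y | x y C. C \<in> X \<and> x \<in> C \<and> y \<in> h C}"

end

theory Submission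
  imports Defs "HOL-Number_Theory.Cong"
begin

text \<open>
  Every element of \<open>A\<close> is the value of a term at the finitely many generators and elements of \<open>B\<close>,
  so the given isomorphism \<open>\<theta>\<close> between the two interpretations is generated by its restriction to
  the image of \<open>B\<close> and its values at the generators: a pair of representatives belongs to the
  graph of \<open>\<theta>\<close> iff it ends a finite derivation whose steps are such initial pairs or
  applications of one of the finitely many operations in both coordinates.  Finite sequences of
  tuples are coded in the list superstructure (Goedel's \<open>\<beta>\<close>-function for numbers, the lists
  themselves for elements, concatenation with offsets for lists), hence \<open>\<theta>\<close> is definable with
  parameters.  That some choice of parameters makes the defining formula an isomorphism is a
  first-order sentence, because the signature is finite, and so it transfers to \<open>M\<close>.
\<close>

section \<open>First-order definability, uniformly in two structures\<close>

text \<open>The structure \<open>M\<close> may have nonstandard numbers and lists, so derivations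
  are never analysed in it. All work on them is done in the list superstructure of \<open>B\<close>;
  what reaches \<open>M\<close> is only the sentence that some parameters \<open>p1\<close>,
  \<open>p2\<close>, \<open>q\<close> make the resulting formula an isomorphism graph. The
  parameters are quantified existentially, since those found in the list superstructure have no
  counterpart in \<open>M\<close>. This yields one isomorphic pair in \<open>M\<close>, and
  well-definedness of the two interpretations spreads it to all pairs. The graph is a relation
  between representing tuples, because a first-order formula sees tuples and not classes.
  Derivations are coded rather than values of terms because a derivation step is described by the
  formulas of the two codes themselves, so that no syntax of terms has to be arithmetized. The
  number of steps has no bound, hence the need to quantify over codes of sequences of arbitrary
  finite length.\<close>

lemma tm_val_cong:
  "(\<And>v. v \<in> tm_vars t \<Longrightarrow> e v = e' v) \<Longrightarrow> tm_val M e t = tm_val M e' t"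
proof (induction t)
  case (App f ts)
  then have "map (tm_val M e) ts = map (tm_val M e') ts" by auto
  then show ?case by (simp del: map_eq_conv)
qed auto

lemma sat_cong:
  "(\<And>v. v \<in> fm_vars p \<Longrightarrow> e v = e' v) \<Longrightarrow> sat M e p = sat M e' p"
proof (induction p arbitrary: e e')
  case (Eq t u)
  then show ?case using tm_val_cong[of t e e' M] tm_val_cong[of u e e' M] by auto
next
  case (Rel r ts)
  then have "map (tm_val M e) ts = map (tm_val M e') ts"
    by (intro map_cong refl tm_val_cong) auto
  then show ?case by (simp del: map_eq_conv)
next
  case (Neg p)
  then show ?case by (metis fm_vars.simps(3) sat.simps(3))
next
  case (Conj p q)
  then show ?case by (metis UnCI fm_vars.simps(4) sat.simps(4))
next
  case (Exi s i p)
  have "sat M (e((s, i) := a)) p = sat M (e'((s, i) := a)) p" for a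
    using Exi.prems by (intro Exi.IH) auto
  then show ?case by simp
qed

lemma tuples_length: "as \<in> tuples M ss \<Longrightarrow> length as = length ss"
  by (auto simp: tuples_def list_all2_lengthD)

lemma tuples_Nil [simp]: "as \<in> tuples M [] \<longleftrightarrow> as = []"
  by (auto simp: tuples_def)

lemma tuples_Cons: "as \<in> tuples M (s # ss) \<longleftrightarrow> (\<exists>a bs. as = a # bs \<and> a \<in> carr M s \<and> bs \<in> tuples M ss)"
  by (auto simp: tuples_def list_all2_Cons2)

lemma tuples_append:
  "as \<in> tuples M (ss @ ts) \<longleftrightarrow> (\<exists>x y. as = x @ y \<and> x \<in> tuples M ss \<and> y \<in> tuples M ts)"
  unfolding tuples_def mem_Collect_eq list_all2_append2
  by (metis list_all2_lengthD)

lemma append_in_tuples: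
  "x \<in> tuples M ss \<Longrightarrow> x @ y \<in> tuples M (ss @ ts) \<longleftrightarrow> y \<in> tuples M ts"
  by (auto simp: tuples_def list_all2_append list_all2_lengthD)

section \<open>Renaming of variables without capture\<close>

fun ren_tm :: "('s \<times> nat \<Rightarrow> nat) \<Rightarrow> ('s, 'f) tm \<Rightarrow> ('s, 'f) tm" where
  "ren_tm \<rho> (Var s i) = Var s (\<rho> (s, i))"
| "ren_tm \<rho> (App f ts) = App f (map (ren_tm \<rho>) ts)"

text \<open>Bound variables are renamed to \<open>k, k + 1, \<dots>\<close>, which avoids capture when the free variables
  are sent below \<open>k\<close>.\<close>

fun ren_fm :: "nat \<Rightarrow> ('s \<times> nat \<Rightarrow> nat) \<Rightarrow> ('s, 'f, 'r) fm \<Rightarrow> ('s, 'f, 'r) fm" where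
  "ren_fm k \<rho> (Eq t u) = Eq (ren_tm \<rho> t) (ren_tm \<rho> u)"
| "ren_fm k \<rho> (Rel r ts) = Rel r (map (ren_tm \<rho>) ts)"
| "ren_fm k \<rho> (Neg p) = Neg (ren_fm k \<rho> p)"
| "ren_fm k \<rho> (Conj p q) = Conj (ren_fm k \<rho> p) (ren_fm k \<rho> q)"
| "ren_fm k \<rho> (Exi s i p) = Exi s k (ren_fm (Suc k) (\<rho>((s, i) := k)) p)"

lemma tm_sort_ren [simp]: "tm_sort L (ren_tm \<rho> t) = tm_sort L t"
  by (cases t) auto

lemma wf_tm_ren: "wf_tm L t \<Longrightarrow> wf_tm L (ren_tm \<rho> t)"
  by (induction t) (auto simp: comp_def)

lemma wf_fm_ren: "wf_fm L p \<Longrightarrow> wf_fm L (ren_fm k \<rho> p)"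
  by (induction p arbitrary: k \<rho>) (auto simp: comp_def wf_tm_ren)

lemma tm_vars_ren: "tm_vars (ren_tm \<rho> t) = (\<lambda>v. (fst v, \<rho> v)) ` tm_vars t"
  by (induction t) auto

lemma fm_vars_ren:
  "fm_vars (ren_fm k \<rho> p) \<subseteq> (\<lambda>v. (fst v, \<rho> v)) ` fm_vars p"
proof (induction p arbitrary: k \<rho>)
  case (Exi s i p)
  show ?case
  proof
    fix v assume v: "v \<in> fm_vars (ren_fm k \<rho> (Exi s i p))"
    then have "v \<in> (\<lambda>v. (fst v, (\<rho>((s, i) := k)) v)) ` fm_vars p"
      using subsetD[OF Exi.IH[of "Suc k" "\<rho>((s, i) := k)"], of v]
      unfolding ren_fm.simps fm_vars.simps by blast
    then obtain w where w: "w \<in> fm_vars p" "v = (fst w, (\<rho>((s, i) := k)) w)" by blast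
    have "w \<noteq> (s, i)" using v w by auto
    then show "v \<in> (\<lambda>v. (fst v, \<rho> v)) ` fm_vars (Exi s i p)" using w by auto
  qed
qed (fastforce simp: tm_vars_ren)+

lemma tm_val_ren: "tm_val M e (ren_tm \<rho> t) = tm_val M (\<lambda>v. e (fst v, \<rho> v)) t"
  by (induction t) (auto simp: comp_def intro: arg_cong[where f = "fn M _"])

text \<open>Free variables land below \<open>k\<close> while binders use \<open>k\<close> and
  upward, so no renamed free variable is captured. The invariant survives a binder because the bound
  variable itself is sent to \<open>k\<close>, which is below the new bound
  \<open>Suc k\<close>.\<close>

lemma sat_ren:
  "(\<And>v. v \<in> fm_vars p \<Longrightarrow> \<rho> v < k) \<Longrightarrow>
     sat M e (ren_fm k \<rho> p) = sat M (\<lambda>v. e (fst v, \<rho> v)) p"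
proof (induction p arbitrary: k \<rho> e)
  case (Exi s i p)
  have "sat M (e((s, k) := a)) (ren_fm (Suc k) (\<rho>((s, i) := k)) p) =
      sat M ((\<lambda>v. e (fst v, \<rho> v))((s, i) := a)) p" for a
  proof -
    have "(\<rho>((s, i) := k)) v < Suc k" if "v \<in> fm_vars p" for v
      using Exi.prems[of v] that by (cases "v = (s, i)") auto
    then have "sat M (e((s, k) := a)) (ren_fm (Suc k) (\<rho>((s, i) := k)) p) =
      sat M (\<lambda>v. (e((s, k) := a)) (fst v, (\<rho>((s, i) := k)) v)) p"
      by (intro Exi.IH)
    \<comment> \<open>Updating \<open>(s, k)\<close> is invisible to the other free variables, whose
      indices stay strictly below \<open>k\<close>.\<close>
    also have "\<dots> = sat M ((\<lambda>v. e (fst v, \<rho> v))((s, i) := a)) p"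
    proof (rule sat_cong)
      fix v assume "v \<in> fm_vars p"
      then show "(e((s, k) := a)) (fst v, (\<rho>((s, i) := k)) v) = ((\<lambda>v. e (fst v, \<rho> v))((s, i) :=
          a)) v"
        using Exi.prems[of v] by (cases "v = (s, i)") auto
    qed
    finally show ?thesis .
  qed
  then show ?case by simp
next
  case (Rel r ts)
  then show ?case by (simp add: comp_def tm_val_ren)
qed (auto simp: tm_val_ren)

text \<open>
  One formula in context \<open>ss\<close> defines \<open>P\<close> in \<open>M\<close> and \<open>Q\<close> in \<open>N\<close>.  Closure of this relation under the
  connectives and quantifiers yields sentences that can be transferred between \<open>M\<close> and \<open>N\<close> without
  ever being written down; definability in a single structure is the case \<open>M = N\<close>.
\<close>

definition codefinable ::
  "('s, 'f, 'r) sig \<Rightarrow> ('u, 's, 'f, 'r) struc \<Rightarrow> ('v, 's, 'f, 'r) struc \<Rightarrow> 's list \<Rightarrow>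
     ('u list \<Rightarrow> bool) \<Rightarrow> ('v list \<Rightarrow> bool) \<Rightarrow> bool" where
  "codefinable K M N ss P Q \<longleftrightarrow>
     (\<exists>p. fm_in K ss p \<and> (\<forall>as \<in> tuples M ss. holds M p as \<longleftrightarrow> P as) \<and>
        (\<forall>as \<in> tuples N ss. holds N p as \<longleftrightarrow> Q as))"

text \<open>\<open>F\<close> and \<open>G\<close> select the same positions \<open>js\<close> of a tuple: they play the role of a tuple of
    variables
  of sorts \<open>us\<close> in context \<open>ss\<close>.\<close>

definition coproj ::
  "('u, 's, 'f, 'r) struc \<Rightarrow> ('v, 's, 'f, 'r) struc \<Rightarrow> 's list \<Rightarrow> 's list \<Rightarrow>
     ('u list \<Rightarrow> 'u list) \<Rightarrow> ('v list \<Rightarrow> 'v list) \<Rightarrow> bool" where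
  "coproj M N ss us F G \<longleftrightarrow>
     (\<exists>js. set js \<subseteq> {..<length ss} \<and> us = map (nth ss) js \<and>
        (\<forall>as \<in> tuples M ss. F as = map (nth as) js) \<and>
        (\<forall>as \<in> tuples N ss. G as = map (nth as) js))"

text \<open>Under a quantifier over a block \<open>ts\<close> the context grows to
  \<open>ss @ ts\<close>; \<open>before\<close> and \<open>after\<close> recover the old variables
  and the new block. The context is an explicit argument, so that a goal itself shows where the
  split lies.\<close>

definition before :: "'s list \<Rightarrow> 'u list \<Rightarrow> 'u list" where
  "before ss as = take (length ss) as"

definition after :: "'s list \<Rightarrow> 'u list \<Rightarrow> 'u list" where
  "after ss as = drop (length ss) as"

lemma before_append [simp]: "x \<in> tuples M ss \<Longrightarrow> before ss (x @ y) = x"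
  by (simp add: before_def tuples_length)

lemma after_append [simp]: "x \<in> tuples M ss \<Longrightarrow> after ss (x @ y) = y"
  by (simp add: after_def tuples_length)

lemma coproj_tuples:
  assumes "coproj M N ss us F G"
  shows "as \<in> tuples M ss \<Longrightarrow> F as \<in> tuples M us" "bs \<in> tuples N ss \<Longrightarrow> G bs \<in> tuples N us"
  using assms unfolding coproj_def
  by (fastforce simp: tuples_def list_all2_conv_all_nth subset_iff)+

lemma coproj_id: "coproj M N ss ss (\<lambda>as. as) (\<lambda>as. as)"
  unfolding coproj_def
  by (rule exI[of _ "[0..<length ss]"])
    (auto simp: map_nth tuples_length intro!: nth_equalityI)

lemma coproj_Nil: "coproj M N ss [] (\<lambda>as. []) (\<lambda>as. [])"
  unfolding coproj_def by (rule exI[of _ "[]"]) auto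

lemma coproj_append:
  assumes "coproj M N ss us F G" "coproj M N ss vs F' G'"
  shows "coproj M N ss (us @ vs) (\<lambda>as. F as @ F' as) (\<lambda>as. G as @ G' as)"
proof -
  obtain js js' where "set js \<subseteq> {..<length ss}" "us = map (nth ss) js"
    "\<forall>as \<in> tuples M ss. F as = map (nth as) js" "\<forall>as \<in> tuples N ss. G as = map (nth as) js"
    "set js' \<subseteq> {..<length ss}" "vs = map (nth ss) js'"
    "\<forall>as \<in> tuples M ss. F' as = map (nth as) js'" "\<forall>as \<in> tuples N ss. G' as = map (nth as) js'"
    using assms unfolding coproj_def by blast
  then show ?thesis unfolding coproj_def by (intro exI[of _ "js @ js'"]) auto
qed

lemma coproj_take:
  assumes "coproj M N ss (us @ vs) F G"
  shows "coproj M N ss us (\<lambda>as. take (length us) (F as)) (\<lambda>as. take (length us) (G as))"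
proof -
  obtain js where js: "set js \<subseteq> {..<length ss}" "us @ vs = map (nth ss) js"
    "\<forall>as \<in> tuples M ss. F as = map (nth as) js" "\<forall>as \<in> tuples N ss. G as = map (nth as) js"
    using assms unfolding coproj_def by blast
  then have "us = map (nth ss) (take (length us) js)" by (metis append_eq_conv_conj take_map)
  with js show ?thesis unfolding coproj_def
    by (intro exI[of _ "take (length us) js"]) (auto simp: take_map dest: in_set_takeD)
qed

lemma coproj_drop:
  assumes "coproj M N ss (us @ vs) F G"
  shows "coproj M N ss vs (\<lambda>as. drop (length us) (F as)) (\<lambda>as. drop (length us) (G as))"
proof -
  obtain js where js: "set js \<subseteq> {..<length ss}" "us @ vs = map (nth ss) js"
    "\<forall>as \<in> tuples M ss. F as = map (nth as) js" "\<forall>as \<in> tuples N ss. G as = map (nth as) js"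
    using assms unfolding coproj_def by blast
  then have "vs = map (nth ss) (drop (length us) js)" by (metis append_eq_conv_conj drop_map)
  with js show ?thesis unfolding coproj_def
    by (intro exI[of _ "drop (length us) js"]) (auto simp: drop_map dest: in_set_dropD)
qed

lemma coproj_after: "coproj M N (ss @ ts) ts (after ss) (after ss)"
  using coproj_drop[OF coproj_id, of M N ss ts] by (simp add: after_def[abs_def])

lemma coproj_before:
  assumes "coproj M N ss us F G"
  shows "coproj M N (ss @ ts) us (\<lambda>as. F (before ss as)) (\<lambda>as. G (before ss as))"
proof -
  obtain js where js: "set js \<subseteq> {..<length ss}" "us = map (nth ss) js"
    "\<forall>as \<in> tuples M ss. F as = map (nth as) js" "\<forall>as \<in> tuples N ss. G as = map (nth as) js"
    using assms unfolding coproj_def by blast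
  have "F (before ss as) = map (nth as) js" if "as \<in> tuples M (ss @ ts)" for as
    using that js by (force simp: tuples_append nth_append tuples_length)
  moreover have "G (before ss as) = map (nth as) js" if "as \<in> tuples N (ss @ ts)" for as
    using that js by (force simp: tuples_append nth_append tuples_length)
  moreover have "us = map (nth (ss @ ts)) js" using js by (auto simp: nth_append)
  ultimately show ?thesis unfolding coproj_def using js(1) by (intro exI[of _ js]) auto
qed

section \<open>Closure of uniform definability under substitution, connectives and
  quantifiers\<close>

lemma codefinable_cong:
  assumes "codefinable K M N ss P Q"
    and "\<And>as. as \<in> tuples M ss \<Longrightarrow> P as = P' as" "\<And>bs. bs \<in> tuples N ss \<Longrightarrow> Q bs = Q' bs"
  shows "codefinable K M N ss P' Q'"
  using assms unfolding codefinable_def by auto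

text \<open>The positions \<open>js\<close> become a renaming of indices. They may repeat or skip
  places, so identification of variables, permutation and weakening are all instances of this one
  rule.\<close>

lemma codefinable_subst:
  assumes "codefinable K M N us P Q" "coproj M N ss us F G"
  shows "codefinable K M N ss (\<lambda>as. P (F as)) (\<lambda>as. Q (G as))"
proof -
  obtain p where p: "fm_in K us p" "\<forall>as \<in> tuples M us. holds M p as \<longleftrightarrow> P as"
    "\<forall>as \<in> tuples N us. holds N p as \<longleftrightarrow> Q as"
    using assms(1) unfolding codefinable_def by blast
  obtain js where js: "set js \<subseteq> {..<length ss}" "us = map (nth ss) js"
    "\<forall>as \<in> tuples M ss. F as = map (nth as) js" "\<forall>as \<in> tuples N ss. G as = map (nth as) js"
    using assms(2) unfolding coproj_def by blast
  \<comment> \<open>All free indices end up below \<open>length ss\<close>, so bound variables may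
    start there.\<close>
  define q where "q = ren_fm (length ss) (\<lambda>v. js ! snd v) p"
  have v: "snd v < length js \<and> fst v = ss ! (js ! snd v) \<and> js ! snd v < length ss"
    if "v \<in> fm_vars p" for v
  proof -
    have "v \<in> ctx_vars us" using p(1) that by (auto simp: fm_in_def)
    then obtain j where "j < length us" "v = (us ! j, j)" by (auto simp: ctx_vars_def)
    then show ?thesis using js(1,2) by (auto dest: subsetD[OF _ nth_mem])
  qed
  have "fm_in K ss q"
    using p(1) fm_vars_ren[of "length ss" "\<lambda>v. js ! snd v" p] v
    unfolding fm_in_def q_def ctx_vars_def by (fastforce simp: wf_fm_ren)
  moreover have *: "holds X q as = holds X p (map (nth as) js)" for X :: "('x, 'a, 'b, 'c) struc"
      and as
  proof -
    have "sat X (env as) q = sat X (\<lambda>v. env as (fst v, js ! snd v)) p"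
      unfolding q_def using v by (intro sat_ren) auto
    also have "\<dots> = sat X (env (map (nth as) js)) p"
      using v by (intro sat_cong) (auto simp: env_def)
    finally show ?thesis by (simp add: holds_def)
  qed
  moreover have "holds M q as = P (F as)" if "as \<in> tuples M ss" for as
    using *[of M as] js(3) p(2) coproj_tuples(1)[OF assms(2) that] that by auto
  moreover have "holds N q as = Q (G as)" if "as \<in> tuples N ss" for as
    using *[of N as] js(4) p(3) coproj_tuples(2)[OF assms(2) that] that by auto
  ultimately show ?thesis unfolding codefinable_def by blast
qed

lemma codefinable_holds:
  assumes "fm_in K us p" "coproj M N ss us F G"
  shows "codefinable K M N ss (\<lambda>as. holds M p (F as)) (\<lambda>as. holds N p (G as))"
  using assms(1) by (intro codefinable_subst[OF _ assms(2)]) (auto simp: codefinable_def)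

lemma codefinable_not:
  assumes "codefinable K M N ss P Q"
  shows "codefinable K M N ss (\<lambda>as. \<not> P as) (\<lambda>as. \<not> Q as)"
proof -
  obtain p where "fm_in K ss p" "\<forall>as \<in> tuples M ss. holds M p as \<longleftrightarrow> P as"
    "\<forall>as \<in> tuples N ss. holds N p as \<longleftrightarrow> Q as" using assms unfolding codefinable_def by blast
  then show ?thesis unfolding codefinable_def
    by (intro exI[of _ "Neg p"]) (auto simp: fm_in_def holds_def)
qed

lemma codefinable_conj:
  assumes "codefinable K M N ss P Q" "codefinable K M N ss P' Q'"
  shows "codefinable K M N ss (\<lambda>as. P as \<and> P' as) (\<lambda>as. Q as \<and> Q' as)"
proof -
  obtain p p' where "fm_in K ss p" "\<forall>as \<in> tuples M ss. holds M p as \<longleftrightarrow> P as"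
    "\<forall>as \<in> tuples N ss. holds N p as \<longleftrightarrow> Q as"
    "fm_in K ss p'" "\<forall>as \<in> tuples M ss. holds M p' as \<longleftrightarrow> P' as"
    "\<forall>as \<in> tuples N ss. holds N p' as \<longleftrightarrow> Q' as" using assms unfolding codefinable_def by blast
  then show ?thesis unfolding codefinable_def
    by (intro exI[of _ "Conj p p'"]) (auto simp: fm_in_def holds_def)
qed

lemma codefinable_disj:
  assumes "codefinable K M N ss P Q" "codefinable K M N ss P' Q'"
  shows "codefinable K M N ss (\<lambda>as. P as \<or> P' as) (\<lambda>as. Q as \<or> Q' as)"
  using codefinable_not[OF codefinable_conj[OF assms[THEN codefinable_not]]] by simp

lemma codefinable_imp:
  assumes "codefinable K M N ss P Q" "codefinable K M N ss P' Q'"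
  shows "codefinable K M N ss (\<lambda>as. P as \<longrightarrow> P' as) (\<lambda>as. Q as \<longrightarrow> Q' as)"
  unfolding imp_conv_disj by (intro codefinable_disj codefinable_not assms)

lemma codefinable_iff:
  assumes "codefinable K M N ss P Q" "codefinable K M N ss P' Q'"
  shows "codefinable K M N ss (\<lambda>as. P as \<longleftrightarrow> P' as) (\<lambda>as. Q as \<longleftrightarrow> Q' as)"
  unfolding iff_conv_conj_imp by (intro codefinable_conj codefinable_imp assms)

lemma codefinable_True: "codefinable K M N ss (\<lambda>as. True) (\<lambda>as. True)"
proof -
  \<comment> \<open>In the empty context no variable may be free, so the equation is closed by a
    quantifier over an arbitrary sort. The implication from this formula to itself is then true even
    if the sort is empty.\<close>
  define p :: "('a, 'b, 'c) fm" where "p = Exi undefined 0 (Eq (Var undefined 0) (Var undefined 0))"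
  have "fm_in K ss p" by (auto simp: p_def fm_in_def)
  then have "codefinable K M N ss (holds M p) (holds N p)" unfolding codefinable_def by blast
  from codefinable_imp[OF this this] show ?thesis by simp
qed

lemma codefinable_ball_finite:
  assumes "finite I" "\<And>i. i \<in> I \<Longrightarrow> codefinable K M N ss (P i) (Q i)"
  shows "codefinable K M N ss (\<lambda>as. \<forall>i\<in>I. P i as) (\<lambda>as. \<forall>i\<in>I. Q i as)"
  using assms by (induction I) (auto intro: codefinable_True codefinable_conj)

lemma codefinable_bex_finite:
  assumes "finite I" "\<And>i. i \<in> I \<Longrightarrow> codefinable K M N ss (P i) (Q i)"
  shows "codefinable K M N ss (\<lambda>as. \<exists>i\<in>I. P i as) (\<lambda>as. \<exists>i\<in>I. Q i as)"
  using codefinable_not[OF codefinable_ball_finite[OF assms(1) codefinable_not[OF assms(2)]]]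
  by simp

lemma codefinable_all_less:
  fixes n :: nat
  assumes "\<And>i. i < n \<Longrightarrow> codefinable K M N ss (P i) (Q i)"
  shows "codefinable K M N ss (\<lambda>as. \<forall>i<n. P i as) (\<lambda>as. \<forall>i<n. Q i as)"
  using codefinable_ball_finite[of "{..<n}" K M N ss P Q] assms by (simp add: Ball_def)

lemma codefinable_ex_one:
  assumes "codefinable K M N (ss @ [s]) P Q"
  shows "codefinable K M N ss (\<lambda>as. \<exists>a\<in>carr M s. P (as @ [a])) (\<lambda>as. \<exists>a\<in>carr N s. Q (as @ [a]))"
proof -
  obtain p where p: "fm_in K (ss @ [s]) p" "\<forall>as \<in> tuples M (ss @ [s]). holds M p as \<longleftrightarrow> P as"
    "\<forall>as \<in> tuples N (ss @ [s]). holds N p as \<longleftrightarrow> Q as" using assms unfolding codefinable_def by blast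
  \<comment> \<open>The new value sits at the end of the tuple, at position
    \<open>length ss\<close>; binding the variable with this index makes updating the environment
    agree with appending.\<close>
  define q where "q = Exi s (length ss) p"
  have *: "holds X q as = (\<exists>a\<in>carr X s. holds X p (as @ [a]))" if "as \<in> tuples X ss"
    for X :: "('x, 'a, 'b, 'c) struc" and as
  proof -
    have "sat X ((env as)((s, length ss) := a)) p = sat X (env (as @ [a])) p" for a
    proof (rule sat_cong)
      fix v assume "v \<in> fm_vars p"
      then have "v \<in> ctx_vars (ss @ [s])" using p(1) by (auto simp: fm_in_def)
      then obtain j where "v = ((ss @ [s]) ! j, j)" "j < Suc (length ss)"
          by (auto simp: ctx_vars_def)
      then show "((env as)((s, length ss) := a)) v = env (as @ [a]) v"
        using tuples_length[OF that] by (cases "j = length ss") (auto simp: env_def nth_append)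
    qed
    then show ?thesis by (simp add: holds_def q_def)
  qed
  have "fm_in K ss q"
    using p(1) by (fastforce simp: fm_in_def q_def ctx_vars_def nth_append less_Suc_eq)
  have **: "as @ [a] \<in> tuples X (ss @ [s])" if "as \<in> tuples X ss" "a \<in> carr X s"
    for X :: "('x, 'a, 'b, 'c) struc" and as a
    using that by (auto simp: append_in_tuples tuples_Cons)
  show ?thesis unfolding codefinable_def
    using p(2,3) \<open>fm_in K ss q\<close> by (intro exI[of _ q]) (auto simp: * **)
qed

lemma codefinable_ex_append:
  assumes "codefinable K M N (ss @ ts) P Q"
  shows "codefinable K M N ss (\<lambda>as. \<exists>x\<in>tuples M ts. P (as @ x)) (\<lambda>as. \<exists>x\<in>tuples N ts. Q (as @ x))"
  using assms
proof (induction ts arbitrary: ss)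
  case (Cons t ts)
  have "codefinable K M N (ss @ [t]) (\<lambda>as. \<exists>x\<in>tuples M ts. P (as @ x)) (\<lambda>as. \<exists>x\<in>tuples N ts.
      Q (as @ x))"
    using Cons.prems by (intro Cons.IH) simp
  from codefinable_ex_one[OF this] show ?case
    by (rule codefinable_cong) (force simp: tuples_Cons)+
qed simp

text \<open>The matrix depends on the old tuple and the new block as two separate arguments, as it
  does in a bounded quantifier of HOL, so the rule applies backwards to nested quantifiers without
  rewriting the goal.\<close>

lemma codefinable_ex:
  assumes "codefinable K M N (ss @ ts) (\<lambda>as. P (before ss as) (after ss as)) (\<lambda>as.
      Q (before ss as) (after ss as))"
  shows "codefinable K M N ss (\<lambda>as. \<exists>x\<in>tuples M ts. P as x) (\<lambda>as. \<exists>x\<in>tuples N ts. Q as x)"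
  by (rule codefinable_cong[OF codefinable_ex_append[OF assms]]) auto

lemma codefinable_all:
  assumes "codefinable K M N (ss @ ts) (\<lambda>as. P (before ss as) (after ss as)) (\<lambda>as.
      Q (before ss as) (after ss as))"
  shows "codefinable K M N ss (\<lambda>as. \<forall>x\<in>tuples M ts. P as x) (\<lambda>as. \<forall>x\<in>tuples N ts. Q as x)"
  using codefinable_not[OF codefinable_ex[OF codefinable_not[OF assms]]] by simp

section \<open>Quantification over argument lists of fixed length\<close>

definition ntuples :: "nat \<Rightarrow> ('u, 's, 'f, 'r) struc \<Rightarrow> 's list \<Rightarrow> 'u list list set" where
  "ntuples n M ts = {xs. length xs = n \<and> (\<forall>i<n. xs ! i \<in> tuples M ts)}"

lemma ntuplesI: "length xs = n \<Longrightarrow> set xs \<subseteq> tuples M ts \<Longrightarrow> xs \<in> ntuples n M ts"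
  by (auto simp: ntuples_def)

lemma ntuples_length: "xs \<in> ntuples n M ts \<Longrightarrow> length xs = n"
  by (auto simp: ntuples_def)

lemma ntuples_nth: "xs \<in> ntuples n M ts \<Longrightarrow> i < n \<Longrightarrow> xs ! i \<in> tuples M ts"
  by (auto simp: ntuples_def)

fun chop :: "nat \<Rightarrow> nat \<Rightarrow> 'u list \<Rightarrow> 'u list list" where
  "chop k 0 x = []"
| "chop k (Suc n) x = take k x # chop k n (drop k x)"

lemma length_chop [simp]: "length (chop k n x) = n"
  by (induction n arbitrary: x) auto

definition coprojs ::
  "('u, 's, 'f, 'r) struc \<Rightarrow> ('v, 's, 'f, 'r) struc \<Rightarrow> 's list \<Rightarrow> nat \<Rightarrow> 's list \<Rightarrow>
     ('u list \<Rightarrow> 'u list list) \<Rightarrow> ('v list \<Rightarrow> 'v list list) \<Rightarrow> bool" where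
  "coprojs M N ss n us F G \<longleftrightarrow>
     (\<forall>as \<in> tuples M ss. length (F as) = n) \<and> (\<forall>as \<in> tuples N ss. length (G as) = n) \<and>
     (\<forall>i<n. coproj M N ss us (\<lambda>as. F as ! i) (\<lambda>as. G as ! i))"

lemma coprojs_nth:
  "coprojs M N ss n us F G \<Longrightarrow> i < n \<Longrightarrow> coproj M N ss us (\<lambda>as. F as ! i) (\<lambda>as. G as ! i)"
  by (simp add: coprojs_def)

lemma coproj_cong:
  assumes "coproj M N ss us F G"
    and "\<And>as. as \<in> tuples M ss \<Longrightarrow> F as = F' as" "\<And>bs. bs \<in> tuples N ss \<Longrightarrow> G bs = G' bs"
  shows "coproj M N ss us F' G'"
  using assms unfolding coproj_def by auto

lemma coprojs_before:
  assumes "coprojs M N ss n us F G"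
  shows "coprojs M N (ss @ ts) n us (\<lambda>as. F (before ss as)) (\<lambda>as. G (before ss as))"
proof -
  have "coproj M N (ss @ ts) us (\<lambda>as. F (before ss as) ! i) (\<lambda>as. G (before ss as) ! i)"
      if "i < n" for i
    using coproj_before[OF coprojs_nth[OF assms that]] .
  then show ?thesis using assms by (auto simp: coprojs_def tuples_append)
qed

lemma coprojs_map_take:
  assumes "coprojs M N ss n (us @ vs) F G"
  shows "coprojs M N ss n us (\<lambda>as. map (take (length us)) (F as)) (\<lambda>as. map (take (length us))
      (G as))"
proof -
  have "coproj M N ss us (\<lambda>as. map (take (length us)) (F as) ! i) (\<lambda>as. map (take (length us))
      (G as) ! i)" if "i < n" for i
    by (rule coproj_cong[OF coproj_take[OF coprojs_nth[OF assms that]]])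
      (use assms that in \<open>auto simp: coprojs_def\<close>)
  then show ?thesis using assms by (auto simp: coprojs_def)
qed

lemma coprojs_map_drop:
  assumes "coprojs M N ss n (us @ vs) F G"
  shows "coprojs M N ss n vs (\<lambda>as. map (drop (length us)) (F as)) (\<lambda>as. map (drop (length us))
      (G as))"
proof -
  have "coproj M N ss vs (\<lambda>as. map (drop (length us)) (F as) ! i) (\<lambda>as. map (drop (length us))
      (G as) ! i)" if "i < n" for i
    by (rule coproj_cong[OF coproj_drop[OF coprojs_nth[OF assms that]]])
      (use assms that in \<open>auto simp: coprojs_def\<close>)
  then show ?thesis using assms by (auto simp: coprojs_def)
qed

lemma coproj_concat:
  assumes "coprojs M N ss n us F G"
  shows "coproj M N ss (concat (replicate n us)) (\<lambda>as. concat (F as)) (\<lambda>as. concat (G as))"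
proof -
  have "coproj M N ss (concat (replicate k us)) (\<lambda>as. concat (take k (F as))) (\<lambda>as.
      concat (take k (G as)))"
    if "k \<le> n" for k
    using that
  proof (induction k)
    case (Suc k)
    have "coproj M N ss (concat (replicate k us) @ us) (\<lambda>as. concat (take k (F as)) @ F as ! k)
        (\<lambda>as. concat (take k (G as)) @ G as ! k)"
      using Suc by (intro coproj_append coprojs_nth[OF assms]) auto
    moreover have "concat (replicate k us) @ us = concat (replicate (Suc k) us)"
      by (induction k) auto
    ultimately have "coproj M N ss (concat (replicate (Suc k) us)) (\<lambda>as. concat (take k (F as))
        @ F as ! k) (\<lambda>as. concat (take k (G as)) @ G as ! k)"
      by simp
    then show ?case
      by (rule coproj_cong) (use Suc.prems assms in \<open>auto simp: coprojs_def take_Suc_conv_app_nth\<close>)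
  qed (simp add: coproj_Nil)
  from this[of n] show ?thesis
    by (rule coproj_cong) (use assms in \<open>auto simp: coprojs_def\<close>)
qed

lemma coproj_chop_nth:
  assumes "coproj M N ss (concat (replicate n us)) F G" "i < n"
  shows "coproj M N ss us (\<lambda>as. chop (length us) n (F as) ! i) (\<lambda>as. chop (length us) n (G as) ! i)"
  using assms
proof (induction n arbitrary: i F G)
  case (Suc n)
  then have *: "coproj M N ss (us @ concat (replicate n us)) F G" by simp
  show ?case
    using coproj_take[OF *] Suc.IH[OF coproj_drop[OF *]] Suc.prems(2) by (cases i) auto
qed simp

lemma coprojs_chop_after:
  "coprojs M N (ss @ concat (replicate n ts)) n ts
     (\<lambda>as. chop (length ts) n (after ss as)) (\<lambda>as. chop (length ts) n (after ss as))"
  unfolding coprojs_def by (auto intro: coproj_chop_nth coproj_after)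

lemma chop_concat_replicate:
  "x \<in> tuples M (concat (replicate n ts)) \<Longrightarrow> concat (chop (length ts) n x) = x \<and> chop (length ts)
      n x \<in> ntuples n M ts"
proof (induction n arbitrary: x)
  case (Suc n)
  then obtain y z where "x = y @ z" "y \<in> tuples M ts" "z \<in> tuples M (concat (replicate n ts))"
    by (auto simp: tuples_append)
  then show ?case using Suc.IH[of z]
    by (auto simp: ntuples_def tuples_length nth_Cons split: nat.split)
qed (auto simp: ntuples_def)

lemma concat_ntuples:
  "xs \<in> ntuples n M ts \<Longrightarrow> concat xs \<in> tuples M (concat (replicate n ts)) \<and> chop (length ts)
      n (concat xs) = xs"
proof (induction n arbitrary: xs)
  case (Suc n)
  then obtain y z where yz: "xs = y # z" by (auto simp: ntuples_def length_Suc_conv)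
  with Suc.prems have "y \<in> tuples M ts" "z \<in> ntuples n M ts"
    by (auto simp: ntuples_def nth_Cons' dest: spec[of _ "Suc _"])
  with Suc.IH[of z] yz show ?case by (auto simp: tuples_append tuples_length)
qed (auto simp: ntuples_def)

text \<open>The arity \<open>n\<close> is fixed outside the logic, and \<open>concat\<close> and
  \<open>chop\<close> are inverse to each other, so a quantifier over lists of \<open>n\<close>
  tuples is a quantifier over one long tuple.\<close>

lemma codefinable_ex_ntuples:
  assumes "codefinable K M N (ss @ concat (replicate n ts))
     (\<lambda>as. P (before ss as) (chop (length ts) n (after ss as))) (\<lambda>as. Q (before ss as)
         (chop (length ts) n (after ss as)))"
  shows "codefinable K M N ss (\<lambda>as. \<exists>x\<in>ntuples n M ts. P as x) (\<lambda>as. \<exists>x\<in>ntuples n N ts. Q as x)"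
  by (rule codefinable_cong[OF codefinable_ex_append[OF assms]])
    (auto, (metis chop_concat_replicate concat_ntuples)+)

lemma codefinable_all_ntuples:
  assumes "codefinable K M N (ss @ concat (replicate n ts))
     (\<lambda>as. P (before ss as) (chop (length ts) n (after ss as))) (\<lambda>as. Q (before ss as)
         (chop (length ts) n (after ss as)))"
  shows "codefinable K M N ss (\<lambda>as. \<forall>x\<in>ntuples n M ts. P as x) (\<lambda>as. \<forall>x\<in>ntuples n N ts. Q as x)"
  using codefinable_not[OF codefinable_ex_ntuples[OF codefinable_not[OF assms]]] by simp

text \<open>In the empty context the only tuple is \<open>[]\<close>, so the defining formula is a
  sentence and elementary equivalence applies to it.\<close>

lemma codefinable_sentence:
  assumes "codefinable K M N [] P Q" "elem_equiv K M N"
  shows "P [] \<longleftrightarrow> Q []"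
  using assms unfolding codefinable_def elem_equiv_def by auto

section \<open>The formulas of a code, and the condition that they describe a structure\<close>

lemma concat_replicate_snoc: "concat (replicate (Suc n) us) = concat (replicate n us) @ us"
  by (induction n) auto

lemma codefinable_dom_set:
  assumes "wf_code L K \<Gamma>" "coproj M N ss (xsorts \<Gamma>) F G" "coproj M N ss (psorts \<Gamma>) P Q"
  shows "codefinable K M N ss (\<lambda>as. F as \<in> dom_set \<Gamma> M (P as)) (\<lambda>as. G as \<in> dom_set \<Gamma> N (Q as))"
proof -
  have "fm_in K (xsorts \<Gamma> @ psorts \<Gamma>) (dom_fm \<Gamma>)" using assms(1) by (simp add: wf_code_def)
  from codefinable_holds[OF this coproj_append[OF assms(2,3)]] show ?thesis
    by (rule codefinable_cong) (auto simp: dom_set_def coproj_tuples[OF assms(2)])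
qed

lemma codefinable_eq_rel:
  assumes "wf_code L K \<Gamma>" "coproj M N ss (xsorts \<Gamma>) F G" "coproj M N ss (xsorts \<Gamma>) F' G'"
    "coproj M N ss (psorts \<Gamma>) P Q"
  shows "codefinable K M N ss (\<lambda>as. (F as, F' as) \<in> eq_rel \<Gamma> M (P as)) (\<lambda>as. (G as, G' as)
      \<in> eq_rel \<Gamma> N (Q as))"
proof -
  have "fm_in K (xsorts \<Gamma> @ xsorts \<Gamma> @ psorts \<Gamma>) (eq_fm \<Gamma>)" using assms(1)
      by (simp add: wf_code_def)
  from codefinable_holds[OF this coproj_append[OF assms(2) coproj_append[OF assms(3,4)]]]
  show ?thesis unfolding eq_rel_def mem_Collect_eq prod.case
    by (intro codefinable_conj codefinable_dom_set[OF assms(1)] assms)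
qed

lemma codefinable_fun_graph:
  assumes "wf_code L K \<Gamma>" "f \<in> funs L" "n = length (fdom L f)"
    "coprojs M N ss n (xsorts \<Gamma>) F G" "coproj M N ss (xsorts \<Gamma>) F' G'" "coproj M N ss (psorts \<Gamma>)
        P Q"
  shows "codefinable K M N ss (\<lambda>as. fun_graph \<Gamma> M (P as) f (F as) (F' as)) (\<lambda>as.
      fun_graph \<Gamma> N (Q as) f (G as) (G' as))"
proof -
  \<comment> \<open>\<open>wf_code\<close> counts the value as one more block of the arguments,
    whereas the graph lists arguments and value apart.\<close>
  have "fm_in K (concat (replicate n (xsorts \<Gamma>)) @ xsorts \<Gamma> @ psorts \<Gamma>) (fun_fm \<Gamma> f)"
    using assms(1,2) unfolding wf_code_def concat_replicate_snoc assms(3) by auto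
  from codefinable_holds[OF this coproj_append[OF coproj_concat[OF assms(4)] coproj_append[OF
      assms(5,6)]]]
  show ?thesis unfolding fun_graph_def .
qed

lemma codefinable_rel_holds:
  assumes "wf_code L K \<Gamma>" "r \<in> rels L" "n = length (rdom L r)"
    "coprojs M N ss n (xsorts \<Gamma>) F G" "coproj M N ss (psorts \<Gamma>) P Q"
  shows "codefinable K M N ss (\<lambda>as. rel_holds \<Gamma> M (P as) r (F as)) (\<lambda>as. rel_holds \<Gamma> N (Q as)
      r (G as))"
proof -
  have "fm_in K (concat (replicate n (xsorts \<Gamma>)) @ psorts \<Gamma>) (rel_fm \<Gamma> r)"
    using assms(1-3) unfolding wf_code_def by auto
  from codefinable_holds[OF this coproj_append[OF coproj_concat[OF assms(4)] assms(5)]]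
  show ?thesis unfolding rel_holds_def .
qed

lemma dom_set_tuples: "x \<in> dom_set \<Gamma> M p \<Longrightarrow> x \<in> tuples M (xsorts \<Gamma>)"
  by (simp add: dom_set_def)

lemma eq_rel_dom_set: "(x, y) \<in> eq_rel \<Gamma> M p \<Longrightarrow> x \<in> dom_set \<Gamma> M p \<and> y \<in> dom_set \<Gamma> M p"
  by (simp add: eq_rel_def)

lemma list_all2_eq_rel_iff:
  "length xs = n \<and> list_all2 (\<lambda>x x'. (x, x') \<in> eq_rel \<Gamma> M p) xs xs' \<longleftrightarrow>
     xs \<in> ntuples n M (xsorts \<Gamma>) \<and> xs' \<in> ntuples n M (xsorts \<Gamma>) \<and> (\<forall>i<n. (xs ! i, xs' ! i)
         \<in> eq_rel \<Gamma> M p)"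
  by (auto simp: list_all2_conv_all_nth ntuples_def dest: eq_rel_dom_set dom_set_tuples)

lemma lists_dom_set_iff:
  "xs \<in> lists (dom_set \<Gamma> M p) \<and> length xs = n \<longleftrightarrow>
     xs \<in> ntuples n M (xsorts \<Gamma>) \<and> (\<forall>i<n. xs ! i \<in> dom_set \<Gamma> M p)"
  unfolding in_lists_conv_set all_set_conv_all_nth ntuples_def by (auto dest: dom_set_tuples)

text \<open>All quantifiers are brought to range over tuples of fixed sorts, over
  \<open>ntuples\<close>, over numbers below an arity or over the symbols of the signature, and
  memberships in the domain become premises or conjuncts. In this form each connective matches a
  closure rule of \<open>codefinable\<close>.\<close>

lemma code_ok_iff:
  "code_ok L \<Gamma> M p \<longleftrightarrow>
     (\<exists>x\<in>tuples M (xsorts \<Gamma>). x \<in> dom_set \<Gamma> M p) \<and>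
     (\<forall>x\<in>tuples M (xsorts \<Gamma>). x \<in> dom_set \<Gamma> M p \<longrightarrow> (x, x) \<in> eq_rel \<Gamma> M p) \<and>
     (\<forall>x\<in>tuples M (xsorts \<Gamma>). \<forall>y\<in>tuples M (xsorts \<Gamma>).
        (x, y) \<in> eq_rel \<Gamma> M p \<longrightarrow> (y, x) \<in> eq_rel \<Gamma> M p) \<and>
     (\<forall>x\<in>tuples M (xsorts \<Gamma>). \<forall>y\<in>tuples M (xsorts \<Gamma>). \<forall>z\<in>tuples M (xsorts \<Gamma>).
        (x, y) \<in> eq_rel \<Gamma> M p \<and> (y, z) \<in> eq_rel \<Gamma> M p \<longrightarrow> (x, z) \<in> eq_rel \<Gamma> M p) \<and>
     (\<forall>f\<in>funs L.
        (\<forall>xs\<in>ntuples (length (fdom L f)) M (xsorts \<Gamma>).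
           (\<forall>i<length (fdom L f). xs ! i \<in> dom_set \<Gamma> M p) \<longrightarrow>
           (\<exists>y\<in>tuples M (xsorts \<Gamma>). y \<in> dom_set \<Gamma> M p \<and> fun_graph \<Gamma> M p f xs y \<and>
              (\<forall>y'\<in>tuples M (xsorts \<Gamma>).
                 y' \<in> dom_set \<Gamma> M p \<and> fun_graph \<Gamma> M p f xs y' \<longrightarrow> (y, y') \<in> eq_rel \<Gamma> M p))) \<and>
        (\<forall>xs\<in>ntuples (length (fdom L f)) M (xsorts \<Gamma>). \<forall>xs'\<in>ntuples (length (fdom L f))
            M (xsorts \<Gamma>).
           \<forall>y\<in>tuples M (xsorts \<Gamma>). \<forall>y'\<in>tuples M (xsorts \<Gamma>).
           (\<forall>i<length (fdom L f). (xs ! i, xs' ! i) \<in> eq_rel \<Gamma> M p) \<and> (y, y') \<in> eq_rel \<Gamma> M p \<longrightarrow>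
           (fun_graph \<Gamma> M p f xs y \<longleftrightarrow> fun_graph \<Gamma> M p f xs' y'))) \<and>
     (\<forall>r\<in>rels L.
        \<forall>xs\<in>ntuples (length (rdom L r)) M (xsorts \<Gamma>). \<forall>xs'\<in>ntuples (length (rdom L r)) M (xsorts \<Gamma>).
          (\<forall>i<length (rdom L r). (xs ! i, xs' ! i) \<in> eq_rel \<Gamma> M p) \<longrightarrow>
          (rel_holds \<Gamma> M p r xs \<longleftrightarrow> rel_holds \<Gamma> M p r xs'))"
    (is "_ \<longleftrightarrow> ?a \<and> ?b \<and> ?c \<and> ?d \<and> (\<forall>f\<in>funs L. ?e f \<and> ?g f) \<and> (\<forall>r\<in>rels L. ?h r)")
proof -
  let ?D = "dom_set \<Gamma> M p" and ?E = "eq_rel \<Gamma> M p"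
  have a: "?D \<noteq> {} \<longleftrightarrow> ?a" by (auto dest: dom_set_tuples)
  have sub: "?E \<subseteq> ?D \<times> ?D" by (auto dest: eq_rel_dom_set)
  have bexD: "(\<exists>y\<in>?D. R y) \<longleftrightarrow> (\<exists>y\<in>tuples M (xsorts \<Gamma>). y \<in> ?D \<and> R y)" for R
    by (auto dest: dom_set_tuples)
  have ballD: "(\<forall>y\<in>?D. R y) \<longleftrightarrow> (\<forall>y\<in>tuples M (xsorts \<Gamma>). y \<in> ?D \<longrightarrow> R y)" for R
    by (auto dest: dom_set_tuples)
  have allE: "(\<forall>x y. (x, y) \<in> ?E \<longrightarrow> R x y) \<longleftrightarrow>
      (\<forall>x\<in>tuples M (xsorts \<Gamma>). \<forall>y\<in>tuples M (xsorts \<Gamma>). (x, y) \<in> ?E \<longrightarrow> R x y)" for R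
    by (auto dest: dom_set_tuples eq_rel_dom_set)
  have c: "sym ?E \<longleftrightarrow> ?c" unfolding sym_def by (rule allE)
  have d: "trans ?E \<longleftrightarrow> ?d" unfolding trans_def
    by (auto dest: dom_set_tuples eq_rel_dom_set) (meson dom_set_tuples eq_rel_dom_set)
  have b: "equiv ?D ?E \<longleftrightarrow> ?b \<and> ?c \<and> ?d"
    unfolding equiv_def c d refl_on_def ballD using sub by blast
  have ball_lists: "(\<forall>xs\<in>lists ?D. length xs = n \<longrightarrow> R xs) \<longleftrightarrow>
      (\<forall>xs\<in>ntuples n M (xsorts \<Gamma>). (\<forall>i<n. xs ! i \<in> ?D) \<longrightarrow> R xs)" for R n
    using lists_dom_set_iff[of _ \<Gamma> M p n] by blast
  have e: "(\<forall>xs \<in> lists ?D. length xs = length (fdom L f) \<longrightarrow>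
           (\<exists>y \<in> ?D. fun_graph \<Gamma> M p f xs y \<and>
              (\<forall>y' \<in> ?D. fun_graph \<Gamma> M p f xs y' \<longrightarrow> (y, y') \<in> ?E))) \<longleftrightarrow> ?e f" for f
    unfolding ball_lists bexD ballD imp_conjL ..
  have all2: "(\<forall>xs xs'. length xs = n \<and> list_all2 (\<lambda>x x'. (x, x') \<in> ?E) xs xs' \<longrightarrow> R xs xs') \<longleftrightarrow>
     (\<forall>xs\<in>ntuples n M (xsorts \<Gamma>). \<forall>xs'\<in>ntuples n M (xsorts \<Gamma>).
        (\<forall>i<n. (xs ! i, xs' ! i) \<in> ?E) \<longrightarrow> R xs xs')" for R n
    unfolding list_all2_eq_rel_iff by blast
  have g: "(\<forall>xs xs' y y'. length xs = length (fdom L f) \<and>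
           list_all2 (\<lambda>x x'. (x, x') \<in> ?E) xs xs' \<and> (y, y') \<in> ?E \<longrightarrow>
           (fun_graph \<Gamma> M p f xs y \<longleftrightarrow> fun_graph \<Gamma> M p f xs' y')) \<longleftrightarrow> ?g f" (is "?l = _") for f
  proof -
    have "?l \<longleftrightarrow> (\<forall>xs xs'. length xs = length (fdom L f) \<and> list_all2 (\<lambda>x x'. (x, x') \<in> ?E) xs xs' \<longrightarrow>
       (\<forall>y y'. (y, y') \<in> ?E \<longrightarrow> (fun_graph \<Gamma> M p f xs y \<longleftrightarrow> fun_graph \<Gamma> M p f xs' y')))" by blast
    also have "\<dots> \<longleftrightarrow> ?g f" unfolding all2 allE by blast
    finally show ?thesis .
  qed
  note h = all2
  show ?thesis unfolding code_ok_def a b e g h by blast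
qed

lemmas coproj_intros = coproj_after coproj_before coprojs_chop_after coprojs_before coprojs_nth

lemmas codefinable_intros =
  codefinable_conj codefinable_disj codefinable_imp codefinable_iff codefinable_not
  codefinable_ex codefinable_all codefinable_ex_ntuples codefinable_all_ntuples
  codefinable_all_less

lemma codefinable_code_ok:
  assumes "finite_sig L" "wf_code L K \<Gamma>" "coproj M N ss (psorts \<Gamma>) P Q"
  shows "codefinable K M N ss (\<lambda>as. code_ok L \<Gamma> M (P as)) (\<lambda>as. code_ok L \<Gamma> N (Q as))"
proof -
  have fin: "finite (funs L)" "finite (rels L)" using assms(1) by (auto simp: finite_sig_def)
  show ?thesis unfolding code_ok_iff
    by (assumption | rule codefinable_intros codefinable_ball_finite[OF fin(1)]
        codefinable_ball_finite[OF fin(2)]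
      codefinable_dom_set[OF assms(2)] codefinable_eq_rel[OF assms(2)]
      codefinable_fun_graph[OF assms(2) _ refl] codefinable_rel_holds[OF assms(2) _ refl]
      coproj_intros assms(3))+
qed

section \<open>Isomorphisms between interpreted structures\<close>

text \<open>\<open>T\<close> relates representatives of classes that correspond to each other; it need not relate all
    of
  them.\<close>

definition iso_graph ::
  "(unit, 'f, 'r) sig \<Rightarrow> ('s, 'f, 'r, 'g, 'q) icode \<Rightarrow> ('s, 'f, 'r, 'g, 'q) icode \<Rightarrow>
     ('u, 's, 'g, 'q) struc \<Rightarrow> 'u list \<Rightarrow> 'u list \<Rightarrow> ('u list \<Rightarrow> 'u list \<Rightarrow> bool) \<Rightarrow> bool" where
  "iso_graph L \<Gamma>1 \<Gamma>2 M p1 p2 T \<longleftrightarrow>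
     (\<forall>x\<in>tuples M (xsorts \<Gamma>1). \<forall>y\<in>tuples M (xsorts \<Gamma>2).
        T x y \<longrightarrow> x \<in> dom_set \<Gamma>1 M p1 \<and> y \<in> dom_set \<Gamma>2 M p2) \<and>
     (\<forall>x\<in>tuples M (xsorts \<Gamma>1). x \<in> dom_set \<Gamma>1 M p1 \<longrightarrow> (\<exists>y\<in>tuples M (xsorts \<Gamma>2). T x y)) \<and>
     (\<forall>y\<in>tuples M (xsorts \<Gamma>2). y \<in> dom_set \<Gamma>2 M p2 \<longrightarrow> (\<exists>x\<in>tuples M (xsorts \<Gamma>1). T x y)) \<and>
     (\<forall>x\<in>tuples M (xsorts \<Gamma>1). \<forall>x'\<in>tuples M (xsorts \<Gamma>1).
      \<forall>y\<in>tuples M (xsorts \<Gamma>2). \<forall>y'\<in>tuples M (xsorts \<Gamma>2).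
        T x y \<and> T x' y' \<longrightarrow> ((x, x') \<in> eq_rel \<Gamma>1 M p1 \<longleftrightarrow> (y, y') \<in> eq_rel \<Gamma>2 M p2)) \<and>
     (\<forall>f\<in>funs L.
        \<forall>xs\<in>ntuples (length (fdom L f)) M (xsorts \<Gamma>1). \<forall>ys\<in>ntuples (length (fdom L f))
            M (xsorts \<Gamma>2).
        \<forall>x\<in>tuples M (xsorts \<Gamma>1). \<forall>y\<in>tuples M (xsorts \<Gamma>2).
          (\<forall>i<length (fdom L f). T (xs ! i) (ys ! i)) \<and> T x y \<and> fun_graph \<Gamma>1 M p1 f xs x \<longrightarrow>
          fun_graph \<Gamma>2 M p2 f ys y) \<and>
     (\<forall>r\<in>rels L.
        \<forall>xs\<in>ntuples (length (rdom L r)) M (xsorts \<Gamma>1). \<forall>ys\<in>ntuples (length (rdom L r))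
            M (xsorts \<Gamma>2).
          (\<forall>i<length (rdom L r). T (xs ! i) (ys ! i)) \<longrightarrow>
          (rel_holds \<Gamma>1 M p1 r xs \<longleftrightarrow> rel_holds \<Gamma>2 M p2 r ys))"

text \<open>For a relation given by a formula, being an isomorphism graph is a first-order condition
  on the parameters. These enter as projections of the context, so that they can be quantified
  afterwards.\<close>

lemma codefinable_iso_graph:
  assumes "finite_sig L" "wf_code L K \<Gamma>1" "wf_code L K \<Gamma>2"
    and "fm_in K (xsorts \<Gamma>1 @ xsorts \<Gamma>2 @ qs) \<theta>"
    and "coproj M N ss (psorts \<Gamma>1) P1 Q1" "coproj M N ss (psorts \<Gamma>2) P2 Q2" "coproj M N ss qs C D"
  shows "codefinable K M N ss
    (\<lambda>as. iso_graph L \<Gamma>1 \<Gamma>2 M (P1 as) (P2 as) (\<lambda>x y. holds M \<theta> (x @ y @ C as)))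
    (\<lambda>as. iso_graph L \<Gamma>1 \<Gamma>2 N (Q1 as) (Q2 as) (\<lambda>x y. holds N \<theta> (x @ y @ D as)))"
proof -
  have fin: "finite (funs L)" "finite (rels L)" using assms(1) by (auto simp: finite_sig_def)
  show ?thesis unfolding iso_graph_def
    by (assumption | rule codefinable_intros codefinable_ball_finite[OF fin(1)]
        codefinable_ball_finite[OF fin(2)]
      codefinable_dom_set[OF assms(2)] codefinable_eq_rel[OF assms(2)]
      codefinable_fun_graph[OF assms(2) _ refl] codefinable_rel_holds[OF assms(2) _ refl]
      codefinable_dom_set[OF assms(3)] codefinable_eq_rel[OF assms(3)]
      codefinable_fun_graph[OF assms(3) _ refl] codefinable_rel_holds[OF assms(3) _ refl]
      codefinable_holds[OF assms(4)] coproj_append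
      coproj_intros assms(5-7))+
qed

section \<open>One-sorted isomorphisms and the quotient structure of a code\<close>

lemma map2_unit: "length as = length us \<Longrightarrow> map2 h us as = map (h ()) as"
  by (induction as us rule: list_induct2) auto

lemma tuples_unit: "as \<in> tuples M us \<longleftrightarrow> length as = length us \<and> set as \<subseteq> carr M ()"
  by (auto simp: tuples_def list_all2_conv_all_nth set_conv_nth)

lemma is_iso_unit:
  fixes L :: "(unit, 'f, 'r) sig"
  shows "is_iso L h M N \<longleftrightarrow> bij_betw (h ()) (carr M ()) (carr N ()) \<and>
    (\<forall>f\<in>funs L. \<forall>as. length as = length (fdom L f) \<and> set as \<subseteq> carr M () \<longrightarrow>
       h () (fn M f as) = fn N f (map (h ()) as)) \<and>
    (\<forall>r\<in>rels L. \<forall>as. length as = length (rdom L r) \<and> set as \<subseteq> carr M () \<longrightarrow>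
       (rl M r as \<longleftrightarrow> rl N r (map (h ()) as)))"
  by (auto simp: is_iso_def tuples_unit map2_unit)

lemma isomorphic_trans:
  fixes L :: "(unit, 'f, 'r) sig"
  assumes "isomorphic L M N" "isomorphic L N P"
  shows "isomorphic L M P"
proof -
  obtain g h where g: "is_iso L g M N" and h: "is_iso L h N P"
    using assms by (auto simp: isomorphic_def)
  have "set (map (g ()) as) \<subseteq> carr N ()" if "set as \<subseteq> carr M ()" for as
    using g that by (auto simp: is_iso_unit bij_betw_def)
  then have "is_iso L (\<lambda>s. h s \<circ> g s) M P"
    using g h unfolding is_iso_unit by (auto intro: bij_betw_trans simp flip: map_map)
  then show ?thesis by (auto simp: isomorphic_def)
qed

lemma class_eq:
  "equiv D E \<Longrightarrow> C \<in> D // E \<Longrightarrow> x \<in> C \<Longrightarrow> C = E `` {x} \<and> x \<in> D"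
  by (metis Image_singleton_iff equiv_class_eq_iff quotientE)

lemma reps_exist:
  assumes "equiv D E" "set Cs \<subseteq> D // E"
  obtains xs where "list_all2 (\<in>) xs Cs" "set xs \<subseteq> D"
proof -
  have *: "\<exists>x. x \<in> C \<and> x \<in> D" if "C \<in> D // E" for C
    using that assms(1) by (auto simp: quotient_def dest: equiv_class_self)
  have "\<exists>xs. list_all2 (\<in>) xs Cs \<and> set xs \<subseteq> D"
    using assms(2)
  proof (induction Cs)
    case (Cons C Cs)
    then obtain xs x where "list_all2 (\<in>) xs Cs" "set xs \<subseteq> D" "x \<in> C" "x \<in> D" using * by fastforce
    then show ?case by (intro exI[of _ "x # xs"]) auto
  qed auto
  then show ?thesis using that by blast
qed

context
  fixes L :: "(unit, 'f, 'r) sig" and \<Gamma> :: "('s, 'f, 'r, 'g, 'q) icode"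
    and M :: "('u, 's, 'g, 'q) struc" and p :: "'u list"
  assumes ok: "code_ok L \<Gamma> M p"
begin

lemma equiv_eq_rel: "equiv (dom_set \<Gamma> M p) (eq_rel \<Gamma> M p)"
  using ok by (simp add: code_ok_def)

lemma carr_interp: "carr (interp \<Gamma> M p) u = dom_set \<Gamma> M p // eq_rel \<Gamma> M p"
  by (simp add: interp_def)

lemma reps_eq_rel:
  assumes "set Cs \<subseteq> dom_set \<Gamma> M p // eq_rel \<Gamma> M p" "list_all2 (\<in>) xs Cs" "list_all2 (\<in>) xs' Cs"
  shows "list_all2 (\<lambda>x x'. (x, x') \<in> eq_rel \<Gamma> M p) xs xs'"
proof -
  have "(xs ! i, xs' ! i) \<in> eq_rel \<Gamma> M p" if "i < length Cs" for i
    using that assms quotient_eq_iff[OF equiv_eq_rel, of "Cs ! i" "Cs ! i" "xs ! i" "xs' ! i"]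
    by (auto simp: list_all2_conv_all_nth subset_iff)
  then show ?thesis using assms(2,3) by (auto simp: list_all2_conv_all_nth)
qed

text \<open>Totality gives a value \<open>y0\<close> for one list of representatives, and invariance
  under the equivalence makes the values for every other list exactly the members of the class of
  \<open>y0\<close>. That class is what the definite description in \<open>interp\<close> denotes,
  so membership in it can be tested with any representatives.\<close>

lemma interp_fn:
  assumes f: "f \<in> funs L" and Cs: "length Cs = length (fdom L f)"
      "set Cs \<subseteq> dom_set \<Gamma> M p // eq_rel \<Gamma> M p"
  shows "fn (interp \<Gamma> M p) f Cs \<in> dom_set \<Gamma> M p // eq_rel \<Gamma> M p"
    and "list_all2 (\<in>) xs Cs \<Longrightarrow>
      y \<in> fn (interp \<Gamma> M p) f Cs \<longleftrightarrow> y \<in> dom_set \<Gamma> M p \<and> fun_graph \<Gamma> M p f xs y"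
proof -
  let ?D = "dom_set \<Gamma> M p" and ?E = "eq_rel \<Gamma> M p"
  obtain xs0 where xs0: "list_all2 (\<in>) xs0 Cs" "set xs0 \<subseteq> ?D"
      using reps_exist[OF equiv_eq_rel Cs(2)] .
  have len: "length xs0 = length (fdom L f)" using xs0(1) Cs(1) by (simp add: list_all2_lengthD)
  then obtain y0 where y0: "y0 \<in> ?D" "fun_graph \<Gamma> M p f xs0 y0"
    "\<And>y'. y' \<in> ?D \<Longrightarrow> fun_graph \<Gamma> M p f xs0 y' \<Longrightarrow> (y0, y') \<in> ?E"
    using ok f xs0(2) unfolding code_ok_def in_lists_conv_set by blast
  have inv: "fun_graph \<Gamma> M p f xs y \<longleftrightarrow> fun_graph \<Gamma> M p f xs' y'"
    if "list_all2 (\<in>) xs Cs" "list_all2 (\<in>) xs' Cs" "(y, y') \<in> ?E" for xs xs' y y'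
  proof -
    have "length xs = length (fdom L f)" using that Cs(1) by (simp add: list_all2_lengthD)
    then show ?thesis
      using ok f reps_eq_rel[OF Cs(2) that(1,2)] that(3) unfolding code_ok_def by blast
  qed
  have refl: "(y, y) \<in> ?E" if "y \<in> ?D" for y
    using equiv_eq_rel that by (auto simp: equiv_def refl_on_def)
  have cl: "y \<in> ?E `` {y0} \<longleftrightarrow> y \<in> ?D \<and> fun_graph \<Gamma> M p f xs y" if "list_all2 (\<in>) xs Cs" for xs y
    using y0 inv[OF xs0(1) that] refl[of y] eq_rel_dom_set[of y0 y \<Gamma> M p] by blast
  have "fn (interp \<Gamma> M p) f Cs = ?E `` {y0}"
    unfolding interp_def struc.simps
  proof (rule the_equality)
    show "?E `` {y0} \<in> ?D // ?E \<and>
      (\<exists>xs y. list_all2 (\<in>) xs Cs \<and> y \<in> ?E `` {y0} \<and> fun_graph \<Gamma> M p f xs y)"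
      using y0 xs0(1) refl[OF y0(1)] by (auto intro!: quotientI)
  next
    fix C assume C: "C \<in> ?D // ?E \<and> (\<exists>xs y. list_all2 (\<in>) xs Cs \<and> y \<in> C \<and> fun_graph \<Gamma> M p f xs y)"
    then obtain xs y where "list_all2 (\<in>) xs Cs" "y \<in> C" "fun_graph \<Gamma> M p f xs y" by blast
    moreover have "C = ?E `` {y}" "y \<in> ?D" using class_eq[OF equiv_eq_rel, of C y] C \<open>y \<in> C\<close> by auto
    ultimately show "C = ?E `` {y0}"
      using cl[of xs y] equiv_class_eq[OF equiv_eq_rel, of y0 y] by auto
  qed
  then show "fn (interp \<Gamma> M p) f Cs \<in> ?D // ?E"
    and "list_all2 (\<in>) xs Cs \<Longrightarrow> y \<in> fn (interp \<Gamma> M p) f Cs \<longleftrightarrow> y \<in> ?D \<and> fun_graph \<Gamma> M p f xs y"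
    using y0(1) cl by (auto intro: quotientI)
qed

text \<open>By invariance the truth value is the same for all lists of representatives, so the
  existential quantifier in \<open>interp\<close> can be replaced by any given list.\<close>

lemma interp_rl:
  assumes r: "r \<in> rels L" and Cs: "length Cs = length (rdom L r)"
      "set Cs \<subseteq> dom_set \<Gamma> M p // eq_rel \<Gamma> M p"
    and "list_all2 (\<in>) xs Cs"
  shows "rl (interp \<Gamma> M p) r Cs \<longleftrightarrow> rel_holds \<Gamma> M p r xs"
proof -
  have "rel_holds \<Gamma> M p r xs' = rel_holds \<Gamma> M p r xs" if "list_all2 (\<in>) xs' Cs" for xs'
  proof -
    have "length xs' = length (rdom L r)" using that Cs(1) by (simp add: list_all2_lengthD)
    moreover have "\<forall>xs xs'. length xs = length (rdom L r) \<and>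
        list_all2 (\<lambda>x x'. (x, x') \<in> eq_rel \<Gamma> M p) xs xs' \<longrightarrow>
        (rel_holds \<Gamma> M p r xs \<longleftrightarrow> rel_holds \<Gamma> M p r xs')"
      using ok r by (simp add: code_ok_def)
    ultimately show ?thesis using reps_eq_rel[OF Cs(2) that assms(4)] by simp
  qed
  moreover have "rl (interp \<Gamma> M p) r Cs \<longleftrightarrow> (\<exists>xs. list_all2 (\<in>) xs Cs \<and> rel_holds \<Gamma> M p r xs)"
    by (simp add: interp_def)
  ultimately show ?thesis using assms(4) by metis
qed

end

text \<open>The induced map sends a class to the set of all partners of its members. That this set
  is a whole class, although \<open>T\<close> may omit pairs, holds because every representative on
  the second side has some partner, and the equality clause puts that partner into the right
  class.\<close>

lemma isomorphic_if_iso_graph: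
  assumes ok1: "code_ok L \<Gamma>1 M p1" and ok2: "code_ok L \<Gamma>2 M p2"
    and g: "iso_graph L \<Gamma>1 \<Gamma>2 M p1 p2 T"
  shows "isomorphic L (interp \<Gamma>1 M p1) (interp \<Gamma>2 M p2)"
proof -
  let ?D1 = "dom_set \<Gamma>1 M p1" and ?E1 = "eq_rel \<Gamma>1 M p1"
    and ?D2 = "dom_set \<Gamma>2 M p2" and ?E2 = "eq_rel \<Gamma>2 M p2"
  note eq1 = equiv_eq_rel[OF ok1] and eq2 = equiv_eq_rel[OF ok2]
  \<comment> \<open>\<open>iso_graph\<close> constrains \<open>T\<close> only on tuples of the right
    sorts; the domain conditions are added so that \<open>R\<close> is controlled
    everywhere.\<close>
  define R where "R x y \<longleftrightarrow> x \<in> ?D1 \<and> y \<in> ?D2 \<and> T x y" for x y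
  note g' = g[unfolded iso_graph_def]
  note g1 = g'[THEN conjunct1, rule_format]
    and g2 = g'[THEN conjunct2, THEN conjunct1, rule_format]
    and g3 = g'[THEN conjunct2, THEN conjunct2, THEN conjunct1, rule_format]
    and g4 = g'[THEN conjunct2, THEN conjunct2, THEN conjunct2, THEN conjunct1, rule_format]
    and g5 = g'[THEN conjunct2, THEN conjunct2, THEN conjunct2, THEN conjunct2, THEN conjunct1,
        rule_format]
    and g6 = g'[THEN conjunct2, THEN conjunct2, THEN conjunct2, THEN conjunct2, THEN conjunct2,
        rule_format]
  have ex1: "\<exists>y. R x y" if "x \<in> ?D1" for x
    using g2[OF dom_set_tuples[OF that] that] g1 dom_set_tuples[OF that] that unfolding R_def by
        blast
  have ex2: "\<exists>x. R x y" if "y \<in> ?D2" for y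
    using g3[OF dom_set_tuples[OF that] that] g1 dom_set_tuples[OF that] that unfolding R_def by
        blast
  have eq: "(x, x') \<in> ?E1 \<longleftrightarrow> (y, y') \<in> ?E2" if "R x y" "R x' y'" for x x' y y'
    using that unfolding R_def by (intro g4) (auto dest: dom_set_tuples)
  define h where "h C = {y. \<exists>x\<in>C. R x y}" for C
  have h: "h (?E1 `` {x}) = ?E2 `` {y}" if "R x y" for x y
  proof -
    have "(x, x) \<in> ?E1" using that eq1 by (auto simp: R_def equiv_def refl_on_def)
    then show ?thesis
      unfolding h_def using eq[OF that] ex2 eq_rel_dom_set[of y _ \<Gamma>2 M p2] by fast
  qed
  have h_rep: "h C \<in> ?D2 // ?E2" "y \<in> h C" if "C \<in> ?D1 // ?E1" "x \<in> C" "R x y" for C x y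
    using class_eq[OF eq1 that(1,2)] h[OF that(3)] that by (auto simp: R_def h_def intro: quotientI)
  have reps: "\<exists>xs ys. list_all2 (\<in>) xs Cs \<and> list_all2 (\<in>) ys (map h Cs) \<and>
      (\<forall>i<length Cs. R (xs ! i) (ys ! i)) \<and> set (map h Cs) \<subseteq> ?D2 // ?E2 \<and>
      xs \<in> ntuples (length Cs) M (xsorts \<Gamma>1) \<and> ys \<in> ntuples (length Cs) M (xsorts \<Gamma>2)"
    if Cs: "set Cs \<subseteq> ?D1 // ?E1" for Cs
  proof -
    obtain xs where xs: "list_all2 (\<in>) xs Cs" "set xs \<subseteq> ?D1" using reps_exist[OF eq1 Cs] .
    then have len: "length xs = length Cs" by (simp add: list_all2_lengthD)
    define ys where "ys = map (\<lambda>x. SOME y. R x y) xs"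
    have R: "R (xs ! i) (ys ! i)" if "i < length Cs" for i
    proof -
      have "xs ! i \<in> ?D1" using that len xs(2) by auto
      from someI_ex[OF ex1[OF this]] show ?thesis using that len by (simp add: ys_def)
    qed
    have hC: "h (Cs ! i) \<in> ?D2 // ?E2 \<and> ys ! i \<in> h (Cs ! i)" if "i < length Cs" for i
      using h_rep[OF _ _ R[OF that]] xs(1) Cs that by (auto simp: list_all2_conv_all_nth subset_iff)
    have len': "length ys = length Cs" by (simp add: ys_def len)
    have "list_all2 (\<in>) ys (map h Cs)" using hC len' by (simp add: list_all2_conv_all_nth)
    moreover have "set (map h Cs) \<subseteq> ?D2 // ?E2"
      using hC unfolding set_conv_nth by auto
    moreover have "xs \<in> ntuples (length Cs) M (xsorts \<Gamma>1)" "ys \<in> ntuples (length Cs) M (xsorts \<Gamma>2)"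
      using R len len' by (auto simp: ntuples_def R_def dest: dom_set_tuples)
    ultimately show ?thesis using xs(1) R by blast
  qed
  have "is_iso L (\<lambda>_. h) (interp \<Gamma>1 M p1) (interp \<Gamma>2 M p2)"
    unfolding is_iso_unit
  proof (intro conjI ballI allI impI)
    have "inj_on h (?D1 // ?E1)"
    proof (rule inj_onI)
      fix C C' assume C: "C \<in> ?D1 // ?E1" "C' \<in> ?D1 // ?E1" "h C = h C'"
      then obtain x x' where x: "x \<in> ?D1" "C = ?E1 `` {x}" "x' \<in> ?D1" "C' = ?E1 `` {x'}"
        by (auto elim!: quotientE)
      obtain y y' where y: "R x y" "R x' y'" using ex1[OF x(1)] ex1[OF x(3)] by blast
      have "?E2 `` {y} = ?E2 `` {y'}" using h[OF y(1)] h[OF y(2)] x(2,4) C(3) by simp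
      then have "(y, y') \<in> ?E2" using y eq_equiv_class_iff[OF eq2] by (simp add: R_def)
      then show "C = C'" using eq[OF y] x equiv_class_eq[OF eq1] by auto
    qed
    moreover have "h ` (?D1 // ?E1) = ?D2 // ?E2"
    proof
      show "h ` (?D1 // ?E1) \<subseteq> ?D2 // ?E2"
        using reps[of "[_]"] by auto
      show "?D2 // ?E2 \<subseteq> h ` (?D1 // ?E1)"
      proof
        fix C assume "C \<in> ?D2 // ?E2"
        then obtain y where y: "y \<in> ?D2" "C = ?E2 `` {y}" by (auto elim!: quotientE)
        then obtain x where "R x y" using ex2 by blast
        then show "C \<in> h ` (?D1 // ?E1)"
          using h[of x y] y(2) by (intro image_eqI[of _ _ "?E1 `` {x}"])
              (auto simp: R_def intro!: quotientI)
      qed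
    qed
    ultimately show "bij_betw h (carr (interp \<Gamma>1 M p1) ()) (carr (interp \<Gamma>2 M p2) ())"
      by (simp add: bij_betw_def carr_interp[OF ok1] carr_interp[OF ok2])
  next
    fix f Cs assume f: "f \<in> funs L"
      and "length Cs = length (fdom L f) \<and> set Cs \<subseteq> carr (interp \<Gamma>1 M p1) ()"
    then have Cs: "length Cs = length (fdom L f)" "set Cs \<subseteq> ?D1 // ?E1"
      by (auto simp: carr_interp[OF ok1])
    then obtain xs ys where r: "list_all2 (\<in>) xs Cs" "list_all2 (\<in>) ys (map h Cs)"
      "\<forall>i<length (fdom L f). R (xs ! i) (ys ! i)" "set (map h Cs) \<subseteq> ?D2 // ?E2"
      "xs \<in> ntuples (length (fdom L f)) M (xsorts \<Gamma>1)" "ys \<in> ntuples (length (fdom L f))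
          M (xsorts \<Gamma>2)"
      using reps[OF Cs(2)] by auto
    obtain x where x: "x \<in> ?D1" "fn (interp \<Gamma>1 M p1) f Cs = ?E1 `` {x}" "x \<in> fn (interp \<Gamma>1 M p1)
        f Cs"
      using interp_fn(1)[OF ok1 f Cs] equiv_class_self[OF eq1] by (metis quotientE)
    obtain y where y: "R x y" using ex1 x by blast
    have "fun_graph \<Gamma>1 M p1 f xs x" using interp_fn(2)[OF ok1 f Cs r(1)] x(3) by simp
    then have "fun_graph \<Gamma>2 M p2 f ys y"
      using r(3) y unfolding R_def
      by (intro g5[OF f r(5,6)]) (auto dest: dom_set_tuples)
    then have "y \<in> fn (interp \<Gamma>2 M p2) f (map h Cs)"
      using interp_fn(2)[OF ok2 f _ r(4) r(2)] y Cs(1) by (simp add: R_def)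
    \<comment> \<open>Both sides are classes of the second equivalence and contain \<open>y\<close>,
      so they coincide; preservation of graphs in one direction suffices.\<close>
    then show "h (fn (interp \<Gamma>1 M p1) f Cs) = fn (interp \<Gamma>2 M p2) f (map h Cs)"
      using x(2) h[OF y] class_eq[OF eq2 interp_fn(1)[OF ok2 f _ r(4)]] Cs(1) by simp
  next
    fix r Cs assume r: "r \<in> rels L"
      and "length Cs = length (rdom L r) \<and> set Cs \<subseteq> carr (interp \<Gamma>1 M p1) ()"
    then have Cs: "length Cs = length (rdom L r)" "set Cs \<subseteq> ?D1 // ?E1"
      by (auto simp: carr_interp[OF ok1])
    then obtain xs ys where s: "list_all2 (\<in>) xs Cs" "list_all2 (\<in>) ys (map h Cs)"
      "\<forall>i<length (rdom L r). R (xs ! i) (ys ! i)" "set (map h Cs) \<subseteq> ?D2 // ?E2"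
      "xs \<in> ntuples (length (rdom L r)) M (xsorts \<Gamma>1)" "ys \<in> ntuples (length (rdom L r))
          M (xsorts \<Gamma>2)"
      using reps[OF Cs(2)] by auto
    have "rel_holds \<Gamma>1 M p1 r xs = rel_holds \<Gamma>2 M p2 r ys"
      using s(3) unfolding R_def by (intro g6[OF r s(5,6)]) auto
    then show "rl (interp \<Gamma>1 M p1) r Cs = rl (interp \<Gamma>2 M p2) r (map h Cs)"
      using interp_rl[OF ok1 r Cs s(1)] interp_rl[OF ok2 r _ s(4,2)] Cs(1) by simp
  qed
  then show ?thesis by (auto simp: isomorphic_def)
qed

text \<open>A tuple lies in at most one class, so \<open>T x y\<close> says that \<open>h\<close>
  takes the class of \<open>x\<close> to the class of \<open>y\<close>. Injectivity of
  \<open>h\<close> then gives the equality clause, and surjectivity the partners of representatives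
  on the second side.\<close>

lemma iso_graph_if_is_iso:
  assumes ok1: "code_ok L \<Gamma>1 M p1" and ok2: "code_ok L \<Gamma>2 M p2"
    and iso: "is_iso L h (interp \<Gamma>1 M p1) (interp \<Gamma>2 M p2)"
    and T: "\<And>x y. x \<in> tuples M (xsorts \<Gamma>1) \<Longrightarrow> y \<in> tuples M (xsorts \<Gamma>2) \<Longrightarrow>
      T x y \<longleftrightarrow> (\<exists>C \<in> carr (interp \<Gamma>1 M p1) (). x \<in> C \<and> y \<in> h () C)"
  shows "iso_graph L \<Gamma>1 \<Gamma>2 M p1 p2 T"
proof -
  let ?D1 = "dom_set \<Gamma>1 M p1" and ?E1 = "eq_rel \<Gamma>1 M p1"
    and ?D2 = "dom_set \<Gamma>2 M p2" and ?E2 = "eq_rel \<Gamma>2 M p2" and ?h = "h ()"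
  note eq1 = equiv_eq_rel[OF ok1] and eq2 = equiv_eq_rel[OF ok2]
  have bij: "bij_betw ?h (?D1 // ?E1) (?D2 // ?E2)"
    using iso by (simp add: is_iso_unit carr_interp[OF ok1] carr_interp[OF ok2])
  have isof: "?h (fn (interp \<Gamma>1 M p1) f Cs) = fn (interp \<Gamma>2 M p2) f (map ?h Cs)"
    if "f \<in> funs L" "length Cs = length (fdom L f)" "set Cs \<subseteq> ?D1 // ?E1" for f Cs
    using iso that by (simp add: is_iso_unit carr_interp[OF ok1])
  have isor: "rl (interp \<Gamma>1 M p1) r Cs = rl (interp \<Gamma>2 M p2) r (map ?h Cs)"
    if "r \<in> rels L" "length Cs = length (rdom L r)" "set Cs \<subseteq> ?D1 // ?E1" for r Cs
    using iso that by (simp add: is_iso_unit carr_interp[OF ok1])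
  have T': "T x y \<longleftrightarrow> x \<in> ?D1 \<and> y \<in> ?h (?E1 `` {x})"
    if "x \<in> tuples M (xsorts \<Gamma>1)" "y \<in> tuples M (xsorts \<Gamma>2)" for x y
    unfolding T[OF that] carr_interp[OF ok1]
    using class_eq[OF eq1] equiv_class_self[OF eq1] by (metis quotientI)
  have h2: "?h C \<in> ?D2 // ?E2" if "C \<in> ?D1 // ?E1" for C
    using bij that by (auto simp: bij_betw_def)
  have D2: "y \<in> ?D2 \<and> ?h (?E1 `` {x}) = ?E2 `` {y}" if "x \<in> ?D1" "y \<in> ?h (?E1 `` {x})" for x y
    using class_eq[OF eq2 h2[OF quotientI[OF that(1)]] that(2)] by simp
  have list: "set (map (\<lambda>x. ?E1 `` {x}) xs) \<subseteq> ?D1 // ?E1 \<and> list_all2 (\<in>) xs (map (\<lambda>x. ?E1 `` {x})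
      xs) \<and>
      set (map (\<lambda>x. ?h (?E1 `` {x})) xs) \<subseteq> ?D2 // ?E2 \<and>
      list_all2 (\<in>) ys (map (\<lambda>x. ?h (?E1 `` {x})) xs)"
    if "xs \<in> ntuples n M (xsorts \<Gamma>1)" "ys \<in> ntuples n M (xsorts \<Gamma>2)"
      "\<forall>i<n. T (xs ! i) (ys ! i)" for n xs ys
  proof -
    have "xs ! i \<in> ?D1 \<and> ys ! i \<in> ?h (?E1 `` {xs ! i})" if "i < n" for i
      using that T' \<open>xs \<in> _\<close> \<open>ys \<in> _\<close> \<open>\<forall>i<n. _ i\<close> by (auto simp: ntuples_def)
    then show ?thesis using that(1,2)
      by (auto simp: ntuples_def set_conv_nth list_all2_conv_all_nth intro!: quotientI h2
          equiv_class_self[OF eq1, unfolded Image_singleton_iff])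
  qed
  show ?thesis
    unfolding iso_graph_def
  proof (intro conjI ballI impI)
    fix x y assume "x \<in> tuples M (xsorts \<Gamma>1)" "y \<in> tuples M (xsorts \<Gamma>2)" "T x y"
    then show "x \<in> ?D1" "y \<in> ?D2" using T' D2 by auto
  next
    fix x assume "x \<in> tuples M (xsorts \<Gamma>1)" "x \<in> ?D1"
    moreover obtain y where "y \<in> ?D2" "?h (?E1 `` {x}) = ?E2 `` {y}"
      using h2[OF quotientI[OF \<open>x \<in> ?D1\<close>]] by (auto elim!: quotientE)
    ultimately show "\<exists>y\<in>tuples M (xsorts \<Gamma>2). T x y"
      using T' equiv_class_self[OF eq2] dom_set_tuples by (metis)
  next
    fix y assume "y \<in> tuples M (xsorts \<Gamma>2)" "y \<in> ?D2"
    moreover have "?E2 `` {y} \<in> ?h ` (?D1 // ?E1)"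
      using bij quotientI[OF \<open>y \<in> ?D2\<close>, of ?E2] by (auto simp: bij_betw_def)
    then obtain x where "x \<in> ?D1" "?h (?E1 `` {x}) = ?E2 `` {y}" by (auto elim!: quotientE)
    ultimately show "\<exists>x\<in>tuples M (xsorts \<Gamma>1). T x y"
      using T' equiv_class_self[OF eq2] dom_set_tuples by metis
  next
    fix x x' y y'
    assume "x \<in> tuples M (xsorts \<Gamma>1)" "x' \<in> tuples M (xsorts \<Gamma>1)"
      "y \<in> tuples M (xsorts \<Gamma>2)" "y' \<in> tuples M (xsorts \<Gamma>2)" "T x y \<and> T x' y'"
    then have *: "x \<in> ?D1" "x' \<in> ?D1" "y \<in> ?h (?E1 `` {x})" "y' \<in> ?h (?E1 `` {x'})" using T' by auto
    have "(y, y') \<in> ?E2 \<longleftrightarrow> ?h (?E1 `` {x}) = ?h (?E1 `` {x'})"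
      using D2[OF *(1,3)] D2[OF *(2,4)] eq_equiv_class_iff[OF eq2] by simp
    also have "\<dots> \<longleftrightarrow> ?E1 `` {x} = ?E1 `` {x'}"
      using bij * by (auto simp: bij_betw_def inj_on_def intro: quotientI)
    also have "\<dots> \<longleftrightarrow> (x, x') \<in> ?E1" using eq_equiv_class_iff[OF eq1] * by simp
    finally show "(x, x') \<in> ?E1 \<longleftrightarrow> (y, y') \<in> ?E2" by simp
  next
    fix f xs ys x y
    assume f: "f \<in> funs L" and xs: "xs \<in> ntuples (length (fdom L f)) M (xsorts \<Gamma>1)"
      and ys: "ys \<in> ntuples (length (fdom L f)) M (xsorts \<Gamma>2)"
      and x: "x \<in> tuples M (xsorts \<Gamma>1)" and y: "y \<in> tuples M (xsorts \<Gamma>2)"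
      and a: "(\<forall>i<length (fdom L f). T (xs ! i) (ys ! i)) \<and> T x y \<and> fun_graph \<Gamma>1 M p1 f xs x"
    let ?Cs = "map (\<lambda>x. ?E1 `` {x}) xs" and ?Ds = "map (\<lambda>x. ?h (?E1 `` {x})) xs"
    have l: "set ?Cs \<subseteq> ?D1 // ?E1" "list_all2 (\<in>) xs ?Cs" "set ?Ds \<subseteq> ?D2 // ?E2" "list_all2 (\<in>)
        ys ?Ds"
      using list[OF xs ys] a by auto
    have len: "length xs = length (fdom L f)" using xs by (rule ntuples_length)
    have xy: "x \<in> ?D1" "y \<in> ?h (?E1 `` {x})" using T'[OF x y] a by auto
    have len': "length ?Cs = length (fdom L f)" "length ?Ds = length (fdom L f)" using len by auto
    have "x \<in> fn (interp \<Gamma>1 M p1) f ?Cs"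
      using interp_fn(2)[OF ok1 f len'(1) l(1,2)] a xy by blast
    from class_eq[OF eq1 interp_fn(1)[OF ok1 f len'(1) l(1)] this]
    have "fn (interp \<Gamma>1 M p1) f ?Cs = ?E1 `` {x}" by blast
    moreover have "?h (fn (interp \<Gamma>1 M p1) f ?Cs) = fn (interp \<Gamma>2 M p2) f (map ?h ?Cs)"
      using len by (intro isof[OF f _ l(1)]) simp
    moreover have "map ?h ?Cs = ?Ds" by (simp add: comp_def)
    ultimately have "y \<in> fn (interp \<Gamma>2 M p2) f ?Ds" using xy(2) by (simp only:)
    then show "fun_graph \<Gamma>2 M p2 f ys y" using interp_fn(2)[OF ok2 f len'(2) l(3,4)] by blast
  next
    fix r xs ys
    assume r: "r \<in> rels L" and xs: "xs \<in> ntuples (length (rdom L r)) M (xsorts \<Gamma>1)"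
      and ys: "ys \<in> ntuples (length (rdom L r)) M (xsorts \<Gamma>2)"
      and a: "\<forall>i<length (rdom L r). T (xs ! i) (ys ! i)"
    let ?Cs = "map (\<lambda>x. ?E1 `` {x}) xs" and ?Ds = "map (\<lambda>x. ?h (?E1 `` {x})) xs"
    have l: "set ?Cs \<subseteq> ?D1 // ?E1" "list_all2 (\<in>) xs ?Cs" "set ?Ds \<subseteq> ?D2 // ?E2" "list_all2 (\<in>)
        ys ?Ds"
      using list[OF xs ys a] by auto
    have len: "length xs = length (rdom L r)" using xs by (rule ntuples_length)
    have "rl (interp \<Gamma>1 M p1) r ?Cs = rl (interp \<Gamma>2 M p2) r (map ?h ?Cs)"
      using len by (intro isor[OF r _ l(1)]) simp
    moreover have "map ?h ?Cs = ?Ds" by (simp add: comp_def)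
    ultimately show "rel_holds \<Gamma>1 M p1 r xs = rel_holds \<Gamma>2 M p2 r ys"
      using interp_rl[OF ok1 r _ l(1,2)] interp_rl[OF ok2 r _ l(3,4)] len by (simp only: length_map)
  qed
qed

section \<open>Coding finite sequences in list superstructures\<close>

text \<open>For a suitable \<open>d\<close> the moduli are pairwise coprime, and the Chinese
  remainder theorem supplies \<open>c\<close>. Two numbers thus code a sequence of any length, and
  remainders can be described by addition and multiplication alone.\<close>

lemma beta_coding:
  fixes f :: "nat \<Rightarrow> nat"
  shows "\<exists>c d. \<forall>i<n. c mod (1 + (i + 1) * d) = f i"
proof -
  \<comment> \<open>\<open>k\<close> bounds both \<open>n\<close> and every value: differences of
    indices then divide \<open>fact k\<close>, and each \<open>f i\<close> is smaller than its
    modulus.\<close>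
  define k where "k = n + (\<Sum>i<n. f i)"
  define d :: nat where "d = fact k"
  have le: "f i \<le> k" if "i < n" for i
    using member_le_sum[of i "{..<n}" f] that by (auto simp: k_def)
  have "coprime (1 + (i + 1) * d) (1 + (j + 1) * d)" if "i < j" "j < n" for i j
  proof (rule ccontr)
    assume "\<not> ?thesis"
    then have "gcd (1 + (i + 1) * d) (1 + (j + 1) * d) \<noteq> 1"
      unfolding coprime_iff_gcd_eq_1 .
    then obtain p :: nat where "prime p" "p dvd gcd (1 + (i + 1) * d) (1 + (j + 1) * d)"
      using prime_factor_nat by blast
    then have p: "prime p" "p dvd 1 + (i + 1) * d" "p dvd 1 + (j + 1) * d"
        by (simp_all only: gcd_greatest_iff)
    have "p dvd (1 + (j + 1) * d) - (1 + (i + 1) * d)" using p(3,2) by (rule dvd_diff_nat)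
    also have "(1 + (j + 1) * d) - (1 + (i + 1) * d) = (j - i) * d"
      by (simp add: diff_mult_distrib)
    finally have "p dvd j - i \<or> p dvd d" using p(1) by (simp add: prime_dvd_mult_iff)
    moreover have "j - i dvd d"
      using that unfolding d_def by (intro dvd_fact) (auto simp: k_def)
    \<comment> \<open>Since \<open>j - i\<close> divides \<open>d\<close>, both cases lead to
      \<open>p dvd d\<close>; as \<open>p\<close> also divides a modulus, it divides 1.\<close>
    ultimately have "p dvd (i + 1) * d" by (meson dvd_trans dvd_mult)
    then have "p dvd 1" using p(2) dvd_add_left_iff by blast
    then show False using p(1) by simp
  qed
  then have "\<forall>i\<in>{..<n}. \<forall>j\<in>{..<n}. i \<noteq> j \<longrightarrow> coprime (1 + (i + 1) * d) (1 + (j + 1) * d)"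
    by (metis coprime_commute lessThan_iff linorder_neqE_nat)
  from chinese_remainder_nat[OF finite_lessThan this, of f]
  obtain c where c: "\<forall>i\<in>{..<n}. [c = f i] (mod (1 + (i + 1) * d))" by blast
  have "c mod (1 + (i + 1) * d) = f i" if "i < n" for i
  proof -
    have "f i \<le> d" using le[OF that] fact_ge_self[of k] unfolding d_def by linarith
    then have "f i < 1 + (i + 1) * d" by simp
    then show ?thesis using c that unfolding cong_def by simp
  qed
  then show ?thesis by blast
qed

text \<open>\<open>C (w @ [Num i] @ x)\<close> says that \<open>x\<close> is the \<open>i\<close>-th member of the sequence coded by \<open>w\<close>.\<close>

definition seq_codable ::
  "(unit, 'f, 'r) sig \<Rightarrow> ('a, unit, 'f, 'r) struc \<Rightarrow> lsort list \<Rightarrow> bool" where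
  "seq_codable L B ts \<longleftrightarrow> (\<exists>cs C.
     codefinable (list_sig L) (list_super B) (list_super B) (cs @ [NatS] @ ts) C C \<and>
     (\<forall>n f. (\<forall>i<n. f i \<in> tuples (list_super B) ts) \<longrightarrow>
        (\<exists>w\<in>tuples (list_super B) cs. \<forall>i<n. \<forall>x\<in>tuples (list_super B) ts.
           C (w @ [Num i] @ x) \<longleftrightarrow> x = f i)))"

lemma carr_list_super [simp]: "carr (list_super B) s = luniv (carr B ()) s"
  and fn_list_super [simp]: "fn (list_super B) = lfn B"
  and rl_list_super [simp]: "rl (list_super B) = lrl B"
  by (simp_all add: list_super_def)

lemma list_sig_simps [simp]:
  "LenF \<in> funs (list_sig L)" "PlusF \<in> funs (list_sig L)" "TimesF \<in> funs (list_sig L)"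
  "ZeroF \<in> funs (list_sig L)" "OneF \<in> funs (list_sig L)" "CompR \<in> rels (list_sig L)"
  "fdom (list_sig L) = lfdom L" "fcod (list_sig L) = lfcod" "rdom (list_sig L) = lrdom L"
  by (simp_all add: list_sig_def)

lemma tuples_NatS: "w \<in> tuples (list_super B) [NatS] \<longleftrightarrow> (\<exists>n. w = [Num n])"
  by (auto simp: tuples_Cons)

lemma codefinable_formula:
  assumes "fm_in K ss p" "\<And>as. as \<in> tuples M ss \<Longrightarrow> holds M p as \<longleftrightarrow> P as"
  shows "codefinable K M M ss P P"
  using assms unfolding codefinable_def by blast

abbreviation plus_tm where "plus_tm t u \<equiv> App PlusF [t, u]"
abbreviation one_tm where "one_tm \<equiv> App OneF []"

lemma mem_ctx_vars: "(s, i) \<in> ctx_vars ss \<longleftrightarrow> i < length ss \<and> ss ! i = s"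
  by (auto simp: ctx_vars_def)

section \<open>Order on the numbers, and codes of sequences sort by sort\<close>

lemma codefinable_less:
  "codefinable (list_sig L) (list_super B) (list_super B) [NatS, NatS]
     (\<lambda>as. un_Num (as ! 0) < un_Num (as ! 1)) (\<lambda>as. un_Num (as ! 0) < un_Num (as ! 1))"
proof (rule codefinable_formula)
  \<comment> \<open>Order is not in the signature: a < b means a + (c + 1) = b for some c. The bound
    index 2 lies beyond the two free ones.\<close>
  let ?p = "Exi NatS 2 (Eq (plus_tm (Var NatS 0) (plus_tm (Var NatS 2) one_tm)) (Var NatS 1))"
  show "fm_in (list_sig L) [NatS, NatS] ?p"
    by (auto simp: fm_in_def mem_ctx_vars)
  fix as assume "as \<in> tuples (list_super B) [NatS, NatS]"
  then obtain a b where "as = [Num a, Num b]" by (auto simp: tuples_Cons)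
  then show "holds (list_super B) ?p as \<longleftrightarrow> un_Num (as ! 0) < un_Num (as ! 1)"
    by (auto simp: holds_def env_def less_iff_Suc_add)
qed

lemma seq_codable_BaseS: "seq_codable L B [BaseS]"
proof -
  \<comment> \<open>A finite sequence of elements is already a list. Its members are indexed from 0
    and list components from 1, hence the added one.\<close>
  let ?p = "Rel CompR [Var ListS 0, Var BaseS 2, plus_tm (Var NatS 1) one_tm]"
  let ?S = "list_super B"
  have "fm_in (list_sig L) ([ListS] @ [NatS] @ [BaseS]) ?p"
    by (auto simp: fm_in_def mem_ctx_vars)
  then have "codefinable (list_sig L) ?S ?S ([ListS] @ [NatS] @ [BaseS]) (holds ?S ?p)
      (holds ?S ?p)"
    unfolding codefinable_def by blast
  moreover have "\<exists>w\<in>tuples ?S [ListS]. \<forall>i<n. \<forall>x\<in>tuples ?S [BaseS]. holds ?S ?p (w @ [Num i] @ x) \<longleftrightarrow>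
      x = f i"
    if f: "\<forall>i<n. f i \<in> tuples ?S [BaseS]" for n f
  proof -
    define l where "l = map (\<lambda>i. un_Elem (hd (f i))) [0..<n]"
    have f': "f i = [Elem (l ! i)] \<and> l ! i \<in> carr B ()" if "i < n" for i
      using f that by (force simp: l_def tuples_Cons)
    have "length l = n" by (simp add: l_def)
    then have "set l \<subseteq> carr B ()" using f' by (auto simp: set_conv_nth)
    then have "[Tup l] \<in> tuples ?S [ListS]" by (auto simp: tuples_Cons)
    moreover have "holds ?S ?p ([Tup l] @ [Num i] @ x) \<longleftrightarrow> x = f i"
      if "i < n" "x \<in> tuples ?S [BaseS]" for i x
      using that f'[OF that(1)]
      by (auto simp: holds_def env_def tuples_Cons) (auto simp: l_def)
    ultimately show ?thesis by blast
  qed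
  ultimately show ?thesis unfolding seq_codable_def by blast
qed

lemma seq_codable_NatS: "seq_codable L B [NatS]"
proof -
  \<comment> \<open>The variables 0 to 3 are c, d, the index i and the value a; let m be the product
    of i + 1 and d. The formula says that c = q * (1 + m) + a and a + k = m for some q and k, the
    variables 4 and 5. The second equation expresses a <= m, so a is the remainder of c modulo 1 +
    m.\<close>
  let ?m = "App TimesF [plus_tm (Var NatS 2) one_tm, Var NatS 1]"
  let ?p = "Exi NatS 4 (Exi NatS 5 (Conj
     (Eq (Var NatS 0) (plus_tm (App TimesF [Var NatS 4, plus_tm one_tm ?m]) (Var NatS 3)))
     (Eq (plus_tm (Var NatS 3) (Var NatS 5)) ?m)))"
  let ?S = "list_super B"
  have "fm_in (list_sig L) ([NatS, NatS] @ [NatS] @ [NatS]) ?p"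
    by (auto simp: fm_in_def mem_ctx_vars)
  then have "codefinable (list_sig L) ?S ?S ([NatS, NatS] @ [NatS] @ [NatS]) (holds ?S ?p)
      (holds ?S ?p)"
    unfolding codefinable_def by blast
  moreover have "\<exists>w\<in>tuples ?S [NatS, NatS]. \<forall>i<n. \<forall>x\<in>tuples ?S [NatS].
      holds ?S ?p (w @ [Num i] @ x) \<longleftrightarrow> x = f i"
    if f: "\<forall>i<n. f i \<in> tuples ?S [NatS]" for n f
  proof -
    obtain c d where cd: "\<forall>i<n. c mod (1 + (i + 1) * d) = un_Num (hd (f i))"
      using beta_coding[of n "\<lambda>i. un_Num (hd (f i))"] by blast
    have "holds ?S ?p ([Num c, Num d] @ [Num i] @ [Num a]) \<longleftrightarrow> c mod (1 + (i + 1) * d) = a" for i a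
    proof -
      let ?m = "(i + 1) * d"
      have "holds ?S ?p ([Num c, Num d] @ [Num i] @ [Num a]) \<longleftrightarrow> (\<exists>q k. c = q * (1 + ?m) + a \<and>
          a + k = ?m)"
        by (simp add: holds_def env_def)
      also have "\<dots> \<longleftrightarrow> (\<exists>q. c = q * (1 + ?m) + a) \<and> a \<le> ?m"
        by (metis le_add1 le_Suc_ex)
      also have "\<dots> \<longleftrightarrow> c mod (1 + ?m) = a"
      proof
        assume "(\<exists>q. c = q * (1 + ?m) + a) \<and> a \<le> ?m"
        then obtain q where "c = q * (1 + ?m) + a" "a < 1 + ?m" by auto
        then show "c mod (1 + ?m) = a" by (metis mod_less mod_mult_self3)
      next
        assume "c mod (1 + ?m) = a"
        moreover have "c mod (1 + ?m) < 1 + ?m" by (rule mod_less_divisor) simp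
        moreover have "c = c div (1 + ?m) * (1 + ?m) + c mod (1 + ?m)"
            by (simp only: div_mult_mod_eq)
        ultimately show "(\<exists>q. c = q * (1 + ?m) + a) \<and> a \<le> ?m"
            by (metis less_Suc_eq_le plus_1_eq_Suc)
      qed
      finally show ?thesis .
    qed
    note sat_p = this
    have f': "f i = [Num (un_Num (hd (f i)))]" if "i < n" for i
      using f that unfolding tuples_NatS by (metis list.sel(1) lval.sel(3))
    have "holds ?S ?p ([Num c, Num d] @ [Num i] @ x) \<longleftrightarrow> x = f i"
      if "i < n" "x \<in> tuples ?S [NatS]" for i x
    proof -
      obtain a where "x = [Num a]" using \<open>x \<in> _\<close> by (auto simp: tuples_NatS)
      moreover have "c mod (1 + (i + 1) * d) = un_Num (hd (f i))" using cd \<open>i < n\<close> by blast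
      moreover obtain b where "f i = [Num b]" using f'[OF \<open>i < n\<close>] by blast
      ultimately show ?thesis using sat_p[of i a] by auto
    qed
    moreover have "[Num c, Num d] \<in> tuples ?S [NatS, NatS]" by (simp add: tuples_Cons)
    ultimately show ?thesis by blast
  qed
  ultimately show ?thesis unfolding seq_codable_def by blast
qed

text \<open>The first and second parts of the members form two sequences with the same index, and
  their codes are placed side by side.\<close>

lemma seq_codable_append:
  fixes B :: "('a, unit, 'f, 'r) struc"
  assumes "seq_codable L B ts" "seq_codable L B us"
  shows "seq_codable L B (ts @ us)"
proof -
  let ?S = "list_super B" and ?K = "list_sig L"
  obtain cs C where C: "codefinable ?K ?S ?S (cs @ [NatS] @ ts) C C"
    "\<And>n f. (\<forall>i<n. f i \<in> tuples ?S ts) \<Longrightarrow>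
        \<exists>w\<in>tuples ?S cs. \<forall>i<n. \<forall>x\<in>tuples ?S ts. C (w @ [Num i] @ x) \<longleftrightarrow> x = f i"
    using assms(1) unfolding seq_codable_def by blast
  obtain ds D where D: "codefinable ?K ?S ?S (ds @ [NatS] @ us) D D"
    "\<And>n f. (\<forall>i<n. f i \<in> tuples ?S us) \<Longrightarrow>
        \<exists>w\<in>tuples ?S ds. \<forall>i<n. \<forall>x\<in>tuples ?S us. D (w @ [Num i] @ x) \<longleftrightarrow> x = f i"
    using assms(2) unfolding seq_codable_def by blast
  let ?ss = "cs @ ds @ [NatS] @ ts @ us"
  \<comment> \<open>\<open>F\<close> and \<open>G\<close> collect from the common context the
    arguments of \<open>C\<close> and of \<open>D\<close>; both keep the index.\<close>
  define F :: "'a lval list \<Rightarrow> 'a lval list" where "F as = take (length cs)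
      as @ take (length [NatS]) (drop (length ds) (drop (length cs) as)) @
     take (length ts) (drop (length [NatS]) (drop (length ds) (drop (length cs) as)))" for as
  define G :: "'a lval list \<Rightarrow> 'a lval list" where "G as = take (length ds) (drop (length cs) as)
      @ take (length [NatS]) (drop (length ds) (drop (length cs) as)) @
     drop (length ts) (drop (length [NatS]) (drop (length ds) (drop (length cs) as)))" for as
  note pr = coproj_id[of ?S ?S ?ss]
  have "coproj ?S ?S ?ss (cs @ [NatS] @ ts) F F"
    unfolding F_def
    by (intro coproj_append coproj_take[OF pr] coproj_take[OF coproj_drop[OF coproj_drop[OF pr]]]
        coproj_take[OF coproj_drop[OF coproj_drop[OF coproj_drop[OF pr]]]])
  moreover have "coproj ?S ?S ?ss (ds @ [NatS] @ us) G G"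
    unfolding G_def
    by (intro coproj_append coproj_take[OF coproj_drop[OF pr]] coproj_take[OF coproj_drop[OF
        coproj_drop[OF pr]]]
        coproj_drop[OF coproj_drop[OF coproj_drop[OF coproj_drop[OF pr]]]])
  ultimately have "codefinable ?K ?S ?S ?ss (\<lambda>as. C (F as) \<and> D (G as)) (\<lambda>as. C (F as) \<and> D (G as))"
    by (intro codefinable_conj codefinable_subst[OF C(1)] codefinable_subst[OF D(1)])
  moreover have "\<exists>w\<in>tuples ?S (cs @ ds). \<forall>i<n. \<forall>x\<in>tuples ?S (ts @ us).
      C (F (w @ [Num i] @ x)) \<and> D (G (w @ [Num i] @ x)) \<longleftrightarrow> x = f i"
    if f: "\<forall>i<n. f i \<in> tuples ?S (ts @ us)" for n f
  proof -
    define g h where "g i = take (length ts) (f i)" and "h i = drop (length ts) (f i)" for i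
    have gh: "g i \<in> tuples ?S ts \<and> h i \<in> tuples ?S us \<and> f i = g i @ h i" if "i < n" for i
      using f that by (fastforce simp: g_def h_def tuples_append tuples_length)
    then obtain w v where w: "w \<in> tuples ?S cs" "\<forall>i<n. \<forall>x\<in>tuples ?S ts. C (w @ [Num i] @ x) \<longleftrightarrow> x =
        g i"
      and v: "v \<in> tuples ?S ds" "\<forall>i<n. \<forall>x\<in>tuples ?S us. D (v @ [Num i] @ x) \<longleftrightarrow> x = h i"
      using C(2)[of n g] D(2)[of n h] by blast
    have "C (F ((w @ v) @ [Num i] @ x)) \<and> D (G ((w @ v) @ [Num i] @ x)) \<longleftrightarrow> x = f i"
      if i: "i < n" and xm: "x \<in> tuples ?S (ts @ us)" for i x
    proof -
      obtain y z where x: "x = y @ z" "y \<in> tuples ?S ts" "z \<in> tuples ?S us"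
        using xm by (auto simp: tuples_append)
      have "F ((w @ v) @ [Num i] @ x) = w @ [Num i] @ y" "G ((w @ v) @ [Num i] @ x) =
          v @ [Num i] @ z"
        using tuples_length[OF w(1)] tuples_length[OF v(1)] tuples_length[OF x(2)] x(1)
        by (auto simp: F_def G_def)
      moreover have "y = g i \<and> z = h i \<longleftrightarrow> x = f i"
        using gh[OF i] x tuples_length[OF x(2)] tuples_length[of "g i" ?S ts] by auto
      ultimately show ?thesis using w(2) v(2) i x(2,3) by simp
    qed
    then show ?thesis using w(1) v(1) by (intro bexI[of _ "w @ v"]) (auto simp: tuples_append)
  qed
  ultimately show ?thesis unfolding seq_codable_def
    by (intro exI[of _ "cs @ ds"] exI[of _ "\<lambda>as. C (F as) \<and> D (G as)"]) auto
qed

text \<open>A sequence of lists is coded by their concatenation together with the sequence of offsets and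
  lengths.\<close>

lemma seq_codable_ListS: "seq_codable L B [ListS]"
proof -
  let ?S = "list_super B" and ?K = "list_sig L"
  have "seq_codable L B ([NatS] @ [NatS])" by (intro seq_codable_append seq_codable_NatS)
  then obtain cs C where C: "codefinable ?K ?S ?S (cs @ [NatS] @ [NatS, NatS]) C C"
    "\<And>n f. (\<forall>i<n. f i \<in> tuples ?S [NatS, NatS]) \<Longrightarrow>
        \<exists>w\<in>tuples ?S cs. \<forall>i<n. \<forall>x\<in>tuples ?S [NatS, NatS]. C (w @ [Num i] @ x) \<longleftrightarrow> x = f i"
    unfolding seq_codable_def by auto
  \<comment> \<open>Variables 0 and 1 are the member and the long list, 2 and 3 the offset and the
    length. The negated existential says that every component of the member reappears in the long
    list, shifted by the offset; so the member is a slice of the long list.\<close>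
  let ?p = "Conj (Eq (App LenF [Var ListS 0]) (Var NatS 3))
     (Neg (Exi NatS 4 (Exi BaseS 5 (Conj (Rel CompR [Var ListS 0, Var BaseS 5, Var NatS 4])
        (Neg (Rel CompR [Var ListS 1, Var BaseS 5, plus_tm (Var NatS 2) (Var NatS 4)]))))))"
  have p: "fm_in ?K ([ListS] @ [ListS] @ [NatS, NatS]) ?p"
    by (auto simp: fm_in_def mem_ctx_vars)
  have sat_p: "holds ?S ?p ([Tup l] @ [Tup s] @ [Num k, Num m]) \<longleftrightarrow> l = take m (drop k s)"
    if "k + m \<le> length s" "set l \<subseteq> carr B ()" for l s k m
  proof -
    have "holds ?S ?p ([Tup l] @ [Tup s] @ [Num k, Num m]) \<longleftrightarrow> length l = m \<and>
       \<not> (\<exists>j. \<exists>a\<in>carr B (). (1 \<le> j \<and> j \<le> length l \<and> l ! (j - 1) = a) \<and>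
          \<not> (1 \<le> k + j \<and> k + j \<le> length s \<and> s ! (k + j - 1) = a))"
      by (simp add: holds_def env_def Let_def)
    also have "\<dots> \<longleftrightarrow> length l = m \<and> (\<forall>j<m. s ! (k + j) = l ! j)" (is "?a \<longleftrightarrow> ?b")
    proof
      assume a: ?a
      \<comment> \<open>The formula counts components from 1, so it is used at
        \<open>Suc j\<close>.\<close>
      have "s ! (k + j) = l ! j" if "j < m" for j
      proof -
        have "l ! j \<in> carr B ()" using that a \<open>set l \<subseteq> _\<close> by auto
        moreover have "1 \<le> Suc j" "Suc j \<le> length l" "l ! (Suc j - 1) = l ! j" using that a by auto
        ultimately have "s ! (k + Suc j - 1) = l ! j" using a by blast
        then show ?thesis by simp
      qed
      then show ?b using a by blast
    next
      assume b: ?b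
      have "1 \<le> k + j \<and> k + j \<le> length s \<and> s ! (k + j - 1) = l ! (j - 1)"
        if "1 \<le> j" "j \<le> length l" for j
      proof -
        have "j - 1 < m" using that b by auto
        then have "s ! (k + (j - 1)) = l ! (j - 1)" using b by blast
        then show ?thesis using that b \<open>k + m \<le> length s\<close> by simp
      qed
      then show ?a using b by blast
    qed
    also have "\<dots> \<longleftrightarrow> l = take m (drop k s)"
      using that(1) by (auto simp: list_eq_iff_nth_eq)
    finally show ?thesis .
  qed
  let ?ss = "[ListS] @ cs @ [NatS] @ [ListS]"
  \<comment> \<open>The offset and the length of the member are looked up in the coded sequence of
    pairs, and the given list is compared with that slice.\<close>
  define D where "D as \<longleftrightarrow> (\<exists>x\<in>tuples ?S [NatS, NatS].
     C ((take (length cs) (drop (length [ListS]) as) @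
         take (length [NatS]) (drop (length cs) (drop (length [ListS]) as))) @ x) \<and>
     holds ?S ?p (drop (length [NatS]) (drop (length cs) (drop (length [ListS]) as))
         @ take (length [ListS]) as @ x))" for as
  have "codefinable ?K ?S ?S ?ss D D"
    unfolding D_def
  proof (intro codefinable_ex codefinable_conj)
    note pr = coproj_id[of ?S ?S ?ss]
    show "codefinable ?K ?S ?S (?ss @ [NatS, NatS])
     (\<lambda>as. C ((take (length cs) (drop (length [ListS]) (before ?ss as)) @
         take (length [NatS]) (drop (length cs) (drop (length [ListS]) (before ?ss as))))
             @ after ?ss as))
     (\<lambda>as. C ((take (length cs) (drop (length [ListS]) (before ?ss as)) @
         take (length [NatS]) (drop (length cs) (drop (length [ListS]) (before ?ss as))))
             @ after ?ss as))"
      by (rule codefinable_subst[OF C(1)], subst append_assoc[symmetric])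
       (intro coproj_append coproj_after coproj_before[OF coproj_take[OF coproj_drop[OF pr]]]
          coproj_before[OF coproj_take[OF coproj_drop[OF coproj_drop[OF pr]]]])
    show "codefinable ?K ?S ?S (?ss @ [NatS, NatS])
     (\<lambda>as. holds ?S ?p (drop (length [NatS]) (drop (length cs) (drop (length [ListS])
         (before ?ss as))) @ take (length [ListS]) (before ?ss as) @ after ?ss as))
     (\<lambda>as. holds ?S ?p (drop (length [NatS]) (drop (length cs) (drop (length [ListS])
         (before ?ss as))) @ take (length [ListS]) (before ?ss as) @ after ?ss as))"
      by (rule codefinable_holds[OF p])
       (intro coproj_append coproj_after coproj_before[OF coproj_take[OF pr]]
          coproj_before[OF coproj_drop[OF coproj_drop[OF coproj_drop[OF pr]]]])
  qed
  moreover have "\<exists>w\<in>tuples ?S ([ListS] @ cs). \<forall>i<n. \<forall>x\<in>tuples ?S [ListS]. D (w @ [Num i] @ x) \<longleftrightarrow>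
      x = f i"
    if f: "\<forall>i<n. f i \<in> tuples ?S [ListS]" for n f
  proof -
    define l where "l i = un_Tup (hd (f i))" for i
    have f': "f i = [Tup (l i)] \<and> set (l i) \<subseteq> carr B ()" if "i < n" for i
      using f that by (force simp: l_def tuples_Cons)
    define s where "s = concat (map l [0..<n])"
    define k where "k i = length (concat (map l [0..<i]))" for i
    have s: "k i + length (l i) \<le> length s \<and> take (length (l i)) (drop (k i) s) = l i" if "i < n"
        for i
    proof -
      have "[0..<n] = [0..<i] @ [i] @ [Suc i..<n]"
        using that by (metis append_Cons append_Nil less_imp_add_positive upt_add_eq_append
            upt_conv_Cons zero_le)
      then have "s = concat (map l [0..<i]) @ l i @ concat (map l [Suc i..<n])"
        unfolding s_def by simp
      then show ?thesis by (simp add: k_def)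
    qed
    obtain w where w: "w \<in> tuples ?S cs"
      "\<forall>i<n. \<forall>x\<in>tuples ?S [NatS, NatS]. C (w @ [Num i] @ x) \<longleftrightarrow> x = [Num (k i), Num (length (l i))]"
      using C(2)[of n "\<lambda>i. [Num (k i), Num (length (l i))]"] by (auto simp: tuples_Cons)
    have "D (([Tup s] @ w) @ [Num i] @ x) \<longleftrightarrow> x = f i" if i: "i < n" and x: "x \<in> tuples ?S [ListS]"
        for i x
    proof -
      obtain l' where l': "x = [Tup l']" "set l' \<subseteq> carr B ()" using x by (auto simp: tuples_Cons)
      have "D (([Tup s] @ w) @ [Num i] @ x) \<longleftrightarrow> (\<exists>y\<in>tuples ?S [NatS, NatS]. C (w @ [Num i] @ y) \<and>
          holds ?S ?p ([Tup l'] @ [Tup s] @ y))"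
        unfolding D_def l'(1) by (simp add: tuples_length[OF w(1)] del: sat.simps holds_def)
      also have "\<dots> \<longleftrightarrow> holds ?S ?p ([Tup l'] @ [Tup s] @ [Num (k i), Num (length (l i))])"
        using w(2) i by (auto simp: tuples_Cons simp del: sat.simps)
      also have "\<dots> \<longleftrightarrow> l' = l i" using sat_p[of "k i" "length (l i)" s l'] s[OF i] l'(2) by simp
      finally show ?thesis using f'[OF i] l'(1) by simp
    qed
    moreover have "set s \<subseteq> carr B ()" using f' unfolding s_def by fastforce
    then have "[Tup s] @ w \<in> tuples ?S ([ListS] @ cs)"
      using w(1) by (simp add: tuples_Cons in_listsI subset_iff)
    ultimately show ?thesis by blast
  qed
  ultimately show ?thesis unfolding seq_codable_def
    by (intro exI[of _ "[ListS] @ cs"] exI[of _ D]) simp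
qed

lemma seq_codable: "seq_codable L B ts"
proof (induction ts)
  case Nil
  \<comment> \<open>The only tuple of no sorts is \<open>[]\<close>, so \<open>x = f i\<close>
    always holds.\<close>
  show ?case unfolding seq_codable_def
    by (intro exI[of _ "[]"] exI[of _ "\<lambda>_. True"]) (simp add: codefinable_True)
next
  case (Cons t ts)
  have "seq_codable L B [t]"
    by (cases t) (simp_all add: seq_codable_BaseS seq_codable_ListS seq_codable_NatS)
  from seq_codable_append[OF this Cons] show ?case by simp
qed

section \<open>Definability of inductively generated sets\<close>

text \<open>A step is given by a relation \<open>R i\<close> and not by a function, since an
  operation on representatives is determined only up to equivalence and all representatives of a
  value are to be derivable. The set \<open>T\<close> keeps every entry of a derivation among the
  tuples whose sequences have codes.\<close>

inductive derived ::
  "'x set \<Rightarrow> ('x \<Rightarrow> bool) \<Rightarrow> 'i set \<Rightarrow> ('i \<Rightarrow> nat) \<Rightarrow> ('i \<Rightarrow> 'x list \<Rightarrow> 'x \<Rightarrow> bool) \<Rightarrow> 'x \<Rightarrow> bool"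
  for T G I ar R where
  base: "x \<in> T \<Longrightarrow> G x \<Longrightarrow> derived T G I ar R x"
| step: "i \<in> I \<Longrightarrow> length xs = ar i \<Longrightarrow> \<forall>x\<in>set xs. derived T G I ar R x \<Longrightarrow> y \<in> T \<Longrightarrow> R i xs y \<Longrightarrow>
    derived T G I ar R y"

definition justified ::
  "'x set \<Rightarrow> ('x \<Rightarrow> bool) \<Rightarrow> 'i set \<Rightarrow> ('i \<Rightarrow> nat) \<Rightarrow> ('i \<Rightarrow> 'x list \<Rightarrow> 'x \<Rightarrow> bool) \<Rightarrow> 'x set \<Rightarrow> 'x \<Rightarrow> bool"
      where
  "justified T G I ar R X y \<longleftrightarrow>
     y \<in> T \<and> (G y \<or> (\<exists>i\<in>I. \<exists>xs. length xs = ar i \<and> set xs \<subseteq> X \<and> R i xs y))"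

definition derivation ::
  "'x set \<Rightarrow> ('x \<Rightarrow> bool) \<Rightarrow> 'i set \<Rightarrow> ('i \<Rightarrow> nat) \<Rightarrow> ('i \<Rightarrow> 'x list \<Rightarrow> 'x \<Rightarrow> bool) \<Rightarrow> 'x list \<Rightarrow> bool" where
  "derivation T G I ar R ds \<longleftrightarrow> (\<forall>k<length ds. justified T G I ar R (set (take k ds)) (ds ! k))"

lemma justified_mono: "justified T G I ar R X y \<Longrightarrow> X \<subseteq> Y \<Longrightarrow> justified T G I ar R Y y"
  unfolding justified_def by (blast dest: subset_trans)

text \<open>Justification is monotone in the set of earlier entries, so the second list stays
  justified when the first precedes it.\<close>

lemma derivation_append:
  assumes "derivation T G I ar R ds" "derivation T G I ar R es"
  shows "derivation T G I ar R (ds @ es)"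
  unfolding derivation_def
proof (intro allI impI)
  fix k assume k: "k < length (ds @ es)"
  show "justified T G I ar R (set (take k (ds @ es))) ((ds @ es) ! k)"
  proof (cases "k < length ds")
    case True
    then show ?thesis using assms(1) by (simp add: derivation_def nth_append)
  next
    case False
    then have "justified T G I ar R (set (take (k - length ds) es)) (es ! (k - length ds))"
      using assms(2) k by (simp add: derivation_def)
    then show ?thesis using False by (auto simp: nth_append intro: justified_mono)
  qed
qed

lemma derivation_snoc:
  assumes "derivation T G I ar R ds" "justified T G I ar R (set ds) y"
  shows "derivation T G I ar R (ds @ [y])"
  using assms by (auto simp: derivation_def nth_append less_Suc_eq)

text \<open>Derivations of the premises are joined into one list, after which the conclusion is
  justified. The tree of an inductive proof thus becomes a linear sequence, which a code can
  represent.\<close>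

lemma derivation_if_derived:
  assumes "derived T G I ar R x"
  shows "\<exists>ds. derivation T G I ar R ds \<and> x \<in> set ds"
  using assms
proof induction
  case (base x)
  then show ?case by (intro exI[of _ "[x]"]) (auto simp: derivation_def justified_def)
next
  case (step i xs y)
  from step.IH have "\<exists>ds. derivation T G I ar R ds \<and> set xs \<subseteq> set ds"
  proof (induction xs)
    case Nil
    show ?case by (intro exI[of _ "[]"]) (simp add: derivation_def)
  next
    case (Cons x xs)
    then obtain ds es where "derivation T G I ar R ds" "set xs \<subseteq> set ds"
      "derivation T G I ar R es" "x \<in> set es" by auto
    then show ?case by (intro exI[of _ "ds @ es"]) (auto intro: derivation_append)
  qed
  then obtain ds where ds: "derivation T G I ar R ds" "set xs \<subseteq> set ds" by blast
  have "justified T G I ar R (set ds) y"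
    using step.hyps ds(2) unfolding justified_def by blast
  with ds(1) have "derivation T G I ar R (ds @ [y])" by (rule derivation_snoc)
  then show ?case by (intro exI[of _ "ds @ [y]"]) auto
qed

text \<open>The first \<open>length pq\<close> arguments of \<open>G\<close> and \<open>R i\<close> are parameters; the formula asserts the
    existence of
  a code of a derivation.\<close>

lemma codefinable_derived:
  fixes L :: "(unit, 'f, 'r) sig" and B :: "('a, unit, 'f, 'r) struc"
  defines "S \<equiv> list_super B" and "K \<equiv> list_sig L"
  assumes I: "finite I"
    and G: "codefinable K S S (pq @ ts) G G"
    and R: "\<And>i. i \<in> I \<Longrightarrow> codefinable K S S (pq @ concat (replicate (ar i) ts) @ ts) (R i) (R i)"
  shows "\<exists>p. fm_in K (ts @ pq) p \<and> (\<forall>q\<in>tuples S pq. \<forall>x\<in>tuples S ts.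
     holds S p (x @ q) \<longleftrightarrow> derived (tuples S ts) (\<lambda>x. G (q @ x)) I ar (\<lambda>i xs x.
         R i (q @ concat xs @ x)) x)"
proof -
  let ?T = "tuples S ts"
  obtain cs C where C: "codefinable K S S (cs @ [NatS] @ ts) C C"
    "\<And>n f. (\<forall>i<n. f i \<in> ?T) \<Longrightarrow> \<exists>w\<in>tuples S cs. \<forall>i<n. \<forall>x\<in>?T. C (w @ [Num i] @ x) \<longleftrightarrow> x = f i"
    using seq_codable[of L B ts] unfolding seq_codable_def S_def K_def by blast
  define less where "less as \<longleftrightarrow> un_Num (as ! 0) < un_Num (as ! 1)" for as :: "'a lval list"
  have less: "codefinable K S S ([NatS] @ [NatS]) less less"
    using codefinable_less[of L B] by (simp add: less_def[abs_def] S_def K_def)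
  have less_iff: "less ([Num a] @ [Num b]) \<longleftrightarrow> a < b" for a b by (simp add: less_def)
  have NatS: "w \<in> tuples S [NatS] \<longleftrightarrow> (\<exists>n. w = [Num n])" for w
    unfolding S_def by (rule tuples_NatS)
  \<comment> \<open>An arbitrary \<open>w\<close> need not describe a sequence: several tuples or
    none may stand at a place. Hence the demand that every tuple which \<open>C\<close> puts at a
    place up to \<open>m\<close> is initial or follows from tuples at earlier places. The length of
    the sequence is not recorded; \<open>m\<close> bounds the part that is inspected.\<close>
  define P where "P q x \<longleftrightarrow> (\<exists>w\<in>tuples S cs. \<exists>m\<in>tuples S [NatS]. C (w @ m @ x) \<and>
     (\<forall>k\<in>tuples S [NatS]. \<forall>y\<in>?T. \<not> less (m @ k) \<and> C (w @ k @ y) \<longrightarrow>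
        G (q @ y) \<or> (\<exists>i\<in>I. \<exists>xs\<in>ntuples (ar i) S ts.
          (\<forall>l<ar i. \<exists>j\<in>tuples S [NatS]. less (j @ k) \<and> C (w @ j @ xs ! l)) \<and>
              R i (q @ concat xs @ y))))" for q x
  have "codefinable K S S (ts @ pq) (\<lambda>as. P (drop (length ts) as) (take (length ts) as)) (\<lambda>as.
      P (drop (length ts) as) (take (length ts) as))"
    unfolding P_def
    by (assumption | rule codefinable_intros codefinable_bex_finite[OF I]
        codefinable_subst[OF C(1)] codefinable_subst[OF G] codefinable_subst[OF R]
            codefinable_subst[OF less]
        coproj_append coproj_concat coproj_intros coproj_take[OF coproj_id] coproj_drop[OF
            coproj_id])+
  then obtain p where p: "fm_in K (ts @ pq) p"
    "\<forall>as\<in>tuples S (ts @ pq). holds S p as \<longleftrightarrow> P (drop (length ts) as) (take (length ts) as)"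
    unfolding codefinable_def by blast
  have P: "P q x \<longleftrightarrow> derived ?T (\<lambda>x. G (q @ x)) I ar (\<lambda>i xs x. R i (q @ concat xs @ x)) x"
    (is "_ \<longleftrightarrow> ?d x") if x: "x \<in> ?T" for q x
  proof
    assume "P q x"
    then obtain w m' where "m' \<in> tuples S [NatS]" and w': "C (w @ m' @ x)"
      "\<And>k y. k \<in> tuples S [NatS] \<Longrightarrow> y \<in> ?T \<Longrightarrow> \<not> less (m' @ k) \<Longrightarrow> C (w @ k @ y) \<Longrightarrow>
        G (q @ y) \<or> (\<exists>i\<in>I. \<exists>xs\<in>ntuples (ar i) S ts.
          (\<forall>l<ar i. \<exists>j\<in>tuples S [NatS]. less (j @ k) \<and> C (w @ j @ xs ! l)) \<and>
              R i (q @ concat xs @ y))"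
      unfolding P_def by blast
    then obtain m where m': "m' = [Num m]" using NatS by blast
    have bexNat: "(\<exists>j\<in>tuples S [NatS]. less (j @ [Num k]) \<and> X j) \<longleftrightarrow> (\<exists>j<k. X [Num j])" for k X
      using NatS less_iff by (metis append_Cons append_Nil)
    have w: "C (w @ [Num m] @ x)"
      "\<And>k y. y \<in> ?T \<Longrightarrow> k \<le> m \<Longrightarrow> C (w @ [Num k] @ y) \<Longrightarrow>
        G (q @ y) \<or> (\<exists>i\<in>I. \<exists>xs\<in>ntuples (ar i) S ts.
          (\<forall>l<ar i. \<exists>j<k. C (w @ [Num j] @ xs ! l)) \<and> R i (q @ concat xs @ y))"
      subgoal using w'(1) unfolding m' .
      subgoal for k y using w'(2)[of "[Num k]" y] unfolding m' bexNat less_iff NatS not_less by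
          blast
      done
    \<comment> \<open>Strong induction on the place; as it covers all tuples that stand there, the
      code need not be single-valued.\<close>
    have "?d y" if "k \<le> m" "y \<in> ?T" "C (w @ [Num k] @ y)" for k y
      using that
    proof (induction k arbitrary: y rule: less_induct)
      case (less k)
      consider "G (q @ y)" | i xs where "i \<in> I" "xs \<in> ntuples (ar i) S ts"
          "\<forall>l<ar i. \<exists>j<k. C (w @ [Num j] @ xs ! l)" "R i (q @ concat xs @ y)"
        using w(2)[OF less.prems(2,1,3)] by blast
      then show ?case
      proof cases
        case 1
        then show ?thesis using less.prems(2) by (intro derived.base)
      next
        case 2
        have "?d (xs ! l)" if "l < ar i" for l
          using 2(2,3) that less.IH less.prems(1) by (meson less_imp_le less_le_trans ntuples_nth)
        then have "\<forall>x\<in>set xs. ?d x"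
          using ntuples_length[OF 2(2)] by (metis in_set_conv_nth)
        then show ?thesis using 2 less.prems(2) ntuples_length[OF 2(2)] by (intro derived.step)
      qed
    qed
    then show "?d x" using w(1) x by blast
  next
    assume "?d x"
    from derivation_if_derived[OF this] obtain ds where
      ds: "derivation ?T (\<lambda>x. G (q @ x)) I ar (\<lambda>i xs x. R i (q @ concat xs @ x)) ds" "x \<in> set ds"
          by blast
    then have ds_T: "\<forall>i<length ds. ds ! i \<in> ?T" by (auto simp: derivation_def justified_def)
    obtain w where w: "w \<in> tuples S cs" "\<forall>i<length ds. \<forall>x\<in>?T. C (w @ [Num i] @ x) \<longleftrightarrow> x = ds ! i"
      using C(2)[OF ds_T] by blast
    obtain m where m: "m < length ds" "x = ds ! m" using ds(2) by (auto simp: in_set_conv_nth)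
    have key: "G (q @ y) \<or> (\<exists>i\<in>I. \<exists>xs\<in>ntuples (ar i) S ts.
          (\<forall>l<ar i. \<exists>j\<in>tuples S [NatS]. less (j @ [Num k]) \<and> C (w @ j @ xs ! l)) \<and>
              R i (q @ concat xs @ y))"
      if k: "k \<le> m" and y: "y \<in> ?T" "C (w @ [Num k] @ y)" for k y
    proof -
      have kd: "k < length ds" "y = ds ! k" using k m y w(2) by auto
      have "justified ?T (\<lambda>x. G (q @ x)) I ar (\<lambda>i xs x. R i (q @ concat xs @ x)) (set (take k ds))
          y"
        using ds(1) kd unfolding derivation_def by simp
      then consider "G (q @ y)" | i xs where "i \<in> I" "length xs = ar i" "set xs \<subseteq> set (take k ds)"
          "R i (q @ concat xs @ y)"
        unfolding justified_def by blast
      then show ?thesis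
      proof cases
        case 2
        have "\<exists>j<k. xs ! l = ds ! j" if "l < ar i" for l
        proof -
          have "xs ! l \<in> set (take k ds)" using 2(2,3) that by auto
          then show ?thesis by (auto simp: in_set_conv_nth)
        qed
        then have *: "xs ! l \<in> ?T \<and> (\<exists>j<k. C (w @ [Num j] @ xs ! l))" if l: "l < ar i" for l
        proof -
          obtain j where j: "j < k" "xs ! l = ds ! j"
            using \<open>\<And>l. l < ar i \<Longrightarrow> \<exists>j<k. xs ! l = ds ! j\<close>[OF l] by blast
          then have "ds ! j \<in> ?T" "C (w @ [Num j] @ ds ! j)" using w(2) ds_T kd(1) by auto
          then show ?thesis using j by auto
        qed
        have "xs \<in> ntuples (ar i) S ts"
          "\<forall>l<ar i. \<exists>j\<in>tuples S [NatS]. less (j @ [Num k]) \<and> C (w @ j @ xs ! l)"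
          subgoal using 2(2) * by (simp add: ntuples_def)
          subgoal using * less_iff NatS by blast
          done
        then show ?thesis using 2(1,4) by blast
      qed simp
    qed
    have "G (q @ y) \<or> (\<exists>i\<in>I. \<exists>xs\<in>ntuples (ar i) S ts.
          (\<forall>l<ar i. \<exists>j\<in>tuples S [NatS]. less (j @ k) \<and> C (w @ j @ xs ! l)) \<and>
              R i (q @ concat xs @ y))"
      if k: "k \<in> tuples S [NatS]" and y: "y \<in> ?T" and ky: "\<not> less ([Num m] @ k) \<and> C (w @ k @ y)"
          for k y
    proof -
      obtain n where n: "k = [Num n]" using k NatS by blast
      then have "n \<le> m" using ky by (simp add: less_def)
      then show ?thesis using key[of n y] y ky unfolding n by blast
    qed
    moreover have "C (w @ [Num m] @ x)" using m w(2) x by simp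
    moreover have "[Num m] \<in> tuples S [NatS]" using NatS by blast
    ultimately show "P q x"
      unfolding P_def using w(1) by blast
  qed
  have "holds S p (x @ q) \<longleftrightarrow> P q x" if "q \<in> tuples S pq" "x \<in> ?T" for q x
    using p(2) that by (simp add: append_in_tuples tuples_length)
  then show ?thesis using p(1) P by blast
qed

section \<open>Definability of the isomorphism and transfer\<close>

lemma coprojs_chop:
  assumes "coproj M N ss (concat (replicate n us)) F G"
  shows "coprojs M N ss n us (\<lambda>as. chop (length us) n (F as)) (\<lambda>as. chop (length us) n (G as))"
  using coproj_chop_nth[OF assms] by (simp add: coprojs_def)

lemma definable_if_codefinable:
  assumes "codefinable K M M (ss @ qs) P P" "cs \<in> tuples M qs"
  shows "definable K M ss {as \<in> tuples M ss. P (as @ cs)}"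
proof -
  obtain p where "fm_in K (ss @ qs) p" "\<forall>as \<in> tuples M (ss @ qs). holds M p as \<longleftrightarrow> P as"
    using assms(1) unfolding codefinable_def by blast
  moreover have "as @ cs \<in> tuples M (ss @ qs)" if "as \<in> tuples M ss" for as
    using that assms(2) by (simp add: append_in_tuples)
  ultimately show ?thesis unfolding definable_def using assms(2)
    by (intro exI[of _ p] exI[of _ qs] exI[of _ cs]) auto
qed

text \<open>The two formulas come with unrelated parameter tuples, which are concatenated so that
  one formula can use both.\<close>

lemma definable_Un:
  assumes "definable K M ss X" "definable K M ss Y"
  shows "definable K M ss (X \<union> Y)"
proof -
  obtain p qs cs where p: "fm_in K (ss @ qs) p" "cs \<in> tuples M qs"
    "X = {as \<in> tuples M ss. holds M p (as @ cs)}" using assms(1) unfolding definable_def by blast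
  obtain p' qs' cs' where p': "fm_in K (ss @ qs') p'" "cs' \<in> tuples M qs'"
    "Y = {as \<in> tuples M ss. holds M p' (as @ cs')}" using assms(2) unfolding definable_def by blast
  define P where "P as \<longleftrightarrow> holds M p (take (length ss) as @ take (length qs) (drop (length ss) as)) \<or>
     holds M p' (take (length ss) as @ drop (length qs) (drop (length ss) as))" for as
  note pr = coproj_id[of M M "ss @ qs @ qs'"]
  have "codefinable K M M (ss @ qs @ qs') P P"
    unfolding P_def
    by (rule codefinable_disj codefinable_holds[OF p(1)] codefinable_holds[OF p'(1)] coproj_append
        coproj_take[OF pr] coproj_take[OF coproj_drop[OF pr]] coproj_drop[OF coproj_drop[OF pr]])+
  moreover have "cs @ cs' \<in> tuples M (qs @ qs')" using p(2) p'(2) by (simp add: append_in_tuples)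
  ultimately have "definable K M ss {as \<in> tuples M ss. P (as @ cs @ cs')}"
    by (rule definable_if_codefinable)
  moreover have "{as \<in> tuples M ss. P (as @ cs @ cs')} = X \<union> Y"
    using tuples_length[OF p(2)] unfolding p(3) p'(3) by (auto simp: P_def tuples_length)
  ultimately show ?thesis by simp
qed

lemma definable_product:
  assumes "definable K M ss X" "definable K M ts Y"
  shows "definable K M (ss @ ts) {x @ y | x y. x \<in> X \<and> y \<in> Y}"
proof -
  obtain p qs cs where p: "fm_in K (ss @ qs) p" "cs \<in> tuples M qs"
    "X = {as \<in> tuples M ss. holds M p (as @ cs)}" using assms(1) unfolding definable_def by blast
  obtain p' qs' cs' where p': "fm_in K (ts @ qs') p'" "cs' \<in> tuples M qs'"
    "Y = {as \<in> tuples M ts. holds M p' (as @ cs')}" using assms(2) unfolding definable_def by blast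
  let ?ss = "ss @ ts @ qs @ qs'"
  define P where "P as \<longleftrightarrow>
     holds M p (take (length ss) as @ take (length qs) (drop (length ts) (drop (length ss) as))) \<and>
     holds M p' (take (length ts) (drop (length ss) as) @ drop (length qs) (drop (length ts)
         (drop (length ss) as)))" for as
  note pr = coproj_id[of M M ?ss]
  have "codefinable K M M ?ss P P"
    unfolding P_def
    by (rule codefinable_conj codefinable_holds[OF p(1)] codefinable_holds[OF p'(1)] coproj_append
        coproj_take[OF pr] coproj_take[OF coproj_drop[OF pr]] coproj_take[OF coproj_drop[OF
            coproj_drop[OF pr]]]
        coproj_drop[OF coproj_drop[OF coproj_drop[OF pr]]])+
  then have "codefinable K M M ((ss @ ts) @ qs @ qs') P P" by simp
  moreover have "cs @ cs' \<in> tuples M (qs @ qs')" using p(2) p'(2) by (simp add: append_in_tuples)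
  ultimately have "definable K M (ss @ ts) {as \<in> tuples M (ss @ ts). P (as @ cs @ cs')}"
    by (rule definable_if_codefinable)
  moreover have "{as \<in> tuples M (ss @ ts). P (as @ cs @ cs')} = {x @ y | x y. x \<in> X \<and> y \<in> Y}"
    using tuples_length[OF p(2)] unfolding p(3) p'(3)
    by (auto simp: P_def tuples_length tuples_append; fastforce simp: tuples_length)
  ultimately show ?thesis by simp
qed

text \<open>Any representative of the class, together with \<open>p\<close>, serves as the parameter
  tuple for the equivalence formula.\<close>

lemma definable_class:
  assumes "wf_code L K \<Gamma>" "code_ok L \<Gamma> M p" "p \<in> tuples M (psorts \<Gamma>)" "C \<in> carr (interp \<Gamma> M p) ()"
  shows "definable K M (xsorts \<Gamma>) C"
proof -
  let ?n = "length (xsorts \<Gamma>)"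
  obtain x where x: "x \<in> dom_set \<Gamma> M p" "C = eq_rel \<Gamma> M p `` {x}"
    using assms(4) by (auto simp: carr_interp[OF assms(2)] elim!: quotientE)
  define P where "P as \<longleftrightarrow> (take ?n (drop ?n as), take ?n as) \<in> eq_rel \<Gamma> M (drop ?n (drop ?n as))"
      for as
  note pr = coproj_id[of M M "xsorts \<Gamma> @ xsorts \<Gamma> @ psorts \<Gamma>"]
  have "codefinable K M M (xsorts \<Gamma> @ xsorts \<Gamma> @ psorts \<Gamma>) P P"
    unfolding P_def
    by (intro codefinable_eq_rel[OF assms(1)] coproj_take[OF pr] coproj_take[OF coproj_drop[OF pr]]
        coproj_drop[OF coproj_drop[OF pr]])
  moreover have "x @ p \<in> tuples M (xsorts \<Gamma> @ psorts \<Gamma>)"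
    using dom_set_tuples[OF x(1)] assms(3) by (simp add: append_in_tuples)
  ultimately have def: "definable K M (xsorts \<Gamma>) {as \<in> tuples M (xsorts \<Gamma>). P (as @ x @ p)}"
    by (rule definable_if_codefinable)
  moreover have "P (as @ x @ p) \<longleftrightarrow> as \<in> C" if "as \<in> tuples M (xsorts \<Gamma>)" for as
    using tuples_length[OF dom_set_tuples[OF x(1)]] tuples_length[OF that] unfolding x(2)
    by (simp add: P_def)
  moreover have "C \<subseteq> tuples M (xsorts \<Gamma>)"
    unfolding x(2) by (auto dest: eq_rel_dom_set dom_set_tuples)
  ultimately have "{as \<in> tuples M (xsorts \<Gamma>). P (as @ x @ p)} = C" by blast
  with def show ?thesis by simp
qed

lemma rep_graph_Un: "rep_graph h (X \<union> Y) = rep_graph h X \<union> rep_graph h Y"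
  unfolding rep_graph_def by blast

text \<open>Each extra class \<open>C\<close> adds the product of \<open>C\<close> and
  \<open>h C\<close>, two definable sets. In this way the values at the generators are joined to the
  restriction that is definable by assumption.\<close>

lemma definable_rep_graph_Un_finite:
  assumes "wf_code L K \<Gamma>1" "wf_code L K \<Gamma>2" "code_ok L \<Gamma>1 M p1" "code_ok L \<Gamma>2 M p2"
    and "p1 \<in> tuples M (psorts \<Gamma>1)" "p2 \<in> tuples M (psorts \<Gamma>2)"
    and "definable K M (xsorts \<Gamma>1 @ xsorts \<Gamma>2) (rep_graph h X)"
    and "finite Y" "Y \<subseteq> carr (interp \<Gamma>1 M p1) ()" "h ` Y \<subseteq> carr (interp \<Gamma>2 M p2) ()"
  shows "definable K M (xsorts \<Gamma>1 @ xsorts \<Gamma>2) (rep_graph h (X \<union> Y))"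
  using assms(8-10)
proof (induction Y)
  case empty
  then show ?case using assms(7) by simp
next
  case (insert C Y)
  have "definable K M (xsorts \<Gamma>1) C"
    using insert.prems(1) by (intro definable_class[OF assms(1,3,5)]) auto
  moreover have "definable K M (xsorts \<Gamma>2) (h C)"
    using insert.prems(2) by (intro definable_class[OF assms(2,4,6)]) auto
  ultimately have "definable K M (xsorts \<Gamma>1 @ xsorts \<Gamma>2) {x @ y | x y. x \<in> C \<and> y \<in> h C}"
    by (rule definable_product)
  moreover have "{x @ y | x y. x \<in> C \<and> y \<in> h C} = rep_graph h {C}"
    unfolding rep_graph_def by blast
  moreover have "definable K M (xsorts \<Gamma>1 @ xsorts \<Gamma>2) (rep_graph h (X \<union> Y))"
    using insert by auto
  moreover have "X \<union> insert C Y = (X \<union> Y) \<union> {C}" by blast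
  ultimately show ?case by (simp only: rep_graph_Un definable_Un)
qed

text \<open>The context is empty, so the condition is a sentence: a code that defines structures in
  one model still does so in every elementarily equivalent one.\<close>

lemma codefinable_codes_strucs:
  fixes \<Gamma> :: "('s, 'f, 'r, 'g, 'q) icode"
  assumes "finite_sig L" "wf_code L K \<Gamma>" "fm_in K (psorts \<Gamma>) \<phi>"
  shows "codefinable K M N [] (\<lambda>_. codes_strucs L \<Gamma> \<phi> M) (\<lambda>_. codes_strucs L \<Gamma> \<phi> N)"
proof -
  have *: "codes_strucs L \<Gamma> \<phi> X \<longleftrightarrow> (\<exists>p\<in>tuples X (psorts \<Gamma>). holds X \<phi> p) \<and>
      (\<forall>p\<in>tuples X (psorts \<Gamma>). holds X \<phi> p \<longrightarrow> code_ok L \<Gamma> X p)" for X :: "('x, 's, 'g, 'q) struc"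
    by (auto simp: codes_strucs_def solutions_def)
  show ?thesis unfolding *
    by (rule codefinable_intros codefinable_code_ok[OF assms(1,2)] codefinable_holds[OF assms(3)]
        coproj_after)+
qed

text \<open>Soundness is induction on derivations: \<open>\<theta>\<close> commutes with the
  operations, so derived pairs lie in its graph. Completeness is induction on the term that
  expresses an element of \<open>A\<close>, carried over to the first interpretation by
  \<open>\<mu>\<close>. Relations of the signature take no part in derivations; their preservation
  comes from \<open>\<theta>\<close>, once the derived pairs are known to be exactly its
  graph.\<close>

lemma definable_isomorphism:
  fixes L :: "(unit, 'f, 'r) sig" and A B :: "('a, unit, 'f, 'r) struc"
    and \<Gamma>1 \<Gamma>2 :: "(lsort, 'f, 'r, 'f lfun, 'r lrel) icode"
  defines "S \<equiv> list_super B" and "K \<equiv> list_sig L"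
  assumes fin: "finite_sig L" and A: "is_struc L A" and BA: "carr B () \<subseteq> carr A ()"
    and gen: "fin_generated_over L A B"
    and wf1: "wf_code L K \<Gamma>1" and wf2: "wf_code L K \<Gamma>2"
    and ok1: "code_ok L \<Gamma>1 S p1" and ok2: "code_ok L \<Gamma>2 S p2"
    and p1: "p1 \<in> tuples S (psorts \<Gamma>1)" and p2: "p2 \<in> tuples S (psorts \<Gamma>2)"
    and \<mu>: "is_iso L \<mu> A (interp \<Gamma>1 S p1)"
    and \<theta>: "is_iso L \<theta> (interp \<Gamma>1 S p1) (interp \<Gamma>2 S p2)"
    and def: "definable K S (xsorts \<Gamma>1 @ xsorts \<Gamma>2) (rep_graph (\<theta> ()) (\<mu> () ` carr B ()))"
  shows "\<exists>\<psi> qs. \<exists>q\<in>tuples S qs. fm_in K (xsorts \<Gamma>1 @ xsorts \<Gamma>2 @ qs) \<psi> \<and>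
    iso_graph L \<Gamma>1 \<Gamma>2 S p1 p2 (\<lambda>x y. holds S \<psi> (x @ y @ q))"
proof -
  let ?I1 = "interp \<Gamma>1 S p1" and ?I2 = "interp \<Gamma>2 S p2" and ?xs1 = "xsorts \<Gamma>1" and ?xs2 =
      "xsorts \<Gamma>2"
  let ?ts = "?xs1 @ ?xs2" and ?m = "\<mu> ()" and ?h = "\<theta> ()" and ?ps1 = "psorts \<Gamma>1" and ?ps2 =
      "psorts \<Gamma>2"
  let ?ar = "\<lambda>f. length (fdom L f)" and ?n1 = "length (xsorts \<Gamma>1)"
  note eq1 = equiv_eq_rel[OF ok1] and eq2 = equiv_eq_rel[OF ok2]
  note carr1 = carr_interp[OF ok1] and carr2 = carr_interp[OF ok2]
  have m_carr: "?m a \<in> carr ?I1 ()" if "a \<in> carr A ()" for a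
    using \<mu> that by (auto simp: is_iso_unit bij_betw_def)
  have m_surj: "carr ?I1 () = ?m ` carr A ()"
    using \<mu> by (auto simp: is_iso_unit bij_betw_def)
  have h_carr: "?h C \<in> carr ?I2 ()" if "C \<in> carr ?I1 ()" for C
    using \<theta> that by (auto simp: is_iso_unit bij_betw_def)
  have m_fn: "?m (fn A f as) = fn ?I1 f (map ?m as)"
    if "f \<in> funs L" "length as = ?ar f" "set as \<subseteq> carr A ()" for f as
    using \<mu> that by (simp add: is_iso_unit)
  have h_fn: "?h (fn ?I1 f Cs) = fn ?I2 f (map ?h Cs)"
    if "f \<in> funs L" "length Cs = ?ar f" "set Cs \<subseteq> carr ?I1 ()" for f Cs
    using \<theta> that by (simp add: is_iso_unit)
  have rep1: "x \<in> tuples S ?xs1" if "x \<in> C" "C \<in> carr ?I1 ()" for x C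
    using class_eq[OF eq1] that unfolding carr1 by (blast dest: dom_set_tuples)
  have rep2: "x \<in> tuples S ?xs2" if "x \<in> C" "C \<in> carr ?I2 ()" for x C
    using class_eq[OF eq2] that unfolding carr2 by (blast dest: dom_set_tuples)
  obtain gs where gs: "set gs \<subseteq> carr A ()"
    "\<And>a. a \<in> carr A () \<Longrightarrow> \<exists>t. \<exists>bs \<in> lists (carr B ()).
        tm_in L (replicate (length gs + length bs) ()) t \<and> a = tm_val A (env (gs @ bs)) t"
    using gen unfolding fin_generated_over_def by blast
  \<comment> \<open>Variables of a term are evaluated at generators or at elements of
    \<open>B\<close>; the images of these are the classes over which pairs are initial.\<close>
  define X where "X = ?m ` carr B () \<union> ?m ` set gs"
  have X: "X \<subseteq> carr ?I1 ()" using m_carr gs(1) BA by (auto simp: X_def)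
  have "definable K S ?ts (rep_graph ?h X)"
    unfolding X_def using m_carr h_carr gs(1)
    by (intro definable_rep_graph_Un_finite[OF wf1 wf2 ok1 ok2 p1 p2 def]) auto
  then obtain r cs c where r: "fm_in K (?ts @ cs) r" "c \<in> tuples S cs"
    "rep_graph ?h X = {as \<in> tuples S ?ts. holds S r (as @ c)}"
    unfolding definable_def by blast
  \<comment> \<open>The final formula needs the parameters of the two interpretations and those
    defining the graph over \<open>X\<close>.\<close>
  define pq where "pq = ?ps1 @ ?ps2 @ cs"
  define q where "q = p1 @ p2 @ c"
  have q: "q \<in> tuples S pq" using p1 p2 r(2) by (simp add: q_def pq_def append_in_tuples)
  define G where "G as \<longleftrightarrow> holds S r
     (drop (length cs) (drop (length ?ps2) (drop (length ?ps1) as)) @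
      take (length cs) (drop (length ?ps2) (drop (length ?ps1) as)))" for as
  \<comment> \<open>The flat list holds the parameters, the argument pairs and the value pair; a
    pair is two representatives in a row, cut at \<open>?n1\<close>. Domain membership of the value
    is demanded separately, as the formula for a function symbol need not imply it.\<close>
  define R where "R f as \<longleftrightarrow>
     (let P1 = take (length ?ps1) as; P2 = take (length ?ps2) (drop (length ?ps1) as);
        rest = drop (length cs) (drop (length ?ps2) (drop (length ?ps1) as));
        zs = chop (length ?ts) (?ar f) (take (length (concat (replicate (?ar f) ?ts))) rest);
        z = drop (length (concat (replicate (?ar f) ?ts))) rest
      in (take ?n1 z \<in> dom_set \<Gamma>1 S P1 \<and> drop ?n1 z \<in> dom_set \<Gamma>2 S P2) \<and>
         fun_graph \<Gamma>1 S P1 f (map (take ?n1) zs) (take ?n1 z) \<and>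
         fun_graph \<Gamma>2 S P2 f (map (drop ?n1) zs) (drop ?n1 z))" for f as
  have Gq: "G (q @ z) \<longleftrightarrow> holds S r (z @ c)" for z
    using tuples_length[OF p1] tuples_length[OF p2] tuples_length[OF r(2)] by (simp add: G_def
        q_def)
  have Rq: "R f (q @ concat zs @ z) \<longleftrightarrow>
      (take ?n1 z \<in> dom_set \<Gamma>1 S p1 \<and> drop ?n1 z \<in> dom_set \<Gamma>2 S p2) \<and>
       fun_graph \<Gamma>1 S p1 f (map (take ?n1) zs) (take ?n1 z) \<and>
       fun_graph \<Gamma>2 S p2 f (map (drop ?n1) zs) (drop ?n1 z)"
    if "zs \<in> ntuples (?ar f) S ?ts" for f zs z
  proof -
    have "concat zs \<in> tuples S (concat (replicate (?ar f) ?ts))" "chop (length ?ts) (?ar f)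
        (concat zs) = zs"
      using concat_ntuples[OF that] by auto
    then show ?thesis
      using tuples_length[OF p1] tuples_length[OF p2] tuples_length[OF r(2)]
        tuples_length[of "concat zs" S "concat (replicate (?ar f) ?ts)"]
      by (simp add: R_def q_def Let_def)
  qed
  have G: "codefinable K S S (pq @ ?ts) G G"
  proof -
    note pr = coproj_id[of S S "?ps1 @ ?ps2 @ cs @ ?ts"]
    have "codefinable K S S (?ps1 @ ?ps2 @ cs @ ?ts) G G"
      unfolding G_def
      by (intro codefinable_holds[OF r(1)] coproj_append coproj_drop[OF coproj_drop[OF
          coproj_drop[OF pr]]]
          coproj_take[OF coproj_drop[OF coproj_drop[OF pr]]])
    then show ?thesis by (simp add: pq_def)
  qed
  have R: "codefinable K S S (pq @ concat (replicate (?ar f) ?ts) @ ?ts) (R f) (R f)"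
      if f: "f \<in> funs L" for f
  proof -
    let ?us = "concat (replicate (?ar f) ?ts)"
    note pr = coproj_id[of S S "?ps1 @ ?ps2 @ cs @ ?us @ ?ts"]
    note z = coproj_drop[OF coproj_drop[OF coproj_drop[OF coproj_drop[OF pr]]]]
      and zs = coprojs_chop[OF coproj_take[OF coproj_drop[OF coproj_drop[OF coproj_drop[OF pr]]]]]
      and P1 = coproj_take[OF pr] and P2 = coproj_take[OF coproj_drop[OF pr]]
    have "codefinable K S S (?ps1 @ ?ps2 @ cs @ ?us @ ?ts) (R f) (R f)"
      unfolding R_def Let_def
      by (intro codefinable_conj codefinable_dom_set[OF wf1 coproj_take[OF z] P1]
          codefinable_dom_set[OF wf2 coproj_drop[OF z] P2]
          codefinable_fun_graph[OF wf1 f refl coprojs_map_take[OF zs] coproj_take[OF z] P1]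
          codefinable_fun_graph[OF wf2 f refl coprojs_map_drop[OF zs] coproj_drop[OF z] P2])
    then show ?thesis by (simp add: pq_def)
  qed
  have "finite (funs L)" using fin by (simp add: finite_sig_def)
  from codefinable_derived[where ar = ?ar and R = R, OF this G[unfolded S_def K_def] R[unfolded
      S_def K_def]]
  obtain \<psi> where \<psi>: "fm_in K (?ts @ pq) \<psi>"
    "\<forall>q\<in>tuples S pq. \<forall>z\<in>tuples S ?ts. holds S \<psi> (z @ q) \<longleftrightarrow>
      derived (tuples S ?ts) (\<lambda>z. G (q @ z)) (funs L) ?ar (\<lambda>f zs z. R f (q @ concat zs @ z)) z"
    unfolding S_def K_def by blast
  let ?d = "derived (tuples S ?ts) (\<lambda>z. G (q @ z)) (funs L) ?ar (\<lambda>f zs z. R f (q @ concat zs @ z))"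
  have graph_pair: "z \<in> tuples S ?ts \<and> take ?n1 z = x \<and> drop ?n1 z = y"
    if "z = x @ y" "x \<in> C" "y \<in> ?h C" "C \<in> carr ?I1 ()" for x y z C
    using rep1[OF that(2,4)] rep2[OF that(3) h_carr[OF that(4)]] that(1)
    by (simp add: append_in_tuples tuples_length)
  have sound: "\<exists>C\<in>carr ?I1 (). take ?n1 z \<in> C \<and> drop ?n1 z \<in> ?h C" if "?d z" for z
    using that
  proof induction
    case (base z)
    then have "z \<in> rep_graph ?h X" unfolding r(3) Gq by simp
    then obtain x y C where C: "C \<in> X" "z = x @ y" "x \<in> C" "y \<in> ?h C"
      unfolding rep_graph_def by blast
    then have "C \<in> carr ?I1 ()" using X by blast
    with graph_pair[OF C(2-4) this] C show ?case by auto
  next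
    case (step f zs z)
    have zs: "zs \<in> ntuples (?ar f) S ?ts"
      using step.hyps(2) step.IH by (intro ntuplesI) (auto elim: derived.cases)
    have "\<exists>Cs. set Cs \<subseteq> carr ?I1 () \<and> list_all2 (\<in>) (map (take ?n1) zs) Cs \<and>
        list_all2 (\<in>) (map (drop ?n1) zs) (map ?h Cs)"
      using step.IH
    proof (induction zs)
      case (Cons z zs)
      then obtain C Cs where "C \<in> carr ?I1 ()" "take ?n1 z \<in> C" "drop ?n1 z \<in> ?h C"
          "set Cs \<subseteq> carr ?I1 ()"
        "list_all2 (\<in>) (map (take ?n1) zs) Cs" "list_all2 (\<in>) (map (drop ?n1) zs) (map ?h Cs)"
            by auto
      then show ?case by (intro exI[of _ "C # Cs"]) simp
    qed simp
    then obtain Cs where Cs: "set Cs \<subseteq> carr ?I1 ()" "list_all2 (\<in>) (map (take ?n1) zs) Cs"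
        "list_all2 (\<in>) (map (drop ?n1) zs) (map ?h Cs)" by blast
    have len: "length Cs = ?ar f" "length (map ?h Cs) = ?ar f"
      using list_all2_lengthD[OF Cs(2)] step.hyps by auto
    have hCs: "set (map ?h Cs) \<subseteq> carr ?I2 ()" using Cs(1) h_carr by auto
    note z = step.hyps(4)[unfolded Rq[OF zs]]
    \<comment> \<open>The coordinates lie in the values of the operation at \<open>Cs\<close> and at
      the images of \<open>Cs\<close>, and \<open>\<theta>\<close> takes the first value to the
      second.\<close>
    have "take ?n1 z \<in> fn ?I1 f Cs"
      using interp_fn(2)[OF ok1 step.hyps(1) len(1) Cs(1)[unfolded carr1] Cs(2)] z by blast
    moreover have "drop ?n1 z \<in> fn ?I2 f (map ?h Cs)"
      using interp_fn(2)[OF ok2 step.hyps(1) len(2) hCs[unfolded carr2] Cs(3)] z by blast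
    moreover have "fn ?I1 f Cs \<in> carr ?I1 ()"
      using interp_fn(1)[OF ok1 step.hyps(1) len(1) Cs(1)[unfolded carr1]] unfolding carr1 .
    ultimately show ?case using h_fn[OF step.hyps(1) len(1) Cs(1)] by auto
  qed
  have complete: "?d (x @ y)" if C: "C \<in> carr ?I1 ()" and xy: "x \<in> C" "y \<in> ?h C" for x y C
  proof -
    obtain a where a: "a \<in> carr A ()" "C = ?m a" using C m_surj by blast
    obtain t bs where t: "bs \<in> lists (carr B ())" "tm_in L (replicate (length gs + length bs) ()) t"
      "a = tm_val A (env (gs @ bs)) t" using gs(2)[OF a(1)] by blast
    let ?v = "tm_val A (env (gs @ bs))"
    \<comment> \<open>The claim covers all representatives of the value and of its image, since in
      the step for an operation the representatives of the arguments are chosen arbitrarily.\<close>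
    have val: "?v t \<in> carr A () \<and> (\<forall>x\<in>?m (?v t). \<forall>y\<in>?h (?m (?v t)). ?d (x @ y))"
      if "wf_tm L t" "tm_vars t \<subseteq> ctx_vars (replicate (length gs + length bs) ())" for t
      using that
    proof (induction t)
      case (Var s i)
      then have "i < length (gs @ bs)" by (auto simp: ctx_vars_def)
      then have "(gs @ bs) ! i \<in> set gs \<union> set bs" by (metis nth_mem set_append)
      then have v: "?v (Var s i) \<in> set gs \<union> carr B ()" using t(1) by (auto simp: env_def)
      then have vX: "?m (?v (Var s i)) \<in> X" by (auto simp: X_def)
      have "?d (x @ y)" if "x \<in> ?m (?v (Var s i))" "y \<in> ?h (?m (?v (Var s i)))" for x y
      proof -
        have "x @ y \<in> rep_graph ?h X" using vX that unfolding rep_graph_def by blast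
        then show ?thesis unfolding r(3) by (intro derived.base) (auto simp: Gq)
      qed
      then show ?case using v gs(1) BA by auto
    next
      case (App f us)
      let ?as = "map ?v us"
      have f: "f \<in> funs L" and len: "length us = ?ar f"
        using App.prems(1) by (auto dest: arg_cong[of _ _ length])
      have IH: "?v u \<in> carr A () \<and> (\<forall>x\<in>?m (?v u). \<forall>y\<in>?h (?m (?v u)). ?d (x @ y))" if "u \<in> set us"
          for u
        using App.IH[OF that] App.prems that by auto
      have as: "set ?as \<subseteq> carr A ()" "length ?as = ?ar f" using IH len by auto
      have "?as \<in> tuples A (fdom L f)" using as by (simp add: tuples_unit)
      then have v: "?v (App f us) \<in> carr A ()"
        using A f unfolding is_struc_def by simp
      let ?Cs = "map ?m ?as" and ?Ds = "map ?h (map ?m ?as)"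
      have Cs: "set ?Cs \<subseteq> carr ?I1 ()" "length ?Cs = ?ar f" using as m_carr by auto
      have Ds: "set ?Ds \<subseteq> carr ?I2 ()" "length ?Ds = ?ar f" using Cs h_carr by auto
      have mv: "?m (?v (App f us)) = fn ?I1 f ?Cs" using m_fn[OF f as(2,1)] by simp
      have hv: "?h (?m (?v (App f us))) = fn ?I2 f ?Ds" unfolding mv by (rule h_fn[OF f Cs(2,1)])
      obtain xs where xs: "list_all2 (\<in>) xs ?Cs" using reps_exist[OF eq1 Cs(1)[unfolded carr1]] by
          blast
      obtain ys where ys: "list_all2 (\<in>) ys ?Ds" using reps_exist[OF eq2 Ds(1)[unfolded carr2]] by
          blast
      \<comment> \<open>Chosen representatives of the arguments are paired with representatives of
        their images; the induction hypothesis derives each pair.\<close>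
      define zs where "zs = map2 (@) xs ys"
      have lens: "length xs = ?ar f" "length ys = ?ar f"
        using list_all2_lengthD[OF xs] list_all2_lengthD[OF ys] Cs(2) Ds(2) by auto
      have i: "?d (zs ! i) \<and> zs ! i \<in> tuples S ?ts \<and> take ?n1 (zs ! i) = xs ! i \<and>
          drop ?n1 (zs ! i) = ys ! i"
        if "i < ?ar f" for i
      proof -
        have u: "us ! i \<in> set us" using that len by simp
        have xi: "xs ! i \<in> ?m (?v (us ! i))" and yi: "ys ! i \<in> ?h (?m (?v (us ! i)))"
          using list_all2_nthD[OF xs, of i] list_all2_nthD[OF ys, of i] that len lens by auto
        have zi: "zs ! i = xs ! i @ ys ! i" using that lens by (simp add: zs_def)
        have "?m (?v (us ! i)) \<in> carr ?I1 ()" using IH[OF u] m_carr by blast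
        from graph_pair[OF zi xi yi this] IH[OF u] xi yi zi show ?thesis by auto
      qed
      have zlen: "length zs = ?ar f" using lens by (simp add: zs_def)
      have zs: "zs \<in> ntuples (?ar f) S ?ts" using i zlen by (simp add: ntuples_def)
      have maps: "map (take ?n1) zs = xs" "map (drop ?n1) zs = ys"
        using i zlen lens by (auto intro!: nth_equalityI)
      have "?d (x @ y)" if x: "x \<in> ?m (?v (App f us))" and y: "y \<in> ?h (?m (?v (App f us)))" for x y
      proof -
        have xy: "x @ y \<in> tuples S ?ts \<and> take ?n1 (x @ y) = x \<and> drop ?n1 (x @ y) = y"
          using graph_pair[OF refl x y m_carr[OF v]] .
        have "x \<in> dom_set \<Gamma>1 S p1 \<and> fun_graph \<Gamma>1 S p1 f xs x"
          using interp_fn(2)[OF ok1 f Cs(2) Cs(1)[unfolded carr1] xs] x unfolding mv by blast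
        moreover have "y \<in> dom_set \<Gamma>2 S p2 \<and> fun_graph \<Gamma>2 S p2 f ys y"
          using interp_fn(2)[OF ok2 f Ds(2) Ds(1)[unfolded carr2] ys] y unfolding hv by blast
        ultimately have "R f (q @ concat zs @ x @ y)" unfolding Rq[OF zs] maps using xy by simp
        moreover have "\<forall>z\<in>set zs. ?d z" using i zlen by (auto simp: in_set_conv_nth)
        ultimately show ?thesis using f zlen xy by (intro derived.step) auto
      qed
      then show ?case using v by blast
    qed
    show ?thesis using val[of t] t(2,3) a(2) xy by (auto simp: tm_in_def)
  qed
  have "holds S \<psi> (x @ y @ q) \<longleftrightarrow> (\<exists>C\<in>carr ?I1 (). x \<in> C \<and> y \<in> ?h C)"
    if "x \<in> tuples S ?xs1" "y \<in> tuples S ?xs2" for x y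
  proof -
    have xy: "x @ y \<in> tuples S ?ts" using that by (simp add: append_in_tuples)
    then have "holds S \<psi> (x @ y @ q) \<longleftrightarrow> ?d (x @ y)" using \<psi>(2) q by fastforce
    then show ?thesis using sound[of "x @ y"] complete tuples_length[OF that(1)] by auto
  qed
  then have "iso_graph L \<Gamma>1 \<Gamma>2 S p1 p2 (\<lambda>x y. holds S \<psi> (x @ y @ q))"
    by (intro iso_graph_if_is_iso[OF ok1 ok2 \<theta>]) auto
  then show ?thesis using \<psi>(1) q by (intro exI[of _ \<psi>] exI[of _ pq] bexI[of _ q]) auto
qed

section \<open>Transfer to elementarily equivalent structures\<close>

theorem theorem2p30:
  fixes L :: "(unit, 'f, 'r) sig"
    and A B :: "('a, unit, 'f, 'r) struc"
    and \<Gamma>1 \<Gamma>2 :: "(lsort, 'f, 'r, 'f lfun, 'r lrel) icode"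
    and \<phi>1 \<phi>2 :: "(lsort, 'f lfun, 'r lrel) fm"
    and M :: "('m, lsort, 'f lfun, 'r lrel) struc"
  assumes "finite_sig L"
    and "is_struc L A"
    and "definable_substruc L B A"
    and "fin_generated_over L A B"
    and "regularly_interpreted L (list_sig L) A \<Gamma>1 \<phi>1 (list_super B)"
    and "regularly_interpreted L (list_sig L) A \<Gamma>2 \<phi>2 (list_super B)"
    and "\<exists>p1 \<in> solutions (list_super B) (psorts \<Gamma>1) \<phi>1. \<exists>p2 \<in> solutions (list_super B) (psorts \<Gamma>2) \<phi>2.
           \<exists>\<mu> \<theta>. is_iso L \<mu> A (interp \<Gamma>1 (list_super B) p1) \<and>
             is_iso L \<theta> (interp \<Gamma>1 (list_super B) p1) (interp \<Gamma>2 (list_super B) p2) \<and>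
             definable (list_sig L) (list_super B) (xsorts \<Gamma>1 @ xsorts \<Gamma>2)
               (rep_graph (\<theta> ()) (\<mu> () ` carr B ()))"
    and "is_struc (list_sig L) M"
    and "elem_equiv (list_sig L) M (list_super B)"
  shows "codes_strucs L \<Gamma>1 \<phi>1 M \<and> codes_strucs L \<Gamma>2 \<phi>2 M \<and>
    (\<exists>p1 \<in> solutions M (psorts \<Gamma>1) \<phi>1. \<exists>p2 \<in> solutions M (psorts \<Gamma>2) \<phi>2.
       isomorphic L (interp \<Gamma>1 M p1) (interp \<Gamma>2 M p2)) \<and>
    (well_defined L \<Gamma>1 \<phi>1 M \<and> well_defined L \<Gamma>2 \<phi>2 M \<longrightarrow>
       (\<forall>p1 \<in> solutions M (psorts \<Gamma>1) \<phi>1. \<forall>p2 \<in> solutions M (psorts \<Gamma>2) \<phi>2.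
          isomorphic L (interp \<Gamma>1 M p1) (interp \<Gamma>2 M p2)))"
proof -
  let ?S = "list_super B" and ?K = "list_sig L"
  have wf1: "wf_code L ?K \<Gamma>1" and \<phi>1: "fm_in ?K (psorts \<Gamma>1) \<phi>1" and c1: "codes_strucs L \<Gamma>1 \<phi>1 ?S"
    and wf2: "wf_code L ?K \<Gamma>2" and \<phi>2: "fm_in ?K (psorts \<Gamma>2) \<phi>2" and c2: "codes_strucs L \<Gamma>2 \<phi>2 ?S"
    using assms(5,6) by (auto simp: regularly_interpreted_def)
  have BA: "carr B () \<subseteq> carr A ()" using assms(3) by (auto simp: definable_substruc_def
      substruc_def)
  have M1: "codes_strucs L \<Gamma>1 \<phi>1 M"
    using codefinable_sentence[OF codefinable_codes_strucs[OF assms(1) wf1 \<phi>1] assms(9)] c1 by simp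
  have M2: "codes_strucs L \<Gamma>2 \<phi>2 M"
    using codefinable_sentence[OF codefinable_codes_strucs[OF assms(1) wf2 \<phi>2] assms(9)] c2 by simp
  obtain p1 p2 \<mu> \<theta> where p: "p1 \<in> solutions ?S (psorts \<Gamma>1) \<phi>1" "p2 \<in> solutions ?S (psorts \<Gamma>2) \<phi>2"
    "is_iso L \<mu> A (interp \<Gamma>1 ?S p1)" "is_iso L \<theta> (interp \<Gamma>1 ?S p1) (interp \<Gamma>2 ?S p2)"
    "definable ?K ?S (xsorts \<Gamma>1 @ xsorts \<Gamma>2) (rep_graph (\<theta> ()) (\<mu> () ` carr B ()))"
    using assms(7) by blast
  have ok: "code_ok L \<Gamma>1 ?S p1" "code_ok L \<Gamma>2 ?S p2" using c1 c2 p(1,2)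
      by (auto simp: codes_strucs_def)
  have pt: "p1 \<in> tuples ?S (psorts \<Gamma>1)" "holds ?S \<phi>1 p1" "p2 \<in> tuples ?S (psorts \<Gamma>2)"
      "holds ?S \<phi>2 p2"
    using p(1,2) by (auto simp: solutions_def)
  obtain \<psi> qs q where \<psi>: "q \<in> tuples ?S qs" "fm_in ?K (xsorts \<Gamma>1 @ xsorts \<Gamma>2 @ qs) \<psi>"
    "iso_graph L \<Gamma>1 \<Gamma>2 ?S p1 p2 (\<lambda>x y. holds ?S \<psi> (x @ y @ q))"
    using definable_isomorphism[OF assms(1,2) BA assms(4) wf1 wf2 ok pt(1,3) p(3-5)] by blast
  \<comment> \<open>The formulas \<open>\<phi>1\<close> and \<open>\<phi>2\<close> are part of the
    sentence, so that the witnesses found in \<open>M\<close> are admissible parameters for the two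
    interpretations.\<close>
  have "codefinable ?K M ?S []
    (\<lambda>_. \<exists>p1\<in>tuples M (psorts \<Gamma>1). \<exists>p2\<in>tuples M (psorts \<Gamma>2). \<exists>q\<in>tuples M qs.
       holds M \<phi>1 p1 \<and> holds M \<phi>2 p2 \<and> iso_graph L \<Gamma>1 \<Gamma>2 M p1 p2 (\<lambda>x y. holds M \<psi> (x @ y @ q)))
    (\<lambda>_. \<exists>p1\<in>tuples ?S (psorts \<Gamma>1). \<exists>p2\<in>tuples ?S (psorts \<Gamma>2). \<exists>q\<in>tuples ?S qs.
       holds ?S \<phi>1 p1 \<and> holds ?S \<phi>2 p2 \<and> iso_graph L \<Gamma>1 \<Gamma>2 ?S p1 p2 (\<lambda>x y. holds ?S \<psi> (x @ y @ q)))"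
    by (rule codefinable_ex codefinable_conj codefinable_holds[OF \<phi>1] codefinable_holds[OF \<phi>2]
        codefinable_iso_graph[OF assms(1) wf1 wf2 \<psi>(2)] coproj_after coproj_before)+
  from codefinable_sentence[OF this assms(9)]
  have "\<exists>p1\<in>tuples M (psorts \<Gamma>1). \<exists>p2\<in>tuples M (psorts \<Gamma>2). \<exists>q\<in>tuples M qs.
       holds M \<phi>1 p1 \<and> holds M \<phi>2 p2 \<and> iso_graph L \<Gamma>1 \<Gamma>2 M p1 p2 (\<lambda>x y. holds M \<psi> (x @ y @ q))"
    using pt \<psi>(1,3) by blast
  then obtain r1 r2 s where r: "r1 \<in> solutions M (psorts \<Gamma>1) \<phi>1" "r2 \<in> solutions M (psorts \<Gamma>2) \<phi>2"
    "iso_graph L \<Gamma>1 \<Gamma>2 M r1 r2 (\<lambda>x y. holds M \<psi> (x @ y @ s))"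
    unfolding solutions_def by blast
  have ok1: "code_ok L \<Gamma>1 M p" if "p \<in> solutions M (psorts \<Gamma>1) \<phi>1" for p
    using M1 that by (simp add: codes_strucs_def)
  have ok2: "code_ok L \<Gamma>2 M p" if "p \<in> solutions M (psorts \<Gamma>2) \<phi>2" for p
    using M2 that by (simp add: codes_strucs_def)
  have iso: "isomorphic L (interp \<Gamma>1 M r1) (interp \<Gamma>2 M r2)"
    by (rule isomorphic_if_iso_graph[OF ok1[OF r(1)] ok2[OF r(2)] r(3)])
  moreover have "isomorphic L (interp \<Gamma>1 M q1) (interp \<Gamma>2 M q2)"
    if "well_defined L \<Gamma>1 \<phi>1 M" "well_defined L \<Gamma>2 \<phi>2 M"
      "q1 \<in> solutions M (psorts \<Gamma>1) \<phi>1" "q2 \<in> solutions M (psorts \<Gamma>2) \<phi>2" for q1 q2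
  proof -
    \<comment> \<open>Well-definedness links arbitrary parameters to the witnesses \<open>r1\<close>
      and \<open>r2\<close>, on either side of the one isomorphism found.\<close>
    have "isomorphic L (interp \<Gamma>1 M q1) (interp \<Gamma>1 M r1)" "isomorphic L (interp \<Gamma>2 M r2)
        (interp \<Gamma>2 M q2)"
      using that r(1,2) by (auto simp: well_defined_def)
    then show ?thesis using iso isomorphic_trans by blast
  qed
  ultimately show ?thesis using M1 M2 r(1,2) by blast
qed

end
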